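(* If a spacetime $(M,g)$ has no lightlike lines, then the relation $A^+=\overline{J^+}$ is transitive, and hence $K^+=A^+$. Moreover, if $(M,g)$ is in addition chronological, then $(M,g)$ is $K$-causal.
   Context: Spacetime: connected time-oriented Lorentzian manifold. $J^+=\{(p,q): p=q$ or there is a future-directed causal curve from $p$ to $q\}\subset M\times M$, $A^+$ its closure in $M\times M$. $K^+$ is the smallest closed and transitive relation containing $J^+$; $K$-causal means $K^+$ is antisymmetric. Chronological: no closed timelike curve. A lightlike line is an achronal inextendible causal curve (achronal: no two points joined by a timelike curve). *)

theory Defs
  imports "HOL-Analysis.Analysis"
begin

text \<open>Iterated directional (Frechet) derivatives.  A map on an open set is C-infinity iff
  all its iterated directional derivatives exist (are differentiable) at every point.\<close>

fun dirderivs :: "'a::euclidean_space list \<Rightarrow> ('a \<Rightarrow> 'b::real_normed_vector) \<Rightarrow> ('a \<Rightarrow> 'b)" where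
  "dirderivs [] f = f"
| "dirderivs (v # vs) f = (\<lambda>x. frechet_derivative (dirderivs vs f) (at x) v)"

definition smooth_on :: "'a::euclidean_space set \<Rightarrow> ('a \<Rightarrow> 'b::real_normed_vector) \<Rightarrow> bool" where
  "smooth_on S f \<longleftrightarrow> open S \<and> (\<forall>vs. \<forall>x\<in>S. dirderivs vs f differentiable (at x))"

type_synonym ('m, 'e) chart = "'m set \<times> ('m \<Rightarrow> 'e)"

definition transition :: "('m, 'e) chart \<Rightarrow> ('m, 'e) chart \<Rightarrow> 'e \<Rightarrow> 'e" where
  "transition c d = snd d \<circ> inv_into (fst c) (snd c)"

definition smooth_atlas :: "('m::topological_space, 'e::euclidean_space) chart set \<Rightarrow> bool" where
  "smooth_atlas A \<longleftrightarrow>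
     (\<forall>(U, \<phi>) \<in> A. open U \<and> inj_on \<phi> U \<and> open (\<phi> ` U) \<and> continuous_on U \<phi>
                    \<and> continuous_on (\<phi> ` U) (inv_into U \<phi>))
   \<and> (\<Union>(fst ` A) = UNIV)
   \<and> (\<forall>c\<in>A. \<forall>d\<in>A. smooth_on (snd c ` (fst c \<inter> fst d)) (transition c d))"

definition minkowski_form :: "'e::euclidean_space \<Rightarrow> 'e \<Rightarrow> 'e \<Rightarrow> real" where
  "minkowski_form e u w = (\<Sum>b\<in>Basis. (if b = e then -1 else 1) * (u \<bullet> b) * (w \<bullet> b))"

text \<open>A symmetric bilinear form of Lorentzian signature (-,+,...,+): in some basis it is
  the Minkowski form (Sylvester).\<close>
definition lorentzian_form :: "('e::euclidean_space \<Rightarrow> 'e \<Rightarrow> real) \<Rightarrow> bool" where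
  "lorentzian_form B \<longleftrightarrow> bilinear B \<and> (\<forall>u w. B u w = B w u)
     \<and> (\<exists>(L::'e \<Rightarrow> 'e) (e::'e). linear L \<and> bij L \<and> e \<in> Basis \<and> (\<forall>u w. B (L u) (L w) = minkowski_form e u w))"

text \<open>The metric g is given by its coordinate representation: gm c x is the bilinear form
  on coordinate vectors at the coordinate point x of chart c.  T is the coordinate representation
  of a continuous timelike vector field fixing the time orientation.\<close>

definition spacetime ::
  "('m::{t2_space, second_countable_topology}, 'e::euclidean_space) chart set
   \<Rightarrow> (('m, 'e) chart \<Rightarrow> 'e \<Rightarrow> 'e \<Rightarrow> 'e \<Rightarrow> real) \<Rightarrow> (('m, 'e) chart \<Rightarrow> 'e \<Rightarrow> 'e) \<Rightarrow> bool" where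
  "spacetime A gm T \<longleftrightarrow>
     connected (UNIV :: 'm set) \<and> DIM('e) \<ge> 2 \<and> smooth_atlas A
   \<and> (\<forall>c\<in>A. \<forall>x\<in>snd c ` fst c. lorentzian_form (gm c x))
   \<and> (\<forall>c\<in>A. \<forall>u w. smooth_on (snd c ` fst c) (\<lambda>x. gm c x u w))
   \<and> (\<forall>c\<in>A. \<forall>d\<in>A. \<forall>x\<in>snd c ` (fst c \<inter> fst d). \<forall>u w.
        gm c x u w = gm d (transition c d x) (frechet_derivative (transition c d) (at x) u)
                                              (frechet_derivative (transition c d) (at x) w))
   \<and> (\<forall>c\<in>A. continuous_on (snd c ` fst c) (T c))
   \<and> (\<forall>c\<in>A. \<forall>x\<in>snd c ` fst c. gm c x (T c x) (T c x) < 0)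
   \<and> (\<forall>c\<in>A. \<forall>d\<in>A. \<forall>x\<in>snd c ` (fst c \<inter> fst d).
        T d (transition c d x) = frechet_derivative (transition c d) (at x) (T c x))"

definition fd_causal_vec :: "(('m, 'e) chart \<Rightarrow> 'e \<Rightarrow> 'e \<Rightarrow> 'e \<Rightarrow> real) \<Rightarrow> (('m, 'e) chart \<Rightarrow> 'e \<Rightarrow> 'e)
   \<Rightarrow> ('m, 'e::euclidean_space) chart \<Rightarrow> 'e \<Rightarrow> 'e \<Rightarrow> bool" where
  "fd_causal_vec gm T c x v \<longleftrightarrow> v \<noteq> 0 \<and> gm c x v v \<le> 0 \<and> gm c x v (T c x) < 0"

definition fd_timelike_vec :: "(('m, 'e) chart \<Rightarrow> 'e \<Rightarrow> 'e \<Rightarrow> 'e \<Rightarrow> real) \<Rightarrow> (('m, 'e) chart \<Rightarrow> 'e \<Rightarrow> 'e)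
   \<Rightarrow> ('m, 'e::euclidean_space) chart \<Rightarrow> 'e \<Rightarrow> 'e \<Rightarrow> bool" where
  "fd_timelike_vec gm T c x v \<longleftrightarrow> gm c x v v < 0 \<and> gm c x v (T c x) < 0"

definition ae_curve ::
  "('m::topological_space, 'e::euclidean_space) chart set \<Rightarrow> (('m, 'e) chart \<Rightarrow> 'e \<Rightarrow> 'e \<Rightarrow> bool)
   \<Rightarrow> (real \<Rightarrow> 'm) \<Rightarrow> real \<Rightarrow> real \<Rightarrow> bool" where
  "ae_curve A P \<gamma> a b \<longleftrightarrow> a < b \<and> continuous_on {a..b} \<gamma> \<and>
     (\<forall>c\<in>A. \<forall>s t. a \<le> s \<and> s < t \<and> t \<le> b \<and> \<gamma> ` {s..t} \<subseteq> fst c \<longrightarrow>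
        (\<exists>L. lipschitz_on L {s..t} (snd c \<circ> \<gamma>)) \<and>
        (\<exists>N. negligible N \<and> (\<forall>r\<in>{s<..<t} - N. \<exists>v.
            ((snd c \<circ> \<gamma>) has_vector_derivative v) (at r) \<and> P c (snd c (\<gamma> r)) v)))"

definition causal_curve where
  "causal_curve A gm T \<gamma> a b \<longleftrightarrow> ae_curve A (fd_causal_vec gm T) \<gamma> a b"

definition timelike_curve where
  "timelike_curve A gm T \<gamma> a b \<longleftrightarrow> ae_curve A (fd_timelike_vec gm T) \<gamma> a b"

definition Jplus where
  "Jplus A gm T = {(p, q). p = q \<or> (\<exists>\<gamma> a b. causal_curve A gm T \<gamma> a b \<and> \<gamma> a = p \<and> \<gamma> b = q)}"

definition Iplus where
  "Iplus A gm T = {(p, q). \<exists>\<gamma> a b. timelike_curve A gm T \<gamma> a b \<and> \<gamma> a = p \<and> \<gamma> b = q}"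

definition Aplus where
  "Aplus A gm T = closure (Jplus A gm T)"

definition Kplus where
  "Kplus A gm T = \<Inter>{R. closed R \<and> trans R \<and> Jplus A gm T \<subseteq> R}"

definition K_causal where
  "K_causal A gm T \<longleftrightarrow> antisym (Kplus A gm T)"

definition chronological where
  "chronological A gm T \<longleftrightarrow> \<not> (\<exists>\<gamma> a b. timelike_curve A gm T \<gamma> a b \<and> \<gamma> a = \<gamma> b)"

definition achronal where
  "achronal A gm T S \<longleftrightarrow> (\<forall>p\<in>S. \<forall>q\<in>S. (p, q) \<notin> Iplus A gm T)"

definition inextendible_causal_curve where
  "inextendible_causal_curve A gm T \<gamma> I \<longleftrightarrow>
     is_interval I \<and> (\<exists>a b. a < b \<and> {a..b} \<subseteq> I)
   \<and> (\<forall>a b. a < b \<and> {a..b} \<subseteq> I \<longrightarrow> causal_curve A gm T \<gamma> a b)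
   \<and> \<not> (\<exists>p. (\<gamma> \<longlongrightarrow> p) (if bdd_above I then at_left (Sup I) else at_top))
   \<and> \<not> (\<exists>p. (\<gamma> \<longlongrightarrow> p) (if bdd_below I then at_right (Inf I) else at_bot))"

definition lightlike_line where
  "lightlike_line A gm T \<gamma> I \<longleftrightarrow> inextendible_causal_curve A gm T \<gamma> I \<and> achronal A gm T (\<gamma> ` I)"

end

theory Submission
  imports Defs "HOL-Complex_Analysis.Great_Picard"
begin

text \<open>
  Write \<open>J\<close> and \<open>I\<close> for the causal and the chronological relation and \<open>A\<^sup>+\<close> for the closure of \<open>J\<close>.
  If \<open>(y, z) \<in> A\<^sup>+\<close> but \<open>(y, z) \<notin> J\<close>, then limits of causal curves inside compact coordinate balls,
  taken one ball after the other, give a future inextendible causal curve from \<open>y\<close> all of whose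
  points \<open>q\<close> satisfy \<open>(q, z) \<in> A\<^sup>+\<close>; dually for \<open>(x, y) \<in> A\<^sup>+\<close>. Two such curves through \<open>y\<close> form
  an inextendible curve, which is not achronal if there are no lightlike lines; so some of its
  points satisfy \<open>(p, q) \<in> I\<close>, and by push-up one may take \<open>p\<close> before and \<open>q\<close> after \<open>y\<close>. As \<open>I\<close> is
  open, \<open>(x, p) \<in> A\<^sup>+\<close>, \<open>(p, q) \<in> I\<close> and \<open>(q, z) \<in> A\<^sup>+\<close> give \<open>(x, z) \<in> A\<^sup>+\<close>. If \<open>x \<noteq> y\<close> are
  \<open>A\<^sup>+\<close>-related in both directions, the same construction within their class gives \<open>(p, q) \<in> I\<close>
  and \<open>(q, p) \<in> A\<^sup>+\<close>, hence a closed timelike curve.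

  Timelike curves are only almost everywhere timelike here. Openness of \<open>I\<close> still holds because
  such a curve has at least one point with a timelike derivative, where straight coordinate
  segments enter the interior of \<open>I\<close>, and the interior of \<open>I\<close> is stable under push-up.
\<close>

subsection \<open>Lipschitz functions of one real variable\<close>

text \<open>Two obstacles shape the limit argument. A limit of curves comes with no derivative, so
  Lipschitz functions must first be shown differentiable almost everywhere. And derivatives need not
  converge along the sequence; the future causal cone is therefore described by linear inequalities,
  a nonzero \<open>v\<close> belonging to it iff its product with every future timelike
  \<open>w\<close> is at most 0. Each inequality becomes a bound on chords of the curves, and this
  bound survives the limit. The uniform Lipschitz constant that compactness asks for comes from
  parametrising by a linear function which controls Euclidean length on causal vectors. Push-up uses
  no geodesics but an explicit perturbation of a causal curve inside one chart. It tolerates small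
  shifts of both endpoints, so it yields points of \<open>interior I\<close> before \<open>I\<close>
  is known to be open. Inextendible curves are handled as sequences of causally related points: only
  failure to converge matters, and curves through these points are inserted at the very end.\<close>

lemma negligible_lipschitz_image:
  fixes f :: "real \<Rightarrow> real"
  assumes "negligible N" "L-lipschitz_on N f"
  shows "negligible (f ` N)"
proof (rule negligible_locally_Lipschitz_image)
  show "DIM(real) \<le> DIM(real)" by simp
  show "negligible N" by fact
  show "\<exists>U B. open U \<and> x \<in> U \<and> (\<forall>y \<in> N \<inter> U. norm (f y - f x) \<le> B * norm (y - x))" if "x \<in> N" for x
    using that lipschitz_on_normD[OF assms(2)] by (intro exI[of _ UNIV] exI[of _ L]) blast
qed

text \<open>The exceptional set has a negligible image, so some intermediate value is attained for the
  last time at a point where the derivative is positive.\<close>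
lemma lipschitz_ae_pos_deriv_less:
  fixes g :: "real \<Rightarrow> real"
  assumes "a < b" and lip: "L-lipschitz_on {a..b} g" and N: "negligible N"
    and d: "\<And>x. x \<in> {a<..<b} - N \<Longrightarrow> \<exists>v. (g has_vector_derivative v) (at x) \<and> v > 0"
  shows "g a \<le> g b"
proof (rule ccontr)
  assume "\<not> g a \<le> g b"
  then have lt: "g b < g a" by simp
  have cont: "continuous_on {a..b} g" using lip by (rule lipschitz_on_continuous_on)
  have "negligible (g ` ({a..b} \<inter> N))"
    by (rule negligible_lipschitz_image[of _ L])
      (auto intro: negligible_subset[OF N] lipschitz_on_subset[OF lip])
  moreover have "\<not> negligible {g b<..<g a}"
    using lt by (simp add: open_not_negligible)
  ultimately obtain y where y: "y \<in> {g b<..<g a}" "y \<notin> g ` ({a..b} \<inter> N)"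
    by (meson negligible_subset subsetI)
  define S where "S = {x\<in>{a..b}. g x = y}"
  have "\<exists>x\<ge>a. x \<le> b \<and> g x = y"
    using y \<open>a < b\<close> cont by (intro IVT2') auto
  then have ne: "S \<noteq> {}" by (auto simp: S_def)
  have "closed S" unfolding S_def
    by (rule continuous_closed_preimage_constant[OF cont]) auto
  then have "compact S" by (metis (no_types, lifting) S_def compact_Icc compact_Int_closed inf.absorb_iff2 mem_Collect_eq subsetI)
  then obtain x where x: "x \<in> S" "\<And>x'. x' \<in> S \<Longrightarrow> x' \<le> x"
    using ne compact_attains_sup by metis
  have xab: "x \<in> {a<..<b}" "g x = y" "x \<notin> N"
    using x(1) y unfolding S_def by (auto simp: less_le)
  obtain v where v: "(g has_vector_derivative v) (at x)" "v > 0" using d xab by blast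
  have "(g has_real_derivative v) (at x)" using v by (simp add: has_real_derivative_iff_has_vector_derivative)
  then obtain e where e: "e > 0" "\<And>h. 0 < h \<Longrightarrow> h < e \<Longrightarrow> g x < g (x + h)"
    using has_real_derivative_pos_inc_right[of g v x UNIV] v(2) by auto
  define h where "h = min (e/2) ((b-x)/2)"
  have h: "0 < h" "h < e" "x + h < b" using e(1) xab by (auto simp: h_def min_def field_simps)
  have "\<exists>z\<ge>x+h. z \<le> b \<and> g z = y"
    using y e(2)[OF h(1,2)] h xab by (intro IVT2') (auto intro: continuous_on_subset[OF cont])
  then obtain z where "z \<ge> x + h" "z \<le> b" "g z = y" by blast
  then have "z \<in> S" using xab h by (auto simp: S_def)
  then show False using x(2) h \<open>z \<ge> x + h\<close> by fastforce
qed

text \<open>Adding \<open>e * x\<close> with \<open>e > 0\<close> makes the derivative positive, and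
  the error \<open>e * (b - a)\<close> disappears with \<open>e\<close>. Monotonicity from a
  derivative that exists only almost everywhere takes the place of integration along curves.\<close>

lemma lipschitz_ae_nonneg_deriv_le:
  fixes g :: "real \<Rightarrow> real"
  assumes "a \<le> b" and lip: "L-lipschitz_on {a..b} g" and N: "negligible N"
    and d: "\<And>x. x \<in> {a<..<b} - N \<Longrightarrow> \<exists>v. (g has_vector_derivative v) (at x) \<and> v \<ge> 0"
  shows "g a \<le> g b"
proof (cases "a = b")
  case False
  then have ab: "a < b" using assms by simp
  have "g a - g b \<le> e * (b - a)" if e: "e > 0" for e
  proof -
    have "(g a + e * a) \<le> (g b + e * b)"
    proof (rule lipschitz_ae_pos_deriv_less[OF ab _ N])
      show "(L + e * 1)-lipschitz_on {a..b} (\<lambda>x. g x + e * x)"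
        using e by (intro lipschitz_intros lip) auto
      fix x assume "x \<in> {a<..<b} - N"
      then obtain v where v: "(g has_vector_derivative v) (at x)" "v \<ge> 0" using d by blast
      have "((\<lambda>x. g x + e * x) has_vector_derivative (v + e)) (at x)"
        using v by (auto intro!: derivative_eq_intros simp flip: has_real_derivative_iff_has_vector_derivative)
      then show "\<exists>v. ((\<lambda>x. g x + e * x) has_vector_derivative v) (at x) \<and> v > 0"
        using v e by (intro exI[of _ "v+e"]) auto
    qed
    then show ?thesis by (simp add: algebra_simps)
  qed
  then have "g a - g b \<le> (e / (b - a)) * (b - a)" if "e > 0" for e
    using that ab by (metis diff_gt_0_iff_gt divide_pos_pos)
  then have "g a - g b \<le> 0 + e" if "e > 0" for e using that ab by (simp split: if_splits)
  then have "g a - g b \<le> 0" by (rule field_le_epsilon)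
  then show ?thesis by simp
qed auto

section \<open>Differentiability almost everywhere of Lipschitz functions, by Vitali
  covering\<close>

lemma negligible_UN_countable:
  assumes "countable I" "\<And>i. i \<in> I \<Longrightarrow> negligible (N i)"
  shows "negligible (\<Union>i\<in>I. N i)"
  using assms by (auto simp: negligible_iff_null_sets intro: null_sets_UN')

text \<open>The intervals of slope at most \<open>u\<close> form a fine cover of \<open>E\<close>,
  so countably many disjoint ones cover it up to a null set, whose image is null because
  \<open>g\<close> is Lipschitz. Each image interval is at most \<open>u\<close> times as long, and
  keeping all intervals inside an open \<open>U\<close> slightly larger than \<open>E\<close> bounds
  their total length.\<close>

lemma emeasure_image_le_slope:
  fixes g h :: "real \<Rightarrow> real"
  assumes gh: "\<And>x. g (h x) = x" "\<And>x. h (g x) = x"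
    and mono: "strict_mono g" and lip: "L-lipschitz_on UNIV g"
    and E: "E \<in> sets lebesgue" and "u > 0"
    and slope: "\<And>x d. x \<in> E \<Longrightarrow> d > 0 \<Longrightarrow>
      \<exists>p q. p \<le> x \<and> x \<le> q \<and> p < q \<and> q - p < d \<and> g q - g p \<le> u * (q - p)"
  shows "emeasure lebesgue (g ` E) \<le> ennreal u * emeasure lebesgue E"
proof (rule ennreal_le_epsilon)
  fix e :: real assume "e > 0"
  then have "e / u > 0" using \<open>u > 0\<close> by simp
  obtain U where U: "open U" "E \<subseteq> U" "(U - E) \<in> lmeasurable" "emeasure lebesgue (U - E) < ennreal (e / u)"
    using sets_lebesgue_outer_open[OF E \<open>e / u > 0\<close>] by blast
  \<comment> \<open>The index set consists of the admissible intervals. The covering theorem speaks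
    of balls, so \<open>a\<close> and \<open>r\<close> give midpoint and radius; the balls need not
    be centred in \<open>E\<close>, hence \<open>x\<close> may be an endpoint.\<close>
  define K where "K = {(p, q). p < q \<and> {p..q} \<subseteq> U \<and> g q - g p \<le> u * (q - p)}"
  define a where "a = (\<lambda>(p::real, q). (p + q) / 2)"
  define r where "r = (\<lambda>(p::real, q). (q - p) / 2)"
  have cb: "cball (a i) (r i) = {fst i..snd i}" for i
    by (cases i) (auto simp: a_def r_def cball_eq_atLeastAtMost field_simps)
  have cov: "\<exists>i. i \<in> K \<and> x \<in> cball (a i) (r i) \<and> r i < d" if x: "x \<in> E" "d > 0" for x d
  proof -
    obtain e where e: "e > 0" "ball x e \<subseteq> U" using U x by (meson openE subsetD)
    obtain p q where pq: "p \<le> x" "x \<le> q" "p < q" "q - p < min d e" "g q - g p \<le> u * (q - p)"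
      using slope[OF x(1), of "min d e"] x e by auto
    have "{p..q} \<subseteq> ball x e" using pq by (auto simp: dist_real_def)
    then have "(p, q) \<in> K" using pq e by (auto simp: K_def)
    then show ?thesis using pq by (intro exI[of _ "(p,q)"]) (auto simp: cb, auto simp: r_def)
  qed
  have r0: "\<And>i. i \<in> K \<Longrightarrow> 0 < r i" by (auto simp: K_def r_def)
  obtain C where C: "countable C" "C \<subseteq> K"
     "pairwise (\<lambda>i j. disjnt (cball (a i) (r i)) (cball (a j) (r j))) C"
     "negligible(E - (\<Union>i \<in> C. cball (a i) (r i)))"
    using Vitali_covering_theorem_cballs[of K r E a, OF r0 cov] by blast
  define X where "X = (\<lambda>i. {fst i..snd i :: real})"
  have imX: "g ` X i = {g (fst i)..g (snd i)}" if "i \<in> C" for i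
  proof -
    have "y \<in> g ` X i" if "g (fst i) \<le> y" "y \<le> g (snd i)" for y
    proof -
      have "y = g (h y)" by (simp add: gh)
      moreover have "fst i \<le> h y" "h y \<le> snd i"
        using that by (metis gh(1) mono strict_mono_less_eq)+
      ultimately show ?thesis by (auto simp: X_def)
    qed
    then show ?thesis using mono by (auto simp: X_def strict_mono_less_eq)
  qed
  have dX: "disjoint_family_on X C"
    using C(3) by (auto simp: disjoint_family_on_def pairwise_def disjnt_def cb X_def)
  have "inj g" using mono by (rule strict_mono_imp_inj_on)
  then have dgX: "disjoint_family_on (\<lambda>i. g ` X i) C"
    using dX unfolding disjoint_family_on_def by (metis image_Int image_empty)
  have len: "emeasure lebesgue (g ` X i) \<le> ennreal u * emeasure lebesgue (X i)" if "i \<in> C" for i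
  proof -
    have i: "fst i < snd i" "g (snd i) - g (fst i) \<le> u * (snd i - fst i)"
      using that C(2) by (auto simp: K_def)
    then have "g (fst i) \<le> g (snd i)" using mono by (simp add: strict_mono_less_eq)
    then have "emeasure lebesgue (g ` X i) = ennreal (g (snd i) - g (fst i))"
      by (simp add: imX[OF that])
    also have "\<dots> \<le> ennreal (u * (snd i - fst i))" using i by (intro ennreal_leI)
    also have "\<dots> = ennreal u * ennreal (snd i - fst i)" using i \<open>u > 0\<close> by (intro ennreal_mult) auto
    also have "ennreal (snd i - fst i) = emeasure lebesgue (X i)" using i by (simp add: X_def)
    finally show ?thesis .
  qed
  have null: "negligible (g ` (E - (\<Union>i\<in>C. X i)))"
    using C(4) by (intro negligible_lipschitz_image[where L=L] lipschitz_on_subset[OF lip]) (auto simp: cb X_def)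
  have XU: "X i \<subseteq> U" if "i \<in> C" for i
    using subsetD[OF C(2) that] by (simp add: K_def X_def case_prod_beta)
  have mX: "X i \<in> sets lebesgue" for i by (simp add: X_def)
  have mgX: "g ` X i \<in> sets lebesgue" if "i \<in> C" for i using imX[OF that] by simp
  have "g ` E \<subseteq> (\<Union>i\<in>C. g ` X i) \<union> g ` (E - (\<Union>i\<in>C. X i))" by blast
  then have "emeasure lebesgue (g ` E) \<le> emeasure lebesgue ((\<Union>i\<in>C. g ` X i) \<union> g ` (E - (\<Union>i\<in>C. X i)))"
    using negligible_imp_sets[OF null] mgX C(1)
    by (intro emeasure_mono sets.Un sets.countable_UN'') auto
  also have "\<dots> = emeasure lebesgue (\<Union>i\<in>C. g ` X i)"
    using null C(1) mgX by (intro emeasure_Un_null_set) (auto simp: negligible_iff_null_sets)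
  also have "\<dots> = (\<integral>\<^sup>+ i. emeasure lebesgue (g ` X i) \<partial>count_space C)"
    using emeasure_UN_countable[OF mgX C(1) dgX] by simp
  also have "\<dots> \<le> (\<integral>\<^sup>+ i. ennreal u * emeasure lebesgue (X i) \<partial>count_space C)"
    using len by (intro nn_integral_mono) auto
  also have "\<dots> = ennreal u * (\<integral>\<^sup>+ i. emeasure lebesgue (X i) \<partial>count_space C)"
    by (intro nn_integral_cmult) auto
  also have "\<dots> = ennreal u * emeasure lebesgue (\<Union>i\<in>C. X i)"
    using emeasure_UN_countable[OF mX C(1) dX] by simp
  also have "\<dots> \<le> ennreal u * emeasure lebesgue U"
    using XU U(1) by (intro mult_left_mono emeasure_mono UN_least) auto
  also have "emeasure lebesgue U = emeasure lebesgue E + emeasure lebesgue (U - E)"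
    using plus_emeasure[of E lebesgue "U - E"] U(2,3) E by (simp add: Un_absorb1)
  also have "ennreal u * (emeasure lebesgue E + emeasure lebesgue (U - E))
      \<le> ennreal u * (emeasure lebesgue E + ennreal (e / u))"
    using U(4) by (intro mult_left_mono add_left_mono) auto
  also have "\<dots> = ennreal u * emeasure lebesgue E + ennreal e"
    using \<open>u > 0\<close> \<open>e > 0\<close> by (simp add: distrib_left flip: ennreal_mult)
  finally show "emeasure lebesgue (g ` E) \<le> ennreal u * emeasure lebesgue E + ennreal e" .
qed

text \<open>The covering estimate for \<open>g\<close> bounds the measure of \<open>g ` E\<close> by \<open>u\<close> times that of \<open>E\<close>, and
  applied to the inverse of \<open>g\<close> it bounds the measure of \<open>E\<close> by \<open>1 / v\<close> times that of \<open>g ` E\<close>.\<close>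
lemma negligible_two_slopes:
  fixes g h :: "real \<Rightarrow> real"
  assumes gh: "\<And>x. g (h x) = x" "\<And>x. h (g x) = x"
    and mono: "strict_mono g" and lip: "L-lipschitz_on UNIV g" "M-lipschitz_on UNIV h"
    and E: "E \<in> sets borel" "bounded E" and uv: "0 < u" "u < v"
    and slope1: "\<And>x d. x \<in> E \<Longrightarrow> d > 0 \<Longrightarrow>
      \<exists>p q. p \<le> x \<and> x \<le> q \<and> p < q \<and> q - p < d \<and> g q - g p \<le> u * (q - p)"
    and slope2: "\<And>x d. x \<in> E \<Longrightarrow> d > 0 \<Longrightarrow>
      \<exists>p q. p \<le> x \<and> x \<le> q \<and> p < q \<and> q - p < d \<and> g q - g p \<ge> v * (q - p)"
  shows "negligible E"
proof -
  have "strict_mono h" using mono gh by (metis strict_mono_def linorder_neqE strict_mono_less)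
  have le1: "emeasure lebesgue (g ` E) \<le> ennreal u * emeasure lebesgue E"
    by (rule emeasure_image_le_slope[OF gh mono lip(1) _ uv(1) slope1]) (use E in auto)
  have "g ` E = h -` E" using gh by (auto simp: image_iff) metis
  moreover have "h -` E \<in> sets borel"
    using measurable_sets_borel[OF borel_measurable_continuous_onI[OF lipschitz_on_continuous_on[OF lip(2)]] E(1)]
    by simp
  ultimately have gE: "g ` E \<in> sets lebesgue" by simp
  have "emeasure lebesgue (h ` (g ` E)) \<le> ennreal (1 / v) * emeasure lebesgue (g ` E)"
  proof (rule emeasure_image_le_slope[OF gh(2,1) \<open>strict_mono h\<close> lip(2) gE])
    show "0 < 1 / v" using uv by simp
    fix y d :: real assume y: "y \<in> g ` E" "d > 0"
    then obtain x where x: "x \<in> E" "y = g x" by auto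
    have L: "L \<ge> 0" using lip(1) by (rule lipschitz_on_nonneg)
    \<comment> \<open>An interval for \<open>h\<close> around \<open>g x\<close> is the image of one
      for \<open>g\<close> around \<open>x\<close>, with reciprocal slope. Its length grows at most
      by the factor \<open>L\<close>, whence \<open>d / (L + 1)\<close>; the added 1 covers
      \<open>L = 0\<close>.\<close>
    obtain p q where pq: "p \<le> x" "x \<le> q" "p < q" "q - p < d / (L + 1)" "g q - g p \<ge> v * (q - p)"
      using slope2[OF x(1), of "d / (L + 1)"] y L by auto
    have "g q - g p \<le> L * (q - p)" using lipschitz_onD[OF lip(1), of q p] pq by (simp add: dist_real_def)
    also have "\<dots> \<le> (L + 1) * (q - p)" using pq by (intro mult_right_mono) auto
    also have "\<dots> < d" using pq L by (simp add: field_simps)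
    finally have "g q - g p < d" .
    moreover have "g p \<le> y" "y \<le> g q" "g p < g q" using pq x mono by (auto simp: strict_mono_less_eq strict_mono_less)
    moreover have "h (g q) - h (g p) \<le> 1 / v * (g q - g p)" using pq uv by (simp add: gh field_simps)
    ultimately show "\<exists>p q. p \<le> y \<and> y \<le> q \<and> p < q \<and> q - p < d \<and> h q - h p \<le> 1 / v * (q - p)"
      by blast
  qed
  also have "h ` (g ` E) = E" using gh by (auto simp: image_iff)
  also have "ennreal (1 / v) * emeasure lebesgue (g ` E) \<le> ennreal (1 / v) * (ennreal u * emeasure lebesgue E)"
    using le1 by (intro mult_left_mono) auto
  also have "\<dots> = ennreal (u / v) * emeasure lebesgue E"
    using uv by (simp flip: mult.assoc ennreal_mult)
  finally have le: "emeasure lebesgue E \<le> ennreal (u / v) * emeasure lebesgue E" .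
  have "E \<in> lmeasurable" using E by (intro bounded_set_imp_lmeasurable) auto
  then have fin: "emeasure lebesgue E = ennreal (measure lebesgue E)"
    by (simp add: emeasure_eq_measure2)
  have "ennreal (measure lebesgue E) \<le> ennreal ((u / v) * measure lebesgue E)"
    using le uv by (subst ennreal_mult) (auto simp: fin)
  then have "measure lebesgue E \<le> (u / v) * measure lebesgue E"
    using uv by (subst (asm) ennreal_le_iff) auto
  then have "(1 - u / v) * measure lebesgue E \<le> 0" by (simp add: algebra_simps)
  moreover have "1 - u / v > 0" using uv by simp
  ultimately have "measure lebesgue E = 0"
    by (meson measure_nonneg mult_le_0_iff not_less order_antisym)
  then show ?thesis using \<open>E \<in> lmeasurable\<close> by (simp add: negligible_iff_measure0)
qed

text \<open>Where \<open>g\<close> is not differentiable, the lower and upper limits of its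
  difference quotients are separated by rationals \<open>u < v\<close>, and for each such pair the
  two slope estimates make the bounded parts of the set null. The lower slope 1 keeps the quotients
  positive and gives \<open>g\<close> a Lipschitz inverse.\<close>

lemma bilipschitz_increasing_ae_differentiable:
  fixes g :: "real \<Rightarrow> real"
  assumes lip: "L-lipschitz_on UNIV g" and low: "\<And>x y. x \<le> y \<Longrightarrow> y - x \<le> g y - g x"
  shows "negligible {x. \<not> g differentiable (at x)}"
proof -
  have up: "g y - g x \<le> L * (y - x)" if "x \<le> y" for x y
    using lipschitz_onD[OF lip, of y x] that by (simp add: dist_real_def)
  have cont: "continuous_on UNIV g" using lip by (rule lipschitz_on_continuous_on)
  have mono: "strict_mono g"
    by (rule strict_monoI) (use low in \<open>smt (verit)\<close>)
  have "surj g"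
    unfolding surj_def
  proof
    fix y
    define R where "R = \<bar>y - g 0\<bar>"
    have "g (-R) \<le> y" using low[of "-R" 0] by (auto simp: R_def)
    moreover have "y \<le> g R" using low[of 0 R] by (auto simp: R_def)
    moreover have "-R \<le> R" by (auto simp: R_def)
    ultimately have "\<exists>x\<ge>-R. x \<le> R \<and> g x = y" using cont
      by (intro IVT') (auto intro: continuous_on_subset)
    then show "\<exists>x. y = g x" by auto
  qed
  define h where "h = inv g"
  have inj: "inj g" using mono by (rule strict_mono_imp_inj_on)
  have gh: "g (h x) = x" "h (g x) = x" for x
    using \<open>surj g\<close> inj by (auto simp: h_def surj_f_inv_f)
  have liph: "1-lipschitz_on UNIV h"
  proof (rule lipschitz_onI)
    fix x y
    have "\<bar>h x - h y\<bar> \<le> \<bar>g (h x) - g (h y)\<bar>"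
      using low[of "h x" "h y"] low[of "h y" "h x"] by linarith
    then show "dist (h x) (h y) \<le> 1 * dist x y" by (simp add: gh dist_real_def)
  qed auto
  define Q where "Q = (\<lambda>x t. (g (x + t) - g x) / t)"
  have Q: "1 \<le> Q x t" "Q x t \<le> L" if "t \<noteq> 0" for x t
    using low[of x "x+t"] low[of "x+t" x] up[of x "x+t"] up[of "x+t" x] that
    by (cases "t > 0"; simp add: Q_def pos_le_divide_eq pos_divide_le_eq neg_le_divide_eq neg_divide_le_eq)+
  define O1 where "O1 = (\<lambda>u n. \<Union>t\<in>{t. t \<noteq> 0 \<and> \<bar>t\<bar> < 1 / real (Suc n)}. {x. Q x t < u})"
  define O2 where "O2 = (\<lambda>v n. \<Union>t\<in>{t. t \<noteq> 0 \<and> \<bar>t\<bar> < 1 / real (Suc n)}. {x. Q x t > v})"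
  have Qc: "continuous_on UNIV (\<lambda>x. Q x t)" for t
    unfolding Q_def divide_inverse
    by (intro continuous_intros continuous_on_compose2[OF cont]) auto
  have op: "open (O1 u n)" "open (O2 u n)" for u n
    unfolding O1_def O2_def by (auto intro!: open_UN ballI open_Collect_less Qc continuous_intros)
  define E where "E = (\<lambda>u v. (\<Inter>n. O1 u n \<inter> O2 v n))"
  have Eb: "E u v \<in> sets borel" for u v unfolding E_def using op by auto
  have neg: "negligible (E u v \<inter> {-real k..real k})" if "u < v" for u v k
  proof (cases "u > 0")
    case False
    have "E u v = {}"
    proof (rule ccontr)
      assume "E u v \<noteq> {}"
      then obtain x t where "t \<noteq> 0" "Q x t < u" unfolding E_def O1_def by blast
      then show False using Q(1)[of t x] False by simp
    qed
    then show ?thesis by simp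
  next
    case True
    have iv: "\<exists>p q. p \<le> x \<and> x \<le> q \<and> p < q \<and> q - p < d \<and> g q - g p = Q x t * (q - p)"
      if t: "t \<noteq> 0" "\<bar>t\<bar> < d" for x t d
      using t by (cases "t > 0")
        (intro exI[of _ x] exI[of _ "x + t"], simp add: Q_def,
         intro exI[of _ "x + t"] exI[of _ x], simp add: Q_def field_simps)
    show ?thesis
    proof (rule negligible_two_slopes[OF gh mono lip liph _ _ True \<open>u < v\<close>])
      fix x d :: real assume x: "x \<in> E u v \<inter> {- real k..real k}" and "d > 0"
      obtain n where "1 / real (Suc n) < d" using \<open>d > 0\<close> by (metis nat_approx_posE)
      moreover have "x \<in> O1 u n" "x \<in> O2 v n" using x by (auto simp: E_def)
      ultimately obtain t t' where t: "t \<noteq> 0" "\<bar>t\<bar> < d" "Q x t < u" "t' \<noteq> 0" "\<bar>t'\<bar> < d" "Q x t' > v"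
        unfolding O1_def O2_def by auto
      obtain p q where pq: "p \<le> x" "x \<le> q" "p < q" "q - p < d" "g q - g p = Q x t * (q - p)"
        using iv[OF t(1,2)] by blast
      moreover have "g q - g p \<le> u * (q - p)"
        unfolding pq(5) using t pq by (intro mult_right_mono) auto
      ultimately show "\<exists>p q. p \<le> x \<and> x \<le> q \<and> p < q \<and> q - p < d \<and> g q - g p \<le> u * (q - p)"
        by blast
      obtain p q where pq: "p \<le> x" "x \<le> q" "p < q" "q - p < d" "g q - g p = Q x t' * (q - p)"
        using iv[OF t(4,5)] by blast
      moreover have "g q - g p \<ge> v * (q - p)"
        unfolding pq(5) using t pq by (intro mult_right_mono) auto
      ultimately show "\<exists>p q. p \<le> x \<and> x \<le> q \<and> p < q \<and> q - p < d \<and> v * (q - p) \<le> g q - g p"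
        by blast
    qed (use Eb in \<open>auto intro: bounded_subset[OF bounded_closed_interval]\<close>)
  qed
  have sub: "{x. \<not> g differentiable (at x)} \<subseteq>
      (\<Union>(u, v)\<in>{(u, v). u \<in> \<rat> \<and> v \<in> \<rat> \<and> u < v}. \<Union>k. E u v \<inter> {-real k..real k})"
  proof (rule subsetI, rule ccontr)
    fix x assume "x \<in> {x. \<not> g differentiable (at x)}"
      and no: "x \<notin> (\<Union>(u, v)\<in>{(u, v). u \<in> \<rat> \<and> v \<in> \<rat> \<and> u < v}. \<Union>k. E u v \<inter> {-real k..real k})"
    then have nd: "\<not> g differentiable (at x)" by simp
    have x: "x \<notin> E u v" if "u \<in> \<rat>" "v \<in> \<rat>" "u < v" for u v
    proof
      assume "x \<in> E u v"
      moreover obtain k where "\<bar>x\<bar> \<le> real k" using real_arch_simple by blast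
      ultimately show False using no that by (auto simp: abs_le_iff)
    qed
    have dich: "(\<forall>\<^sub>F t in at 0. Q x t \<ge> u) \<or> (\<forall>\<^sub>F t in at 0. Q x t \<le> v)"
      if uv: "u \<in> \<rat>" "v \<in> \<rat>" "u < v" for u v
    proof -
      obtain n where "x \<notin> O1 u n \<or> x \<notin> O2 v n" using x[OF uv] by (auto simp: E_def)
      then have "(\<forall>t. t \<noteq> 0 \<and> \<bar>t\<bar> < 1 / real (Suc n) \<longrightarrow> Q x t \<ge> u) \<or>
          (\<forall>t. t \<noteq> 0 \<and> \<bar>t\<bar> < 1 / real (Suc n) \<longrightarrow> Q x t \<le> v)"
        unfolding O1_def O2_def by (auto simp: not_less)
      then show ?thesis
        unfolding eventually_at by (auto intro!: exI[of _ "1 / real (Suc n)"])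
    qed
    \<comment> \<open>The supremum \<open>l\<close> of \<open>S\<close> is the lower limit of the
      quotients. A rational just above \<open>l\<close> is not in \<open>S\<close>, so
      \<open>dich\<close> bounds the quotients from above, and \<open>l\<close> is the upper limit
      too.\<close>
    define S where "S = {u. \<forall>\<^sub>F t in at 0. Q x t \<ge> u}"
    have "1 \<in> S" unfolding S_def using Q(1)[of _ x] by (auto simp: eventually_at intro!: exI[of _ 1])
    have bdd: "u \<le> L" if "u \<in> S" for u
    proof -
      have "\<forall>\<^sub>F t::real in at 0. t \<noteq> 0" by (auto simp: eventually_at intro!: exI[of _ 1])
      then have "\<forall>\<^sub>F t in at 0. Q x t \<ge> u \<and> Q x t \<le> L"
        using that Q(2)[of _ x] unfolding S_def by (auto elim: eventually_elim2)
      then have "\<forall>\<^sub>F t::real in at 0. u \<le> L" by eventually_elim auto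
      then show ?thesis by simp
    qed
    then have bddS: "bdd_above S" by (auto simp: bdd_above_def)
    define l where "l = Sup S"
    have "(Q x \<longlongrightarrow> l) (at 0)"
    proof (rule tendstoI)
      fix e :: real assume "e > 0"
      have "\<exists>u\<in>S. l - e < u"
        using \<open>1 \<in> S\<close> \<open>e > 0\<close> by (intro less_cSupD) (auto simp: l_def)
      then obtain u where "u \<in> S" "l - e < u" by blast
      then have lo: "\<forall>\<^sub>F t in at 0. Q x t > l - e" unfolding S_def by (auto elim: eventually_mono)
      obtain u' where u': "u' \<in> \<rat>" "l < u'" "u' < l + e / 2" using Rats_dense_in_real[of l "l + e/2"] \<open>e > 0\<close> by auto
      obtain v' where v': "v' \<in> \<rat>" "l + e / 2 < v'" "v' < l + e"
        using Rats_dense_in_real[of "l + e/2" "l + e"] \<open>e > 0\<close> by auto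
      have "u' \<notin> S" using u' cSup_upper[OF _ bddS, of u'] by (auto simp: l_def)
      then have "\<forall>\<^sub>F t in at 0. Q x t \<le> v'" using dich[of u' v'] u' v' by (auto simp: S_def)
      then have "\<forall>\<^sub>F t in at 0. Q x t < l + e" by (rule eventually_mono) (use v' in auto)
      with lo show "\<forall>\<^sub>F t in at 0. dist (Q x t) l < e"
        by eventually_elim (auto simp: dist_real_def abs_less_iff)
    qed
    then have "(g has_real_derivative l) (at x)" unfolding DERIV_def Q_def .
    then show False using nd by (meson real_differentiable_def)
  qed
  show ?thesis
  proof (rule negligible_subset[OF _ sub])
    have "countable {(u::real, v). u \<in> \<rat> \<and> v \<in> \<rat> \<and> u < v}"
      by (rule countable_subset[of _ "\<rat> \<times> \<rat>"]) (auto simp: countable_rat)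
    moreover have "negligible (\<Union>k. E u v \<inter> {-real k..real k})" if "u < v" for u v
      using neg[OF that] by (intro negligible_UN_countable) auto
    ultimately show "negligible (\<Union>(u, v)\<in>{(u, v). u \<in> \<rat> \<and> v \<in> \<rat> \<and> u < v}. \<Union>k. E u v \<inter> {-real k..real k})"
      by (intro negligible_UN_countable) auto
  qed
qed

text \<open>Extending \<open>f\<close> by constants through the clamp \<open>cl\<close> and adding
  \<open>(L + 1) * x\<close> gives a Lipschitz function on the whole line with slope at least 1. The
  linear term does not affect differentiability.\<close>

lemma lipschitz_real_ae_differentiable:
  fixes f :: "real \<Rightarrow> real"
  assumes lip: "L-lipschitz_on {a..b} f" and "a \<le> b"
  shows "negligible {x\<in>{a<..<b}. \<not> f differentiable (at x)}"
proof -
  define cl where "cl = (\<lambda>x. max a (min b x))"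
  define g where "g = (\<lambda>x. f (cl x) + (L + 1) * x)"
  have L: "L \<ge> 0" using lip by (rule lipschitz_on_nonneg)
  have cl: "\<bar>cl x - cl y\<bar> \<le> \<bar>x - y\<bar>" "cl x \<in> {a..b}" for x y using \<open>a \<le> b\<close> by (auto simp: cl_def)
  have fcl: "\<bar>f (cl x) - f (cl y)\<bar> \<le> L * \<bar>x - y\<bar>" for x y
    using lipschitz_onD[OF lip cl(2) cl(2), of x y] mult_left_mono[OF cl(1)[of x y] L]
    by (simp add: dist_real_def)
  have "negligible {x. \<not> g differentiable (at x)}"
  proof (rule bilipschitz_increasing_ae_differentiable)
    have "L-lipschitz_on UNIV (\<lambda>x. f (cl x))"
      by (rule lipschitz_onI) (use L fcl in \<open>auto simp: dist_real_def\<close>)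
    then show "(L + (L + 1) * 1)-lipschitz_on UNIV g" unfolding g_def
      using L by (intro lipschitz_intros) auto
    fix x y :: real assume "x \<le> y"
    then show "y - x \<le> g y - g x" using fcl[of x y] by (auto simp: g_def algebra_simps abs_le_iff)
  qed
  moreover have "{x\<in>{a<..<b}. \<not> f differentiable (at x)} \<subseteq> {x. \<not> g differentiable (at x)}"
  proof (intro subsetI CollectI notI, elim CollectE conjE)
    fix x assume x: "x \<in> {a<..<b}" "\<not> f differentiable (at x)" "g differentiable (at x)"
    have "(\<lambda>y. g y - (L + 1) * y) differentiable (at x)" using x by (intro derivative_intros) auto
    then obtain D where "((\<lambda>y. g y - (L + 1) * y) has_derivative D) (at x)"
      by (auto simp: differentiable_def)
    then have "(f has_derivative D) (at x)"
      by (rule has_derivative_transform_within_open[of _ _ _ _ "{a<..<b}"])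
        (use x in \<open>auto simp: g_def cl_def\<close>)
    then show False using x by (auto simp: differentiable_def)
  qed
  ultimately show ?thesis by (rule negligible_subset)
qed

text \<open>Serves the limits of causal curves, which are Lipschitz but carry no derivative from
  their construction.\<close>

lemma lipschitz_ae_vector_derivative:
  fixes f :: "real \<Rightarrow> 'a::euclidean_space"
  assumes lip: "L-lipschitz_on {a..b} f" and "a \<le> b"
  obtains N where "negligible N" "\<And>x. x \<in> {a<..<b} - N \<Longrightarrow> \<exists>v. (f has_vector_derivative v) (at x)"
proof
  let ?N = "\<Union>i\<in>Basis. {x\<in>{a<..<b}. \<not> (\<lambda>x. f x \<bullet> i) differentiable (at x)}"
  show "negligible ?N"
  proof (intro negligible_Union, goal_cases)
    case (2 S)
    then obtain i where i: "i \<in> Basis" "S = {x\<in>{a<..<b}. \<not> (\<lambda>x. f x \<bullet> i) differentiable (at x)}" by auto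
    have "L-lipschitz_on {a..b} (\<lambda>x. f x \<bullet> i)"
    proof (rule lipschitz_onI)
      fix x y assume xy: "x \<in> {a..b}" "y \<in> {a..b}"
      have "dist (f x \<bullet> i) (f y \<bullet> i) = \<bar>(f x - f y) \<bullet> i\<bar>" by (simp add: dist_real_def inner_diff_left)
      also have "\<dots> \<le> norm (f x - f y)" using i by (simp add: Basis_le_norm)
      also have "\<dots> \<le> L * dist x y" using lipschitz_onD[OF lip xy] by (simp add: dist_norm)
      finally show "dist (f x \<bullet> i) (f y \<bullet> i) \<le> L * dist x y" .
    qed (use lip in \<open>rule lipschitz_on_nonneg\<close>)
    then show ?case unfolding i(2) by (rule lipschitz_real_ae_differentiable) fact
  qed auto
  fix x assume "x \<in> {a<..<b} - ?N"
  then have "f differentiable (at x)" by (subst differentiable_componentwise_within) auto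
  then show "\<exists>v. (f has_vector_derivative v) (at x)"
    using vector_derivative_works by blast
qed

subsection \<open>Lorentzian forms and metrics\<close>

text \<open>Separates the time axis \<open>e\<close> from its Euclidean complement, so that
  Cauchy-Schwarz applies to the spatial parts.\<close>

lemma minkowski_form_eq:
  assumes "e \<in> Basis"
  shows "minkowski_form e u w = (u - (u \<bullet> e) *\<^sub>R e) \<bullet> (w - (w \<bullet> e) *\<^sub>R e) - (u \<bullet> e) * (w \<bullet> e)"
proof -
  have "minkowski_form e u w = (\<Sum>b\<in>Basis. (u \<bullet> b) * (w \<bullet> b) - (if b = e then 2 * (u \<bullet> b) * (w \<bullet> b) else 0))"
    unfolding minkowski_form_def by (intro sum.cong) auto
  also have "\<dots> = (\<Sum>b\<in>Basis. (u \<bullet> b) * (w \<bullet> b)) - 2 * (u \<bullet> e) * (w \<bullet> e)"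
    unfolding sum_subtractf using assms by (subst sum.delta) auto
  also have "\<dots> = u \<bullet> w - 2 * (u \<bullet> e) * (w \<bullet> e)" by (simp only: euclidean_inner[symmetric])
  also have "\<dots> = (u - (u \<bullet> e) *\<^sub>R e) \<bullet> (w - (w \<bullet> e) *\<^sub>R e) - (u \<bullet> e) * (w \<bullet> e)"
    unfolding inner_diff_left inner_diff_right inner_scaleR_left inner_scaleR_right
      inner_same_Basis[OF assms] inner_commute[of e w] by algebra
  finally show ?thesis .
qed

text \<open>Write \<open>t0\<close>, \<open>v0\<close> for the components along \<open>e\<close>.
  Orthogonality and Cauchy-Schwarz give |v0| |t0| \<le> |v'| |t'| \<le> |v0| |t'|, while |t'| <
  |t0|. Hence v0 = 0, and then v' = 0.\<close>

lemma minkowski_orthogonal_timelike: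
  assumes e: "e \<in> Basis" and T: "minkowski_form e t t < 0"
    and v: "minkowski_form e v v \<le> 0" "minkowski_form e v t = 0"
  shows "v = 0"
proof -
  define t' v' where "t' = t - (t \<bullet> e) *\<^sub>R e" and "v' = v - (v \<bullet> e) *\<^sub>R e"
  have "t' \<bullet> t' < (t \<bullet> e) * (t \<bullet> e)" "v' \<bullet> v' \<le> (v \<bullet> e) * (v \<bullet> e)"
    using T v(1) unfolding minkowski_form_eq[OF e] t'_def v'_def by linarith+
  then have "(norm t')\<^sup>2 < \<bar>t \<bullet> e\<bar>\<^sup>2" "(norm v')\<^sup>2 \<le> \<bar>v \<bullet> e\<bar>\<^sup>2"
    by (simp_all only: power2_norm_eq_inner power2_abs power2_eq_square[of "_ \<bullet> _"])
  then have t: "norm t' < \<bar>t \<bullet> e\<bar>" and v1: "norm v' \<le> \<bar>v \<bullet> e\<bar>"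
    using power2_less_imp_less[of "norm t'" "\<bar>t \<bullet> e\<bar>"] power2_le_imp_le[of "norm v'" "\<bar>v \<bullet> e\<bar>"] by simp_all
  have "v' \<bullet> t' = (v \<bullet> e) * (t \<bullet> e)"
    using v(2) unfolding minkowski_form_eq[OF e] t'_def v'_def by linarith
  then have "\<bar>v \<bullet> e\<bar> * \<bar>t \<bullet> e\<bar> \<le> norm v' * norm t'"
    using Cauchy_Schwarz_ineq2[of v' t'] by (simp add: abs_mult)
  also have "\<dots> \<le> \<bar>v \<bullet> e\<bar> * norm t'" using v1 by (intro mult_right_mono) auto
  finally have "\<bar>v \<bullet> e\<bar> * (\<bar>t \<bullet> e\<bar> - norm t') \<le> 0" by (simp add: algebra_simps)
  then have "v \<bullet> e = 0" using t by (smt (verit) mult_pos_pos)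
  then show "v = 0" using v1 by (simp add: v'_def)
qed

context
  fixes B :: "'e::euclidean_space \<Rightarrow> 'e \<Rightarrow> real"
  assumes lf: "lorentzian_form B"
begin

lemma lorentzian_bilinear: "bilinear B" and lorentzian_sym: "B u w = B w u"
  using lf by (auto simp: lorentzian_form_def)

lemma lorentzian_expand:
  "B (u + v) w = B u w + B v w" "B w (u + v) = B w u + B w v"
  "B (u - v) w = B u w - B v w" "B w (u - v) = B w u - B w v"
  "B (k *\<^sub>R u) w = k * B u w" "B w (k *\<^sub>R u) = k * B w u"
  "B 0 w = 0" "B w 0 = 0" "B (- u) w = - B u w" "B w (- u) = - B w u"
  using lorentzian_bilinear
  by (auto simp: bilinear_ladd bilinear_radd bilinear_lsub bilinear_rsub bilinear_lmul bilinear_rmul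
      bilinear_lzero bilinear_rzero bilinear_lneg bilinear_rneg)

lemma causal_not_orthogonal_timelike:
  assumes "B t t < 0" "v \<noteq> 0" "B v v \<le> 0"
  shows "B v t \<noteq> 0"
proof
  assume vt: "B v t = 0"
  obtain L :: "'e \<Rightarrow> 'e" and e where L: "linear L" "bij L" "e \<in> Basis"
      "\<And>u w. B (L u) (L w) = minkowski_form e u w"
    using lf unfolding lorentzian_form_def by blast
  obtain t' v' where tv: "t = L t'" "v = L v'" using bij_is_surj[OF L(2)] by (meson surjD)
  have "v' = 0"
    using assms vt L(3) by (intro minkowski_orthogonal_timelike[of e t']) (auto simp: tv L(4))
  then show False using assms tv L(1) by (simp add: linear_0)
qed

text \<open>Otherwise \<open>- B w t\<close> times \<open>v\<close> plus \<open>B v w\<close> times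
  \<open>t\<close> has nonnegative coefficients, so it is causal and nonzero, and yet orthogonal to
  the timelike \<open>w\<close>.\<close>

lemma same_orientation_neg:
  assumes "B t t < 0" "B v v \<le> 0" "B v t < 0" "B w w < 0" "B w t < 0"
  shows "B v w < 0"
proof (rule ccontr)
  assume "\<not> B v w < 0"
  define \<alpha> \<beta> where "\<alpha> = B v w" and "\<beta> = - B w t"
  have \<alpha>: "\<alpha> \<ge> 0" and \<beta>: "\<beta> > 0" using assms \<open>\<not> B v w < 0\<close> by (auto simp: \<alpha>_def \<beta>_def)
  define u where "u = \<beta> *\<^sub>R v + \<alpha> *\<^sub>R t"
  have "B u w = 0"
    by (simp add: u_def lorentzian_expand \<alpha>_def \<beta>_def lorentzian_sym[of t w])
  moreover have "B u u = \<beta> * \<beta> * B v v + 2 * \<alpha> * \<beta> * B v t + \<alpha> * \<alpha> * B t t"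
    by (simp add: u_def lorentzian_expand lorentzian_sym[of t v] algebra_simps)
  moreover have "\<beta> * \<beta> * B v v \<le> 0" "2 * \<alpha> * \<beta> * B v t \<le> 0" "\<alpha> * \<alpha> * B t t \<le> 0"
    using assms \<alpha> \<beta> by (auto intro!: mult_nonneg_nonpos)
  moreover have "B u t < 0"
  proof -
    have "B u t = \<beta> * B v t + \<alpha> * B t t" by (simp add: u_def lorentzian_expand)
    moreover have "\<beta> * B v t < 0" "\<alpha> * B t t \<le> 0"
      using assms \<alpha> \<beta> by (auto intro!: mult_nonneg_nonpos mult_pos_neg)
    ultimately show ?thesis by linarith
  qed
  then have "u \<noteq> 0" by (auto simp: lorentzian_expand)
  ultimately show False using causal_not_orthogonal_timelike[of w u] assms by auto
qed

text \<open>If \<open>v\<close> were spacelike, some \<open>t + \<lambda> v\<close> would be timelike and have positive product with \<open>v\<close>.\<close>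
lemma causal_if_dual:
  assumes t: "B t t < 0" and dual: "\<And>w. B w w < 0 \<Longrightarrow> B w t < 0 \<Longrightarrow> B v w \<le> 0" and "v \<noteq> 0"
  shows "B v v \<le> 0" "B v t < 0"
proof -
  have b: "B v t \<le> 0" using dual[of t] t by simp
  show vv: "B v v \<le> 0"
  proof (rule ccontr)
    define a b c where "a = B v v" and "b = B v t" and "c = B t t"
    assume "\<not> B v v \<le> 0"
    then have a: "a > 0" by (simp add: a_def)
    have c: "c < 0" and b: "b \<le> 0" using t b by (auto simp: c_def b_def)
    have ac: "a * c < 0" using a c by (rule mult_pos_neg)
    \<comment> \<open>With \<open>l = (s - b) / a\<close> one gets \<open>B v w = s\<close> and
      \<open>a * B w w = a * c + s * s - b * b\<close>. Any positive \<open>s\<close> with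
      \<open>s * s < - (a * c)\<close> would do; half of that bound is taken.\<close>
    define s where "s = sqrt (- (a * c) / 2)"
    have s2: "s * s = - (a * c) / 2" and s: "s > 0"
      using ac by (simp_all add: s_def del: real_sqrt_mult)
    define l where "l = (s - b) / a"
    have l: "l > 0" using a b s by (simp add: l_def)
    define w where "w = t + l *\<^sub>R v"
    have "B w w = c + 2 * l * b + l * l * a"
      by (simp add: w_def lorentzian_expand lorentzian_sym[of t v] a_def b_def c_def algebra_simps)
    also have "a * \<dots> = a * c + s * s - b * b" using a by (simp add: l_def field_simps)
    also have "\<dots> < 0" using s2 ac zero_le_square[of b] by linarith
    finally have "B w w < 0" using a by (simp add: mult_less_0_iff)
    moreover have "B w t = c + l * b" by (simp add: w_def lorentzian_expand b_def c_def)
    then have "B w t < 0" using c l b by (smt (verit) mult_nonneg_nonpos)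
    moreover have "B v w = b + l * a" by (simp add: w_def lorentzian_expand a_def b_def)
    then have "B v w > 0" using a s by (simp add: l_def)
    ultimately show False using dual[of w] by simp
  qed
  show "B v t < 0"
    using causal_not_orthogonal_timelike[OF t \<open>v \<noteq> 0\<close> vv] b by simp
qed

end

text \<open>The first directional derivatives are themselves differentiable, hence bounded on a
  compact ball. Summing the bounds over the basis controls the operator norm of the derivative, and
  the ball is convex.\<close>

lemma smooth_on_imp_locally_lipschitz:
  fixes f :: "'a::euclidean_space \<Rightarrow> 'b::real_normed_vector"
  assumes "smooth_on S f" "x0 \<in> S"
  obtains r L where "r > 0" "cball x0 r \<subseteq> S" "L-lipschitz_on (cball x0 r) f"
proof -
  have "open S" and diff: "\<And>vs x. x \<in> S \<Longrightarrow> dirderivs vs f differentiable (at x)"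
    using assms by (auto simp: smooth_on_def)
  obtain r where r: "r > 0" "cball x0 r \<subseteq> S" using \<open>open S\<close> assms(2) open_contains_cball by blast
  define D where "D = (\<lambda>x. frechet_derivative f (at x))"
  have D: "(f has_derivative D x) (at x)" if "x \<in> S" for x
    using diff[OF that, of "[]"] unfolding D_def by (simp only: dirderivs.simps frechet_derivative_works)
  have "\<exists>K. \<forall>x\<in>cball x0 r. norm (D x b) \<le> K" for b
  proof -
    have "continuous_on (cball x0 r) (dirderivs [b] f)"
    proof (intro continuous_at_imp_continuous_on ballI differentiable_imp_continuous_within)
      show "dirderivs [b] f differentiable (at x)" if "x \<in> cball x0 r" for x
        using diff[of x "[b]"] that r by blast
    qed
    then have "compact (dirderivs [b] f ` cball x0 r)" by (intro compact_continuous_image) auto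
    then have "bounded ((\<lambda>x. D x b) ` cball x0 r)" by (simp add: D_def compact_imp_bounded)
    then show ?thesis unfolding bounded_iff by blast
  qed
  then have "\<forall>b. \<exists>K. \<forall>x\<in>cball x0 r. norm (D x b) \<le> K" by blast
  from choice[OF this] obtain K where K: "\<And>b x. x \<in> cball x0 r \<Longrightarrow> norm (D x b) \<le> K b" by blast
  define L where "L = (\<Sum>b\<in>Basis. K b)"
  have K0: "K b \<ge> 0" for b using order_trans[OF norm_ge_zero K[of x0 b]] r by simp
  have on: "onorm (D x) \<le> L" if x: "x \<in> cball x0 r" for x
  proof (rule onorm_bound)
    show "0 \<le> L" using K0 by (simp add: L_def sum_nonneg)
    fix h
    have lin: "linear (D x)" using D x r by (meson has_derivative_linear subsetD)
    have "D x h = D x (\<Sum>b\<in>Basis. (h \<bullet> b) *\<^sub>R b)" by (simp add: euclidean_representation)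
    also have "\<dots> = (\<Sum>b\<in>Basis. (h \<bullet> b) *\<^sub>R D x b)" using lin by (simp add: linear_sum linear_scale)
    also have "norm \<dots> \<le> (\<Sum>b\<in>Basis. norm h * K b)"
      using K[OF x] by (intro sum_norm_le) (auto intro!: mult_mono simp: Basis_le_norm)
    finally show "norm (D x h) \<le> L * norm h" by (simp add: L_def sum_distrib_left sum_distrib_right mult.commute)
  qed
  have "L-lipschitz_on (cball x0 r) f"
  proof (rule lipschitz_onI)
    show "0 \<le> L" using K0 by (simp add: L_def sum_nonneg)
    fix x y assume xy: "x \<in> cball x0 r" "y \<in> cball x0 r"
    have "norm (f x - f y) \<le> L * norm (x - y)"
    proof (rule differentiable_bound[OF convex_cball _ on xy])
      show "(f has_derivative D x) (at x within cball x0 r)" if "x \<in> cball x0 r" for x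
        by (rule has_derivative_at_withinI, rule D) (use that r(2) in blast)
    qed
    then show "dist (f x) (f y) \<le> L * dist x y" by (simp add: dist_norm)
  qed
  then show thesis using r that by blast
qed

lemma smooth_on_imp_continuous_on:
  assumes "smooth_on S f" shows "continuous_on S f"
proof (intro continuous_at_imp_continuous_on ballI differentiable_imp_continuous_within)
  fix x assume "x \<in> S"
  then have "dirderivs [] f differentiable (at x)" using assms unfolding smooth_on_def by blast
  then show "f differentiable (at x)" by simp
qed

section \<open>Local geometry of a Lorentzian metric on an open set of a Euclidean space\<close>

locale lorentz_metric =
  fixes \<Omega> :: "'e::euclidean_space set" and G :: "'e \<Rightarrow> 'e \<Rightarrow> 'e \<Rightarrow> real" and \<tau> :: "'e \<Rightarrow> 'e"
  assumes lorentz: "\<And>x. x \<in> \<Omega> \<Longrightarrow> lorentzian_form (G x)"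
    and smooth: "\<And>u w. smooth_on \<Omega> (\<lambda>x. G x u w)"
    and cont_orient: "continuous_on \<Omega> \<tau>"
    and timelike_orient: "\<And>x. x \<in> \<Omega> \<Longrightarrow> G x (\<tau> x) (\<tau> x) < 0"
begin

lemma open_domain: "open \<Omega>"
  using smooth by (auto simp: smooth_on_def)

text \<open>Smoothness is given for fixed vectors only. The expansion yields continuity jointly in
  the point and the vectors, and a Lipschitz bound that is uniform in the vectors.\<close>

lemma metric_expand_Basis:
  assumes "x \<in> \<Omega>"
  shows "G x u w = (\<Sum>b\<in>Basis. \<Sum>b'\<in>Basis. (u \<bullet> b) * (w \<bullet> b') * G x b b')"
proof -
  have bil: "bilinear (G x)" using lorentz[OF assms] by (rule lorentzian_bilinear)
  have "G x u w = G x (\<Sum>b\<in>Basis. (u \<bullet> b) *\<^sub>R b) (\<Sum>b\<in>Basis. (w \<bullet> b) *\<^sub>R b)"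
    by (simp add: euclidean_representation)
  also have "\<dots> = (\<Sum>(b,b')\<in>Basis\<times>Basis. G x ((u \<bullet> b) *\<^sub>R b) ((w \<bullet> b') *\<^sub>R b'))"
    using bil by (rule bilinear_sum)
  finally show ?thesis
    by (simp add: sum.cartesian_product bilinear_lmul[OF bil] bilinear_rmul[OF bil] mult.assoc mult.left_commute)
qed

lemma continuous_on_metric [continuous_intros]:
  assumes "continuous_on X p" "p ` X \<subseteq> \<Omega>" "continuous_on X u" "continuous_on X w"
  shows "continuous_on X (\<lambda>z. G (p z) (u z) (w z))"
proof -
  have "continuous_on X (\<lambda>z. G (p z) b b')" for b b'
    by (rule continuous_on_compose2[OF smooth_on_imp_continuous_on[OF smooth] assms(1,2)])
  then have "continuous_on X (\<lambda>z. \<Sum>b\<in>Basis. \<Sum>b'\<in>Basis. (u z \<bullet> b) * (w z \<bullet> b') * G (p z) b b')"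
    using assms by (intro continuous_intros)
  then show ?thesis
    using assms by (subst continuous_on_cong[OF refl metric_expand_Basis]) auto
qed

lemma metric_locally_lipschitz:
  assumes "x0 \<in> \<Omega>"
  obtains r L where "r > 0" "L \<ge> 0" "cball x0 r \<subseteq> \<Omega>"
    "\<And>x y u w. x \<in> cball x0 r \<Longrightarrow> y \<in> cball x0 r \<Longrightarrow>
        \<bar>G x u w - G y u w\<bar> \<le> L * dist x y * norm u * norm w"
proof -
  \<comment> \<open>Each coefficient brings its own radius. As \<open>P b b' r\<close> holds for all
    sufficiently small \<open>r\<close>, finitely many coefficients can share one.\<close>
  define P where "P = (\<lambda>b b' r. cball x0 r \<subseteq> \<Omega> \<and> (\<exists>L. L-lipschitz_on (cball x0 r) (\<lambda>x. G x b b')))"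
  have "\<forall>\<^sub>F r in at_right 0. P b b' r" for b b'
  proof -
    obtain R L where R: "R > 0" "cball x0 R \<subseteq> \<Omega>" "L-lipschitz_on (cball x0 R) (\<lambda>x. G x b b')"
      using smooth_on_imp_locally_lipschitz[OF smooth assms] by metis
    have "P b b' r" if "r < R" for r
    proof -
      have "cball x0 r \<subseteq> cball x0 R" using that by (simp add: subset_cball)
      then show ?thesis using R unfolding P_def by (meson lipschitz_on_subset order_trans)
    qed
    then show ?thesis using R(1) by (auto simp: eventually_at_right_field)
  qed
  then have "\<forall>\<^sub>F r in at_right 0. r > 0 \<and> (\<forall>b\<in>Basis. \<forall>b'\<in>Basis. P b b' r)"
    by (intro eventually_conj eventually_ball_finite ballI finite_Basis eventually_at_right_less)
  then obtain r where r: "r > 0" "\<And>b b'. b \<in> Basis \<Longrightarrow> b' \<in> Basis \<Longrightarrow> P b b' r"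
    by (auto dest!: eventually_happens)
  obtain L where L: "\<And>b b'. b \<in> Basis \<Longrightarrow> b' \<in> Basis \<Longrightarrow> (L b b')-lipschitz_on (cball x0 r) (\<lambda>x. G x b b')"
    using r(2) unfolding P_def by metis
  have sub: "cball x0 r \<subseteq> \<Omega>" using r(2) nonempty_Basis unfolding P_def by blast
  define M where "M = (\<Sum>b\<in>Basis. \<Sum>b'\<in>Basis. L b b')"
  have L0: "b \<in> Basis \<Longrightarrow> b' \<in> Basis \<Longrightarrow> L b b' \<ge> 0" for b b' using L by (meson lipschitz_on_nonneg)
  show thesis
  proof (rule that[OF r(1) _ sub])
    show "M \<ge> 0" unfolding M_def using L0 by (intro sum_nonneg)
    fix x y u w assume xy: "x \<in> cball x0 r" "y \<in> cball x0 r"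
    have "G x u w - G y u w = (\<Sum>b\<in>Basis. \<Sum>b'\<in>Basis. (u \<bullet> b) * (w \<bullet> b') * (G x b b' - G y b b'))"
      using xy sub by (simp add: metric_expand_Basis[of x u w] metric_expand_Basis[of y u w] subset_iff
          sum_subtractf algebra_simps)
    also have "\<bar>\<dots>\<bar> \<le> (\<Sum>b\<in>Basis. \<Sum>b'\<in>Basis. norm u * norm w * (L b b' * dist x y))"
    proof (intro order_trans[OF sum_abs] sum_mono, goal_cases)
      case (1 b b')
      have "\<bar>G x b b' - G y b b'\<bar> \<le> L b b' * dist x y"
        using lipschitz_onD[OF L[OF 1] xy] by (simp add: dist_real_def)
      then show ?case using 1
        by (auto simp: abs_mult intro!: mult_mono Basis_le_norm)
    qed
    also have "\<dots> = M * dist x y * norm u * norm w"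
      by (simp add: M_def sum_distrib_left sum_distrib_right algebra_simps)
    finally show "\<bar>G x u w - G y u w\<bar> \<le> M * dist x y * norm u * norm w" .
  qed
qed

definition fdc :: "'e \<Rightarrow> 'e \<Rightarrow> bool" where
  "fdc x v \<longleftrightarrow> v \<noteq> 0 \<and> G x v v \<le> 0 \<and> G x v (\<tau> x) < 0"

definition fdt :: "'e \<Rightarrow> 'e \<Rightarrow> bool" where
  "fdt x v \<longleftrightarrow> G x v v < 0 \<and> G x v (\<tau> x) < 0"

text \<open>A ball on which \<open>V = \<tau> x0\<close> is uniformly timelike, also with respect to the light cones
  at nearby points.\<close>
definition is_box :: "'e \<Rightarrow> real \<Rightarrow> real \<Rightarrow> real \<Rightarrow> real \<Rightarrow> bool" where
  "is_box x0 \<rho> c L \<eta> \<longleftrightarrow> \<rho> > 0 \<and> c > 0 \<and> L \<ge> 0 \<and> \<eta> > 0 \<and> cball x0 \<rho> \<subseteq> \<Omega> \<and>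
     (\<forall>y\<in>cball x0 \<rho>. \<forall>W\<in>cball (\<tau> x0) \<eta>. G y W W \<le> -c \<and> G y W (\<tau> x0) \<le> -c) \<and>
     (\<forall>x\<in>cball x0 \<rho>. fdt x (\<tau> x0)) \<and>
     (\<forall>x\<in>cball x0 \<rho>. \<forall>y\<in>cball x0 \<rho>. \<forall>v. \<forall>W\<in>cball (\<tau> x0) \<eta>. fdc x v \<longrightarrow> G y v W \<le> -c * norm v) \<and>
     (\<forall>x\<in>cball x0 \<rho>. \<forall>y\<in>cball x0 \<rho>. \<forall>u w. \<bar>G x u w - G y u w\<bar> \<le> L * dist x y * norm u * norm w)"

text \<open>Nearby points together with unit vectors in the closed causal cone form a compact set on
  which the product with \<open>V\<close> is negative, so it is at most some \<open>-c0\<close>;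
  scaling extends this to all causal vectors. A smaller radius then absorbs the change of the metric
  between points and the change from \<open>V\<close> to \<open>W\<close>.\<close>

lemma ex_box:
  assumes x0: "x0 \<in> \<Omega>"
  obtains \<rho> c L \<eta> where "is_box x0 \<rho> c L \<eta>"
proof -
  define V where "V = \<tau> x0"
  obtain r0 L where r0: "r0 > 0" "L \<ge> 0" "cball x0 r0 \<subseteq> \<Omega>"
    and L: "\<And>x y u w. x \<in> cball x0 r0 \<Longrightarrow> y \<in> cball x0 r0 \<Longrightarrow>
        \<bar>G x u w - G y u w\<bar> \<le> L * dist x y * norm u * norm w"
    using metric_locally_lipschitz[OF x0] by metis
  have V0: "G x0 V V < 0" using timelike_orient[OF x0] by (simp add: V_def)
  have "\<forall>\<^sub>F x in nhds x0. G x V V < 0 \<and> G x V (\<tau> x) < 0"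
  proof -
    have c: "continuous_on \<Omega> (\<lambda>x. G x V V)" "continuous_on \<Omega> (\<lambda>x. G x V (\<tau> x))"
      by (auto intro!: continuous_intros cont_orient)
    have "isCont (\<lambda>x. G x V V) x0" "isCont (\<lambda>x. G x V (\<tau> x)) x0"
      using c x0 open_domain continuous_on_eq_continuous_at by blast+
    then have "((\<lambda>x. G x V V) \<longlongrightarrow> G x0 V V) (nhds x0)" "((\<lambda>x. G x V (\<tau> x)) \<longlongrightarrow> G x0 V V) (nhds x0)"
      using tendsto_at_iff_tendsto_nhds[of "\<lambda>x. G x V V" x0] tendsto_at_iff_tendsto_nhds[of "\<lambda>x. G x V (\<tau> x)" x0]
      by (simp_all add: isCont_def V_def)
    then have "\<forall>\<^sub>F x in nhds x0. G x V V < 0" "\<forall>\<^sub>F x in nhds x0. G x V (\<tau> x) < 0"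
      using V0 order_tendstoD(2) by blast+
    then show ?thesis by eventually_elim auto
  qed
  then obtain r1' where r1': "r1' > 0" "\<And>x. dist x x0 < r1' \<Longrightarrow> G x V V < 0 \<and> G x V (\<tau> x) < 0"
    by (auto simp: eventually_nhds_metric)
  define r1 where "r1 = min r0 (r1' / 2)"
  have r1: "r1 > 0" "r1 \<le> r0" "\<And>x. x \<in> cball x0 r1 \<Longrightarrow> fdt x V"
    using r0 r1' by (auto simp: r1_def fdt_def dist_commute)
  have sub1: "cball x0 r1 \<subseteq> cball x0 r0" "cball x0 r1 \<subseteq> \<Omega>" using r1 r0(3) by (auto simp: subset_iff)
  \<comment> \<open>Weak inequalities make the set compact. Strictness of the second one is
    recovered because a nonzero causal vector is not orthogonal to a timelike one.\<close>
  define K where "K = {z \<in> cball x0 r1 \<times> sphere 0 1. G (fst z) (snd z) (snd z) \<le> 0 \<and> G (fst z) (snd z) (\<tau> (fst z)) \<le> 0}"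
  have neg: "G x v V < 0" if "(x, v) \<in> K" for x v
  proof -
    have x: "x \<in> \<Omega>" "v \<noteq> 0" "G x v v \<le> 0" "G x v (\<tau> x) \<le> 0" "x \<in> cball x0 r1"
      using that sub1 by (auto simp: K_def)
    then have "G x v (\<tau> x) < 0"
      using causal_not_orthogonal_timelike[OF lorentz[OF x(1)] timelike_orient[OF x(1)] x(2,3)] by simp
    then show ?thesis
      using same_orientation_neg[OF lorentz[OF x(1)] timelike_orient[OF x(1)] x(3), of V] r1(3)[OF x(5)]
      by (simp add: fdt_def)
  qed
  have "\<exists>c0>0. \<forall>(x,v)\<in>K. G x v V \<le> -c0"
  proof (cases "K = {}")
    case False
    have cts: "continuous_on (cball x0 r1 \<times> sphere 0 1) (\<lambda>z. G (fst z) (snd z) (snd z))"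
      "continuous_on (cball x0 r1 \<times> sphere 0 1) (\<lambda>z. G (fst z) (snd z) (\<tau> (fst z)))"
      "continuous_on (cball x0 r1 \<times> sphere 0 1) (\<lambda>z. G (fst z) (snd z) V)"
      using sub1 by (auto intro!: continuous_intros continuous_on_compose2[OF cont_orient])
    have "closed K"
    proof -
      let ?S = "cball x0 r1 \<times> sphere 0 1"
      have "K = (?S \<inter> (\<lambda>z. G (fst z) (snd z) (snd z)) -` {..0}) \<inter>
          (?S \<inter> (\<lambda>z. G (fst z) (snd z) (\<tau> (fst z))) -` {..0})"
        by (auto simp: K_def)
      also have "closed \<dots>"
        by (intro closed_Int continuous_closed_preimage cts closed_Times) auto
      finally show ?thesis .
    qed
    moreover have "bounded K"
      by (rule bounded_subset[of "cball x0 r1 \<times> sphere 0 1"]) (auto simp: K_def bounded_Times)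
    ultimately have cK: "compact K" by (simp add: compact_eq_bounded_closed)
    have "continuous_on K (\<lambda>z. G (fst z) (snd z) V)"
      using cts(3) by (rule continuous_on_subset) (auto simp: K_def)
    then obtain z where "z \<in> K" "\<forall>y\<in>K. G (fst y) (snd y) V \<le> G (fst z) (snd z) V"
      using continuous_attains_sup[OF cK False] by blast
    then show ?thesis using neg[of "fst z" "snd z"]
      by (intro exI[of _ "- G (fst z) (snd z) V"]) auto
  qed (auto intro: exI[of _ 1])
  then obtain c0 where c0: "c0 > 0" "\<And>x v. (x, v) \<in> K \<Longrightarrow> G x v V \<le> -c0" by blast
  have c0': "G x v V \<le> - c0 * norm v" if x: "x \<in> cball x0 r1" and v: "fdc x v" for x v
  proof -
    have lf: "lorentzian_form (G x)" using x sub1 lorentz by blast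
    have "norm v > 0" using v by (simp add: fdc_def)
    define v' where "v' = (1 / norm v) *\<^sub>R v"
    have "(x, v') \<in> K"
    proof -
      have e: "G x v' w = (1 / norm v) * G x v w" "G x w v' = (1 / norm v) * G x w v" for w
        unfolding v'_def by (rule lorentzian_expand[OF lf])+
      have "G x v' v' \<le> 0" "G x v' (\<tau> x) \<le> 0"
        unfolding e using v \<open>norm v > 0\<close> by (auto simp: fdc_def intro!: divide_nonpos_pos)
      then show ?thesis using x \<open>norm v > 0\<close> by (simp add: K_def v'_def)
    qed
    then have "norm v * G x v' V \<le> norm v * (- c0)" using c0(2) by (intro mult_left_mono) auto
    moreover have "norm v * G x v' V = G x (norm v *\<^sub>R v') V" by (rule lorentzian_expand(5)[OF lf, symmetric])
    moreover have "norm v *\<^sub>R v' = v" using \<open>norm v > 0\<close> by (simp add: v'_def)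
    ultimately show ?thesis by (simp add: mult.commute)
  qed
  obtain M0 where M0: "\<And>u w. \<bar>G x0 u w\<bar> \<le> M0 * norm u * norm w"
    using bilinear_bounded[OF lorentzian_bilinear[OF lorentz[OF x0]]] by auto
  define M where "M = \<bar>M0\<bar> + L * r0"
  have M: "M \<ge> 0" using r0 by (simp add: M_def)
  have bd: "\<bar>G x u w\<bar> \<le> M * norm u * norm w" if x: "x \<in> cball x0 r0" for x u w
  proof -
    have "\<bar>G x u w - G x0 u w\<bar> \<le> L * dist x x0 * norm u * norm w" using L x r0 by simp
    also have "\<dots> \<le> L * r0 * norm u * norm w"
      using x r0 by (intro mult_right_mono mult_left_mono) (auto simp: dist_commute)
    finally have "\<bar>G x u w\<bar> \<le> M0 * norm u * norm w + L * r0 * norm u * norm w" using M0[of u w] by linarith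
    also have "\<dots> = (M0 + L * r0) * norm u * norm w" by (simp add: algebra_simps)
    also have "\<dots> \<le> M * norm u * norm w" by (intro mult_right_mono) (auto simp: M_def)
    finally show ?thesis .
  qed
  \<comment> \<open>Half of the value at the centre is left for errors. The radius \<open>r\<close>
    below bounds three of them: moving \<open>v\<close> from the metric at \<open>x\<close> to that
    at \<open>y\<close>, replacing \<open>V\<close> by \<open>W\<close> there, and both changes
    together in \<open>G y W W\<close>.\<close>
  define c1 where "c1 = - G x0 V V / 2"
  have c1: "c1 > 0" using V0 by (simp add: c1_def)
  have "\<forall>\<^sub>F r in at_right 0. 0 < r \<and> r < r1 \<and> L * (2 * r) * norm V < c0 / 4 \<and> M * r < c0 / 4 \<and>
      L * r * norm V * norm V + M * r * norm V + M * (norm V + r) * r < c1"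
  proof (intro eventually_conj)
    have "((\<lambda>r. L * (2 * r) * norm V) \<longlongrightarrow> L * (2 * 0) * norm V) (at_right 0)" by (intro tendsto_intros)
    then show "\<forall>\<^sub>F r in at_right 0. L * (2 * r) * norm V < c0 / 4" using c0 by (intro order_tendstoD) auto
    have "((\<lambda>r. M * r) \<longlongrightarrow> M * 0) (at_right 0)" by (intro tendsto_intros)
    then show "\<forall>\<^sub>F r in at_right 0. M * r < c0 / 4" using c0 by (intro order_tendstoD) auto
    have "((\<lambda>r. L * r * norm V * norm V + M * r * norm V + M * (norm V + r) * r) \<longlongrightarrow>
       L * 0 * norm V * norm V + M * 0 * norm V + M * (norm V + 0) * 0) (at_right 0)" by (intro tendsto_intros)
    then show "\<forall>\<^sub>F r in at_right 0. L * r * norm V * norm V + M * r * norm V + M * (norm V + r) * r < c1"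
      using c1 by (intro order_tendstoD) auto
    show "\<forall>\<^sub>F r in at_right 0. r < r1" using r1 by (auto simp: eventually_at_right_field)
    show "\<forall>\<^sub>F r in at_right (0::real). 0 < r" by (rule eventually_at_right_less)
  qed
  then obtain r where r: "0 < r" "r < r1" "L * (2 * r) * norm V < c0 / 4" "M * r < c0 / 4"
      "L * r * norm V * norm V + M * r * norm V + M * (norm V + r) * r < c1"
    by (auto dest!: eventually_happens)
  define c where "c = min c1 (c0 / 2)"
  have subr: "cball x0 r \<subseteq> cball x0 r1" using r by (simp add: subset_cball)
  have "is_box x0 r c L r"
    unfolding is_box_def V_def[symmetric]
  proof (intro conjI ballI allI impI)
    show "0 < r" "0 < c" "0 \<le> L" "0 < r" using r c0 c1 r0 by (auto simp: c_def)
    show "cball x0 r \<subseteq> \<Omega>" using subr sub1 by blast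
    show "fdt x V" if "x \<in> cball x0 r" for x using r1 subr that by blast
    show "\<bar>G x u w - G y u w\<bar> \<le> L * dist x y * norm u * norm w"
      if "x \<in> cball x0 r" "y \<in> cball x0 r" for x y u w
      using L that subr sub1 by blast
    have small: "norm (W - V) \<le> r" if "W \<in> cball V r" for W
      using that by (simp add: dist_norm norm_minus_commute)
    fix y W assume yW: "y \<in> cball x0 r" "W \<in> cball V r"
    have y: "y \<in> cball x0 r0" "y \<in> \<Omega>" using yW subr sub1 by blast+
    note ex = lorentzian_expand[OF lorentz[OF y(2)]]
    have W: "norm W \<le> norm V + r" using small[OF yW(2)] norm_triangle_sub[of W V] by linarith
    have e1: "\<bar>G y V V - G x0 V V\<bar> \<le> L * r * norm V * norm V"
    proof -
      have "\<bar>G y V V - G x0 V V\<bar> \<le> L * dist y x0 * norm V * norm V" using L y r0 by simp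
      also have "\<dots> \<le> L * r * norm V * norm V"
        using yW r0 by (intro mult_right_mono mult_left_mono) (auto simp: dist_commute)
      finally show ?thesis .
    qed
    have e2: "\<bar>G y (W - V) V\<bar> \<le> M * r * norm V"
      by (rule order_trans[OF bd[OF y(1)]]) (use small[OF yW(2)] M in \<open>intro mult_right_mono mult_left_mono; simp\<close>)
    have e3: "\<bar>G y W (W - V)\<bar> \<le> M * (norm V + r) * r"
      by (rule order_trans[OF bd[OF y(1)]]) (use small[OF yW(2)] M W r in \<open>intro mult_mono; simp\<close>)
    have "G y W W = G y V V + G y (W - V) V + G y W (W - V)" by (simp add: ex)
    then show "G y W W \<le> - c" using e1 e2 e3 r(5) by (simp add: c_def c1_def)
    have "0 \<le> M * (norm V + r) * r" using M r by simp
    moreover have "G y W V = G y V V + G y (W - V) V" by (simp add: ex)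
    ultimately show "G y W V \<le> - c" using e1 e2 r(5) by (simp add: c_def c1_def)
  next
    fix x y v W assume *: "x \<in> cball x0 r" "y \<in> cball x0 r" "W \<in> cball V r" "fdc x v"
    have y: "y \<in> cball x0 r0" "y \<in> \<Omega>" "x \<in> cball x0 r0" "x \<in> cball x0 r1" using * subr sub1 by blast+
    note ex = lorentzian_expand[OF lorentz[OF y(2)]]
    have W: "norm (W - V) \<le> r" using * by (simp add: dist_norm norm_minus_commute)
    have d: "dist y x \<le> 2 * r" using dist_triangle[of y x x0] * by (simp add: dist_commute)
    have "G y v W = G x v V + (G y v V - G x v V) + G y v (W - V)" by (simp add: ex)
    also have "\<dots> \<le> - c0 * norm v + L * dist y x * norm v * norm V + M * norm v * norm (W - V)"
      using c0'[OF y(4) *(4)] L[OF y(1,3), of v V] bd[OF y(1), of v "W - V"] by linarith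
    also have "\<dots> \<le> - c0 * norm v + L * (2 * r) * norm v * norm V + M * norm v * r"
      using W d M r0 by (intro add_mono mult_right_mono mult_left_mono) auto
    also have "\<dots> = (- c0 + L * (2 * r) * norm V + M * r) * norm v" by (simp add: algebra_simps)
    also have "\<dots> \<le> - c * norm v" using r by (intro mult_right_mono) (auto simp: c_def)
    finally show "G y v W \<le> - c * norm v" .
  qed
  then show thesis by (rule that)
qed

end

subsection \<open>Causal curves in coordinates\<close>

definition coord_curve :: "('e::euclidean_space \<Rightarrow> 'e \<Rightarrow> bool) \<Rightarrow> (real \<Rightarrow> 'e) \<Rightarrow> real \<Rightarrow> real \<Rightarrow> bool" where
  "coord_curve P \<zeta> a b \<longleftrightarrow> a < b \<and> (\<exists>L. L-lipschitz_on {a..b} \<zeta>) \<and>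
     (\<exists>N. negligible N \<and> (\<forall>r\<in>{a<..<b} - N. \<exists>v. (\<zeta> has_vector_derivative v) (at r) \<and> P (\<zeta> r) v))"

context lorentz_metric
begin

text \<open>The chronological relation of the chart alone. Later arguments go through its interior,
  since pairs there remain related after a small shift of both points.\<close>

definition local_future :: "('e \<times> 'e) set" where
  "local_future = {(x, y). \<exists>\<zeta> a b. coord_curve fdt \<zeta> a b \<and> \<zeta> ` {a..b} \<subseteq> \<Omega> \<and> \<zeta> a = x \<and> \<zeta> b = y}"

lemma fdt_same_orientation:
  assumes "y \<in> \<Omega>" "fdt y V" "G y u u < 0" "G y u V < 0"
  shows "fdt y u"
proof -
  have "G y u (\<tau> y) < 0"
    using assms timelike_orient[OF assms(1)] lorentzian_sym[OF lorentz[OF assms(1)], of V "\<tau> y"]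
    by (intro same_orientation_neg[OF lorentz[OF assms(1)], of V u "\<tau> y"]) (auto simp: fdt_def)
  then show ?thesis using assms by (simp add: fdt_def)
qed

lemma fdc_fdt_neg:
  assumes "y \<in> \<Omega>" "fdc y v" "fdt y w"
  shows "G y v w < 0"
  using assms timelike_orient[OF assms(1)]
  by (intro same_orientation_neg[OF lorentz[OF assms(1)], of "\<tau> y" v w]) (auto simp: fdt_def fdc_def)

lemma open_fdt: "open {z. fst z \<in> \<Omega> \<and> fdt (fst z) (snd z)}"
proof -
  let ?S = "\<Omega> \<times> (UNIV :: 'e set)"
  have o: "open ?S" using open_domain by (intro open_Times) auto
  have 1: "continuous_on ?S (\<lambda>z. G (fst z) (snd z) (snd z))"
    and 2: "continuous_on ?S (\<lambda>z. G (fst z) (snd z) (\<tau> (fst z)))"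
    by (auto intro!: continuous_intros continuous_on_compose2[OF cont_orient])
  have "open (?S \<inter> (\<lambda>z. G (fst z) (snd z) (snd z)) -` {..<0})"
    using continuous_on_open_vimage[OF o] 1 by (metis inf_commute open_lessThan)
  moreover have "open (?S \<inter> (\<lambda>z. G (fst z) (snd z) (\<tau> (fst z))) -` {..<0})"
    using continuous_on_open_vimage[OF o] 2 by (metis inf_commute open_lessThan)
  moreover have "{z. fst z \<in> \<Omega> \<and> fdt (fst z) (snd z)} =
      (?S \<inter> (\<lambda>z. G (fst z) (snd z) (snd z)) -` {..<0}) \<inter>
      (?S \<inter> (\<lambda>z. G (fst z) (snd z) (\<tau> (fst z))) -` {..<0})"
    by (auto simp: fdt_def)
  ultimately show ?thesis by (simp add: open_Int)
qed

lemma fdt_neighbourhood: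
  assumes "x \<in> \<Omega>" "fdt x v"
  obtains d where "d > 0" "\<And>x' u. dist x' x < d \<Longrightarrow> dist u v < d \<Longrightarrow> x' \<in> \<Omega> \<and> fdt x' u"
proof -
  obtain U W where UW: "open U" "open W" "x \<in> U" "v \<in> W" "U \<times> W \<subseteq> {z. fst z \<in> \<Omega> \<and> fdt (fst z) (snd z)}"
    by (rule open_prod_elim[OF open_fdt, of "(x, v)"]) (use assms in auto)
  obtain d1 d2 where d: "d1 > 0" "d2 > 0" "ball x d1 \<subseteq> U" "ball v d2 \<subseteq> W"
    using UW by (meson openE)
  have "x' \<in> \<Omega> \<and> fdt x' u" if "dist x' x < min d1 d2" "dist u v < min d1 d2" for x' u
  proof -
    have "x' \<in> ball x d1" "u \<in> ball v d2" using that by (auto simp: dist_commute)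
    then have "(x', u) \<in> U \<times> W" using d by auto
    then show ?thesis using UW(5) by auto
  qed
  then show thesis using that[of "min d1 d2"] d by simp
qed

text \<open>Being future timelike is an open condition on point and vector, so short segments with
  velocity near \<open>v\<close> are timelike. Moving both endpoints by at most \<open>e\<close>
  changes the velocity by at most \<open>2 * e / h\<close>, which for fixed \<open>h\<close> is
  small; hence the interior.\<close>

lemma straight_segment_local_future:
  assumes x: "x \<in> \<Omega>" "fdt x v"
  obtains d where "d > 0" "\<And>h u. 0 < h \<Longrightarrow> h < d \<Longrightarrow> dist u v < d \<Longrightarrow> (x, x + h *\<^sub>R u) \<in> interior local_future"
proof -
  obtain d1 where d1: "d1 > 0" "\<And>x' u. dist x' x < d1 \<Longrightarrow> dist u v < d1 \<Longrightarrow> x' \<in> \<Omega> \<and> fdt x' u"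
    using fdt_neighbourhood[OF x] by metis
  define R where "R = norm v + d1 + 1"
  have R: "R > 0" using d1 by (simp add: R_def add_nonneg_pos)
  define d where "d = min (d1 / 2) (d1 / (2 * R))"
  have d: "d > 0" "d \<le> d1 / 2" "d * R \<le> d1 / 2" using d1 R by (auto simp: d_def min_def field_simps)
  have seg: "(x', x' + h *\<^sub>R u) \<in> local_future" if h: "0 < h" "h < d" and x': "dist x' x < d1 / 2" and u: "dist u v < d1" for h x' u
  proof -
    have "norm u \<le> R" using u norm_triangle_sub[of u v] by (simp add: R_def dist_norm)
    have in\<Omega>: "x' + s *\<^sub>R u \<in> \<Omega> \<and> fdt (x' + s *\<^sub>R u) u" if "s \<in> {0..h}" for s
    proof (rule d1(2)[OF _ u])
      have "dist (x' + s *\<^sub>R u) x \<le> dist (x' + s *\<^sub>R u) x' + dist x' x" by (rule dist_triangle)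
      also have "dist (x' + s *\<^sub>R u) x' = s * norm u" using that by (simp add: dist_norm)
      also have "s * norm u \<le> d * R" using that h \<open>norm u \<le> R\<close> R by (intro mult_mono) auto
      finally show "dist (x' + s *\<^sub>R u) x < d1" using d x' by simp
    qed
    have "coord_curve fdt (\<lambda>s. x' + s *\<^sub>R u) 0 h"
      unfolding coord_curve_def
    proof (intro conjI exI ballI)
      show "0 < h" by fact
      show "(norm u)-lipschitz_on {0..h} (\<lambda>s. x' + s *\<^sub>R u)"
        by (rule lipschitz_onI) (auto simp: dist_norm mult.commute simp flip: scaleR_diff_left)
      show "negligible {}" by simp
      fix r assume "r \<in> {0<..<h} - {}"
      show "((\<lambda>s. x' + s *\<^sub>R u) has_vector_derivative u) (at r)"
        by (auto intro!: derivative_eq_intros simp: has_vector_derivative_def)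
      show "fdt (x' + r *\<^sub>R u) u" using in\<Omega>[of r] \<open>r \<in> _\<close> by auto
    qed
    then show ?thesis unfolding local_future_def using in\<Omega>
      by (intro CollectI case_prodI exI[of _ "\<lambda>s. x' + s *\<^sub>R u"] exI[of _ 0] exI[of _ h]) auto
  qed
  show thesis
  proof (rule that[OF d(1)])
    fix h u assume h: "0 < h" "h < d" and u: "dist u v < d"
    \<comment> \<open>The velocity then changes by at most \<open>d1 - d\<close>, so it stays within
      \<open>d1\<close> of \<open>v\<close>; the other entry keeps the starting point within
      \<open>d1 / 2\<close> of \<open>x\<close>.\<close>
    define e where "e = min (d1 / 2) (h * (d1 - d) / 2)"
    have e: "e > 0" using d1 h d by (auto simp: e_def)
    have "ball (x, x + h *\<^sub>R u) e \<subseteq> local_future"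
    proof
      fix z assume z: "z \<in> ball (x, x + h *\<^sub>R u) e"
      obtain x' y' where xy: "z = (x', y')" by (cases z)
      have dx: "dist x x' < e" and dy: "dist (x + h *\<^sub>R u) y' < e"
        using z dist_fst_le[of "(x, x + h *\<^sub>R u)" z] dist_snd_le[of "(x, x + h *\<^sub>R u)" z] by (auto simp: xy)
      define u' where "u' = (1 / h) *\<^sub>R (y' - x')"
      have "u' - u = (1 / h) *\<^sub>R ((y' - (x + h *\<^sub>R u)) + (x - x'))"
        using h by (simp add: u'_def algebra_simps)
      then have "norm (u' - u) = (1 / h) * norm ((y' - (x + h *\<^sub>R u)) + (x - x'))" using h by simp
      also have "\<dots> \<le> (1 / h) * (e + e)"
        using dx dy h by (intro mult_left_mono norm_triangle_le) (auto simp: dist_norm norm_minus_commute)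
      also have "\<dots> \<le> d1 - d" using h by (simp add: e_def field_simps min_def)
      finally have "dist u' v < d1" using u dist_triangle[of u' v u] by (simp add: dist_norm)
      moreover have "dist x' x < d1 / 2" using dx by (simp add: e_def dist_commute)
      ultimately have "(x', x' + h *\<^sub>R u') \<in> local_future" using seg h by blast
      then show "z \<in> local_future" using h by (simp add: xy u'_def)
    qed
    then show "(x, x + h *\<^sub>R u) \<in> interior local_future"
      using e by (meson mem_interior)
  qed
qed

lemma lipschitz_vector_derivative_norm_le:
  fixes \<zeta> :: "real \<Rightarrow> 'a::real_normed_vector"
  assumes lip: "L-lipschitz_on {a..b} \<zeta>" and r: "r \<in> {a<..<b}" and d: "(\<zeta> has_vector_derivative v) (at r)"
  shows "norm v \<le> L"
proof -
  have "norm v \<le> L + e" if e: "e > 0" for e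
  proof -
    obtain d' where d': "d' > 0" "\<And>y. norm (y - r) < d' \<Longrightarrow> norm (\<zeta> y - \<zeta> r - (y - r) *\<^sub>R v) \<le> e * norm (y - r)"
      using d e unfolding has_vector_derivative_def has_derivative_at_alt by blast
    define h where "h = min (d' / 2) (b - r)"
    have h: "h > 0" "h < d'" "r + h \<in> {a..b}" using d' r by (auto simp: h_def)
    have "norm (\<zeta> (r + h) - \<zeta> r - h *\<^sub>R v) \<le> e * h" using d'(2)[of "r + h"] h by simp
    moreover have "norm (\<zeta> (r + h) - \<zeta> r) \<le> L * h"
      using lipschitz_on_normD[OF lip h(3), of r] r h by simp
    ultimately have "norm (h *\<^sub>R v) \<le> L * h + e * h"
      using norm_triangle_sub[of "h *\<^sub>R v" "\<zeta> (r + h) - \<zeta> r"] by (simp add: norm_minus_commute)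
    then have "h * norm v \<le> h * (L + e)" using h by (simp add: algebra_simps)
    then show ?thesis using h by simp
  qed
  then show ?thesis by (rule field_le_epsilon)
qed

end

section \<open>Perturbing a causal curve into a timelike one\<close>

lemma lipschitz_on_of_vector_derivative_bound:
  fixes w :: "real \<Rightarrow> 'a::real_normed_vector"
  assumes d: "\<And>s. s \<in> {a..b} \<Longrightarrow> (w has_vector_derivative w' s) (at s)"
    and bd: "\<And>s. s \<in> {a..b} \<Longrightarrow> norm (w' s) \<le> C" and "C \<ge> 0"
  shows "C-lipschitz_on {a..b} w"
proof (rule lipschitz_onI)
  fix x y assume xy: "x \<in> {a..b}" "y \<in> {a..b}"
  have "norm (w x - w y) \<le> C * norm (x - y)"
  proof (rule differentiable_bound[OF convex_real_interval(5) _ _ xy])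
    show "(w has_derivative (\<lambda>h. h *\<^sub>R w' s)) (at s within {a..b})" if "s \<in> {a..b}" for s
      using d[OF that] unfolding has_vector_derivative_def by (rule has_derivative_at_withinI)
    show "onorm (\<lambda>h. h *\<^sub>R w' s) \<le> C" if "s \<in> {a..b}" for s
      using bd[OF that] \<open>C \<ge> 0\<close> by (intro onorm_bound) (auto simp: mult.commute[of C] intro: mult_left_mono)
  qed
  then show "dist (w x) (w y) \<le> C * dist x y" by (simp add: dist_norm)
qed fact

context lorentz_metric
begin

text \<open>Adding a deviation \<open>w\<close> with \<open>w' = k (V + \<theta>)\<close>, \<open>k\<close> at least a fixed multiple of \<open>norm w\<close>, makes a
  causal curve timelike: the gain \<open>k G(\<zeta>', V)\<close> absorbs the change of the light cones along \<open>w\<close>.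
  This holds for \<open>w = \<delta> + \<epsilon> (exp (K s) - 1) V\<close> with \<open>\<delta>\<close> linear and \<open>K\<close> large.\<close>
lemma causal_curve_perturbation:
  assumes box: "is_box x0 \<rho> c L \<eta>" and \<zeta>: "coord_curve fdc \<zeta> a b" "\<zeta> ` {a..b} \<subseteq> ball x0 \<rho>"
  obtains M \<epsilon>0 where "M \<ge> 0" "\<epsilon>0 > 0"
    "\<And>\<epsilon> \<delta>0 \<delta>1. 0 < \<epsilon> \<Longrightarrow> \<epsilon> < \<epsilon>0 \<Longrightarrow> norm \<delta>0 \<le> \<epsilon> \<Longrightarrow> norm \<delta>1 \<le> \<epsilon> \<Longrightarrow>
      (\<zeta> a + \<delta>0, \<zeta> b + \<delta>1 + (M * \<epsilon>) *\<^sub>R \<tau> x0) \<in> local_future"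
proof -
  define V where "V = \<tau> x0"
  have bx: "\<rho> > 0" "c > 0" "L \<ge> 0" "\<eta> > 0" "cball x0 \<rho> \<subseteq> \<Omega>"
    and bW: "\<And>y W. y \<in> cball x0 \<rho> \<Longrightarrow> W \<in> cball V \<eta> \<Longrightarrow> G y W W \<le> -c \<and> G y W V \<le> -c"
    and bV: "\<And>x. x \<in> cball x0 \<rho> \<Longrightarrow> fdt x V"
    and bv: "\<And>x y v W. x \<in> cball x0 \<rho> \<Longrightarrow> y \<in> cball x0 \<rho> \<Longrightarrow> W \<in> cball V \<eta> \<Longrightarrow> fdc x v \<Longrightarrow> G y v W \<le> -c * norm v"
    and bL: "\<And>x y u w. x \<in> cball x0 \<rho> \<Longrightarrow> y \<in> cball x0 \<rho> \<Longrightarrow> \<bar>G x u w - G y u w\<bar> \<le> L * dist x y * norm u * norm w"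
    using box unfolding is_box_def V_def by blast+
  have "a < b" using \<zeta>(1) by (simp add: coord_curve_def)
  obtain \<Lambda> N where \<Lambda>: "\<Lambda>-lipschitz_on {a..b} \<zeta>" and N: "negligible N"
    and dN: "\<And>r. r \<in> {a<..<b} - N \<Longrightarrow> \<exists>v. (\<zeta> has_vector_derivative v) (at r) \<and> fdc (\<zeta> r) v"
    using \<zeta>(1) unfolding coord_curve_def by blast
  have \<Lambda>0: "\<Lambda> \<ge> 0" using \<Lambda> by (rule lipschitz_on_nonneg)
  define l where "l = b - a"
  have l: "l > 0" using \<open>a < b\<close> by (simp add: l_def)
  \<comment> \<open>The first entry gives \<open>norm (\<theta> s) \<le> \<eta>\<close>. The second
    makes the gain \<open>2 * k * c * norm v\<close> at least as large as the loss from evaluating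
    \<open>v\<close> in the metric at the shifted point; strict negativity then comes from the term
    quadratic in \<open>k\<close>.\<close>
  define K where "K = max (2 / (l * \<eta>)) (L * \<Lambda> * (1 + norm V) / (2 * c))"
  have K1: "2 / (l * \<eta>) \<le> K" and K2: "L * \<Lambda> * (1 + norm V) / (2 * c) \<le> K" by (auto simp: K_def)
  have "2 / (l * \<eta>) > 0" using l bx by simp
  with K1 have K: "K > 0" by linarith
  define E where "E = (\<lambda>s. exp (K * (s - a)))"
  define M where "M = exp (K * l) - 1"
  have M: "M \<ge> 0" using K l by (simp add: M_def)
  have "compact (\<zeta> ` {a..b})"
    using lipschitz_on_continuous_on[OF \<Lambda>] by (rule compact_continuous_image) simp
  then obtain d where d: "d > 0" "(\<Union>x\<in>\<zeta> ` {a..b}. ball x d) \<subseteq> ball x0 \<rho>"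
    using compact_subset_open_imp_ball_epsilon_subset[OF _ open_ball \<zeta>(2)] by blast
  \<comment> \<open>Since \<open>norm (w s) \<le> \<epsilon> * (M + 1) * (1 + norm V)\<close>, this
    keeps the perturbed curve within \<open>d\<close> of \<zeta> and so inside the box.\<close>
  define \<epsilon>0 where "\<epsilon>0 = d / ((M + 1) * (1 + norm V))"
  have V1: "1 + norm V > 0" by (simp add: add_pos_nonneg)
  have \<epsilon>0: "\<epsilon>0 > 0" using d M V1 by (simp add: \<epsilon>0_def)
  show thesis
  proof (rule that[OF M \<epsilon>0])
    fix \<epsilon> :: real and \<delta>0 \<delta>1 :: 'e assume \<epsilon>: "0 < \<epsilon>" "\<epsilon> < \<epsilon>0" and \<delta>: "norm \<delta>0 \<le> \<epsilon>" "norm \<delta>1 \<le> \<epsilon>"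
    define k where "k = (\<lambda>s. \<epsilon> * K * E s)"
    \<comment> \<open>The constant velocity of the linear interpolation from \<delta>0 to \<delta>1
      is written as \<open>k s\<close> times a small vector, so that it counts as a tilt of
      \<open>V\<close>.\<close>
    define \<theta> where "\<theta> = (\<lambda>s. (1 / (l * k s)) *\<^sub>R (\<delta>1 - \<delta>0))"
    define w where "w = (\<lambda>s. \<delta>0 + ((s - a) / l) *\<^sub>R (\<delta>1 - \<delta>0) + (\<epsilon> * (E s - 1)) *\<^sub>R V)"
    have E1: "1 \<le> E s" "E s \<le> M + 1" if "s \<in> {a..b}" for s
      using that K by (auto simp: E_def M_def l_def)
    have kpos: "k s > 0" for s using \<epsilon> K by (simp add: k_def E_def)
    have wd: "(w has_vector_derivative (k s *\<^sub>R (V + \<theta> s))) (at s)" for s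
    proof -
      have "(w has_vector_derivative ((1 / l) *\<^sub>R (\<delta>1 - \<delta>0) + (\<epsilon> * (K * E s)) *\<^sub>R V)) (at s)"
        unfolding w_def E_def
        by (rule derivative_eq_intros refl | simp add: algebra_simps l less_imp_neq[OF l, symmetric])+
      also have "(1 / l) *\<^sub>R (\<delta>1 - \<delta>0) + (\<epsilon> * (K * E s)) *\<^sub>R V = k s *\<^sub>R (V + \<theta> s)"
      proof -
        have "k s * (1 / (l * k s)) = 1 / l" using kpos[of s] l by (simp add: field_simps)
        then have "k s *\<^sub>R \<theta> s = (1 / l) *\<^sub>R (\<delta>1 - \<delta>0)" by (simp only: \<theta>_def scaleR_scaleR)
        moreover have "\<epsilon> * (K * E s) = k s" by (simp add: k_def)
        ultimately show ?thesis by (simp only: scaleR_add_right add.commute)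
      qed
      finally show ?thesis .
    qed
    have nw: "norm (w s) \<le> \<epsilon> * E s * (1 + norm V)" if s: "s \<in> {a..b}" for s
    proof -
      define t where "t = (s - a) / l"
      have t: "0 \<le> t" "t \<le> 1" using s l by (auto simp: t_def l_def)
      have "norm (\<delta>0 + t *\<^sub>R (\<delta>1 - \<delta>0)) = norm ((1 - t) *\<^sub>R \<delta>0 + t *\<^sub>R \<delta>1)" by (simp add: algebra_simps)
      also have "\<dots> \<le> (1 - t) * norm \<delta>0 + t * norm \<delta>1" using norm_triangle_ineq[of "(1 - t) *\<^sub>R \<delta>0" "t *\<^sub>R \<delta>1"] t by simp
      also have "\<dots> \<le> (1 - t) * \<epsilon> + t * \<epsilon>" using t \<delta> by (intro add_mono mult_left_mono) auto
      also have "\<dots> = \<epsilon>" by (simp add: algebra_simps)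
      finally have 1: "norm (\<delta>0 + t *\<^sub>R (\<delta>1 - \<delta>0)) \<le> \<epsilon>" .
      have 2: "norm ((\<epsilon> * (E s - 1)) *\<^sub>R V) = \<epsilon> * (E s - 1) * norm V" using \<epsilon> E1[OF s] by simp
      have "norm (w s) \<le> \<epsilon> + \<epsilon> * (E s - 1) * norm V"
        using norm_triangle_ineq[of "\<delta>0 + t *\<^sub>R (\<delta>1 - \<delta>0)" "(\<epsilon> * (E s - 1)) *\<^sub>R V"] 1 2
        unfolding w_def t_def by linarith
      also have "\<dots> = \<epsilon> * (1 + (E s - 1) * norm V)" by (simp add: algebra_simps)
      also have "\<dots> \<le> \<epsilon> * (E s * (1 + norm V))"
        using \<epsilon> E1[OF s] by (intro mult_left_mono) (auto simp: algebra_simps add_increasing2)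
      finally show ?thesis by (simp add: mult.assoc)
    qed
    have n\<theta>: "norm (\<theta> s) \<le> \<eta>" if s: "s \<in> {a..b}" for s
    proof -
      have "norm (\<theta> s) = norm (\<delta>1 - \<delta>0) / (l * k s)" using l kpos[of s] by (simp add: \<theta>_def)
      also have "\<dots> \<le> (2 * \<epsilon>) / (l * k s)"
        using \<delta> l kpos[of s] norm_triangle_ineq4[of \<delta>1 \<delta>0] by (intro divide_right_mono) auto
      also have "\<dots> = 2 / (l * K * E s)" using \<epsilon> by (simp add: k_def)
      also have "\<dots> \<le> 2 / (l * K)" using E1[OF s] l K by (intro divide_left_mono) auto
      also have "\<dots> \<le> \<eta>" using K1 K l bx by (simp add: field_simps)
      finally show ?thesis .
    qed
    define \<xi> where "\<xi> = (\<lambda>s. \<zeta> s + w s)"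
    have in_ball: "\<xi> s \<in> ball x0 \<rho>" if s: "s \<in> {a..b}" for s
    proof -
      have "norm (w s) \<le> \<epsilon> * E s * (1 + norm V)" by (rule nw[OF s])
      also have "\<dots> \<le> \<epsilon> * (M + 1) * (1 + norm V)"
        using E1[OF s] \<epsilon> by (intro mult_right_mono mult_left_mono) auto
      also have "\<dots> < \<epsilon>0 * (M + 1) * (1 + norm V)"
        using \<epsilon> M V1 by (intro mult_strict_right_mono) auto
      also have "\<dots> = d" using M V1 by (simp add: \<epsilon>0_def)
      finally have "\<xi> s \<in> ball (\<zeta> s) d" by (simp add: \<xi>_def dist_norm)
      then show ?thesis using d(2) s by blast
    qed
    have "coord_curve fdt \<xi> a b"
      unfolding coord_curve_def
    proof (intro conjI exI[of _ N] ballI)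
      have "(\<epsilon> * K * (M + 1) * (norm V + \<eta>))-lipschitz_on {a..b} w"
      proof (rule lipschitz_on_of_vector_derivative_bound[OF wd])
        fix s assume s: "s \<in> {a..b}"
        have "norm (k s *\<^sub>R (V + \<theta> s)) = k s * norm (V + \<theta> s)" using kpos[of s] by simp
        also have "\<dots> \<le> (\<epsilon> * K * (M + 1)) * (norm V + \<eta>)"
          using E1[OF s] \<epsilon> K M n\<theta>[OF s] kpos[of s] norm_triangle_ineq[of V "\<theta> s"] unfolding k_def
          by (intro mult_mono) auto
        finally show "norm (k s *\<^sub>R (V + \<theta> s)) \<le> \<epsilon> * K * (M + 1) * (norm V + \<eta>)" .
      qed (use \<epsilon> K M bx in auto)
      then show "\<exists>L. L-lipschitz_on {a..b} \<xi>"
        unfolding \<xi>_def using lipschitz_on_add[OF \<Lambda>] by blast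
      fix r assume r: "r \<in> {a<..<b} - N"
      obtain v where v: "(\<zeta> has_vector_derivative v) (at r)" "fdc (\<zeta> r) v" using dN[OF r] by blast
      have rab: "r \<in> {a..b}" using r by auto
      let ?W = "V + \<theta> r"
      let ?u = "v + k r *\<^sub>R ?W"
      have "(\<xi> has_vector_derivative ?u) (at r)"
        unfolding \<xi>_def by (rule has_vector_derivative_add[OF v(1) wd])
      moreover have "fdt (\<xi> r) ?u"
      proof -
        have y: "\<xi> r \<in> cball x0 \<rho>" "\<xi> r \<in> \<Omega>" "\<zeta> r \<in> cball x0 \<rho>"
          using in_ball[OF rab] bx \<zeta>(2) rab by (force simp: subset_iff)+
        note ex = lorentzian_expand[OF lorentz[OF y(2)]]
        have W: "?W \<in> cball V \<eta>" using n\<theta>[OF rab] by (simp add: dist_norm)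
        have V: "V \<in> cball V \<eta>" using bx by simp
        have nv: "norm v \<le> \<Lambda>" using lipschitz_vector_derivative_norm_le[OF \<Lambda> _ v(1)] r by simp
        have "G (\<xi> r) v v \<le> G (\<zeta> r) v v + L * dist (\<xi> r) (\<zeta> r) * norm v * norm v"
          using bL[OF y(1,3), of v v] by linarith
        also have "\<dots> \<le> L * dist (\<xi> r) (\<zeta> r) * norm v * norm v" using v by (simp add: fdc_def)
        also have "dist (\<xi> r) (\<zeta> r) = norm (w r)" by (simp add: \<xi>_def dist_norm)
        also have "L * norm (w r) * norm v * norm v \<le> L * (\<epsilon> * E r * (1 + norm V)) * \<Lambda> * norm v"
          using nw[OF rab] order_trans[OF norm_ge_zero nw[OF rab]] nv bx \<Lambda>0 by (intro mult_right_mono mult_mono) auto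
        also have "\<dots> = (L * \<Lambda> * (1 + norm V)) * (\<epsilon> * E r * norm v)" by simp
        also have "\<dots> \<le> (2 * c * K) * (\<epsilon> * E r * norm v)"
          using K2 bx \<epsilon> by (intro mult_right_mono) (auto simp: E_def field_simps)
        also have "\<dots> = 2 * k r * (c * norm v)" by (simp add: k_def)
        finally have gvv: "G (\<xi> r) v v \<le> 2 * k r * (c * norm v)" .
        have "2 * k r * G (\<xi> r) v ?W \<le> 2 * k r * (- c * norm v)"
          using bv[OF y(3,1) W v(2)] kpos[of r] by (intro mult_left_mono) auto
        moreover have "k r * k r * G (\<xi> r) ?W ?W < 0"
          using bW[OF y(1) W] kpos[of r] bx by (intro mult_pos_neg) auto
        moreover have "G (\<xi> r) ?u ?u = G (\<xi> r) v v + 2 * k r * G (\<xi> r) v ?W + k r * k r * G (\<xi> r) ?W ?W"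
        proof -
          have "G (\<xi> r) (v + x) (v + x) = G (\<xi> r) v v + 2 * G (\<xi> r) v x + G (\<xi> r) x x" for x
            using lorentzian_sym[OF lorentz[OF y(2)], of x v] by (simp add: ex(1,2))
          from this[of "k r *\<^sub>R ?W"] show ?thesis by (simp add: ex(5,6))
        qed
        moreover have "2 * k r * (- c * norm v) = - (2 * k r * (c * norm v))" by simp
        ultimately have "G (\<xi> r) ?u ?u < 0" using gvv by linarith
        moreover have "G (\<xi> r) ?u V < 0"
        proof -
          have "G (\<xi> r) ?u V = G (\<xi> r) v V + k r * G (\<xi> r) ?W V" by (simp add: ex(1,5) distrib_left)
          moreover have "G (\<xi> r) v V \<le> - c * norm v" by (rule bv[OF y(3,1) V v(2)])
          moreover have "- c * norm v \<le> 0" using bx by simp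
          moreover have "k r * G (\<xi> r) ?W V < 0"
            using bW[OF y(1) W] kpos[of r] bx by (intro mult_pos_neg) auto
          ultimately show ?thesis by linarith
        qed
        ultimately show ?thesis using fdt_same_orientation[OF y(2) bV[OF y(1)]] by blast
      qed
      ultimately show "\<exists>v. (\<xi> has_vector_derivative v) (at r) \<and> fdt (\<xi> r) v" by blast
    qed (use \<open>a < b\<close> N in auto)
    moreover have "\<xi> ` {a..b} \<subseteq> \<Omega>" using in_ball bx(5) by force
    moreover have "\<xi> a = \<zeta> a + \<delta>0" by (simp add: \<xi>_def w_def E_def)
    moreover have "\<xi> b = \<zeta> b + \<delta>1 + (M * \<epsilon>) *\<^sub>R \<tau> x0"
      using l by (simp add: \<xi>_def w_def E_def M_def V_def l_def[symmetric] mult.commute)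
    ultimately show "(\<zeta> a + \<delta>0, \<zeta> b + \<delta>1 + (M * \<epsilon>) *\<^sub>R \<tau> x0) \<in> local_future"
      unfolding local_future_def by blast
  qed
qed

text \<open>The admissible shifts of the two endpoints fill a neighbourhood, which puts the pair
  into the interior. The price is a displacement of the end by \<open>M * \<epsilon>\<close> along
  \<open>\<tau> x0\<close>, and this tends to 0 with \<epsilon>.\<close>

lemma causal_curve_end_push:
  assumes box: "is_box x0 \<rho> c L \<eta>" and \<zeta>: "coord_curve fdc \<zeta> a b" "\<zeta> ` {a..b} \<subseteq> ball x0 \<rho>" and "e > 0"
  obtains y where "dist y (\<zeta> b) < e" "(\<zeta> a, y) \<in> interior local_future"
proof -
  obtain M \<epsilon>0 where M: "M \<ge> 0" "\<epsilon>0 > 0"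
    and fut: "\<And>\<epsilon> \<delta>0 \<delta>1. 0 < \<epsilon> \<Longrightarrow> \<epsilon> < \<epsilon>0 \<Longrightarrow> norm \<delta>0 \<le> \<epsilon> \<Longrightarrow> norm \<delta>1 \<le> \<epsilon> \<Longrightarrow>
      (\<zeta> a + \<delta>0, \<zeta> b + \<delta>1 + (M * \<epsilon>) *\<^sub>R \<tau> x0) \<in> local_future"
    using causal_curve_perturbation[OF box \<zeta>] by metis
  define \<epsilon> where "\<epsilon> = min (\<epsilon>0 / 2) (e / (2 * (M * norm (\<tau> x0) + 1)))"
  have m: "M * norm (\<tau> x0) + 1 > 0" using M by (simp add: add_nonneg_pos)
  have \<epsilon>: "0 < \<epsilon>" "\<epsilon> < \<epsilon>0" using M \<open>e > 0\<close> m by (auto simp: \<epsilon>_def min_less_iff_disj)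
  define y where "y = \<zeta> b + (M * \<epsilon>) *\<^sub>R \<tau> x0"
  have "dist y (\<zeta> b) = \<epsilon> * (M * norm (\<tau> x0))" using M \<epsilon> by (simp add: y_def dist_norm)
  also have "\<dots> \<le> (e / (2 * (M * norm (\<tau> x0) + 1))) * (M * norm (\<tau> x0) + 1)"
    using M \<epsilon> \<open>e > 0\<close> m by (intro mult_mono) (auto simp: \<epsilon>_def)
  also have "\<dots> = e / 2"
  proof -
    have "e / (2 * X) * X = e / 2" if "X > 0" for X using that by simp
    then show ?thesis using m by blast
  qed
  also have "\<dots> < e" using \<open>e > 0\<close> by simp
  finally have "dist y (\<zeta> b) < e" .
  moreover have "ball (\<zeta> a, y) \<epsilon> \<subseteq> local_future"
  proof
    fix z assume z: "z \<in> ball (\<zeta> a, y) \<epsilon>"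
    have "norm (fst z - \<zeta> a) \<le> \<epsilon>" "norm (snd z - y) \<le> \<epsilon>"
      using z dist_fst_le[of "(\<zeta> a, y)" z] dist_snd_le[of "(\<zeta> a, y)" z] by (auto simp: dist_norm norm_minus_commute)
    from fut[OF \<epsilon> this] show "z \<in> local_future" by (simp add: y_def)
  qed
  then have "(\<zeta> a, y) \<in> interior local_future" using \<epsilon> by (meson mem_interior)
  ultimately show thesis by (rule that)
qed

end

context lorentz_metric
begin

text \<open>The chords starting at a point of differentiability have velocities close to
  \<open>v\<close>. A straight segment replaces the curve between \<open>r\<close> and
  \<open>r + h\<close>, so nothing is asked of the curve at other parameters.\<close>

lemma timelike_derivative_local_future:
  assumes "\<zeta> r \<in> \<Omega>" "fdt (\<zeta> r) v" "(\<zeta> has_vector_derivative v) (at r)"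
  obtains d where "d > 0" "\<And>h. 0 < h \<Longrightarrow> h < d \<Longrightarrow> (\<zeta> r, \<zeta> (r + h)) \<in> interior local_future"
proof -
  obtain d1 where d1: "d1 > 0"
    "\<And>h u. 0 < h \<Longrightarrow> h < d1 \<Longrightarrow> dist u v < d1 \<Longrightarrow> (\<zeta> r, \<zeta> r + h *\<^sub>R u) \<in> interior local_future"
    using straight_segment_local_future[OF assms(1,2)] by metis
  obtain d2 where d2: "d2 > 0"
    "\<And>y. norm (y - r) < d2 \<Longrightarrow> norm (\<zeta> y - \<zeta> r - (y - r) *\<^sub>R v) \<le> d1 / 2 * norm (y - r)"
    using assms(3) \<open>d1 > 0\<close> unfolding has_vector_derivative_def has_derivative_at_alt by (metis half_gt_zero)
  show thesis
  proof (rule that[of "min d1 d2"])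
    show "min d1 d2 > 0" using d1 d2 by simp
    fix h :: real assume h: "0 < h" "h < min d1 d2"
    define u where "u = (1 / h) *\<^sub>R (\<zeta> (r + h) - \<zeta> r)"
    have "u - v = (1 / h) *\<^sub>R (\<zeta> (r + h) - \<zeta> r - h *\<^sub>R v)"
      using h by (simp add: u_def algebra_simps)
    then have "norm (u - v) = (1 / h) * norm (\<zeta> (r + h) - \<zeta> r - h *\<^sub>R v)" using h by simp
    also have "\<dots> \<le> (1 / h) * (d1 / 2 * h)"
      using d2(2)[of "r + h"] h by (intro mult_left_mono) auto
    also have "\<dots> < d1" using h d1 by simp
    finally have "(\<zeta> r, \<zeta> r + h *\<^sub>R u) \<in> interior local_future"
      using d1(2)[of h u] h by (simp add: dist_norm)
    then show "(\<zeta> r, \<zeta> (r + h)) \<in> interior local_future" using h by (simp add: u_def)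
  qed
qed

section \<open>A linear time function on a box, and limits of causal curves\<close>

context
  fixes x0 \<rho> c L \<eta> assumes box: "is_box x0 \<rho> c L \<eta>"
begin

lemma box_facts:
  shows "\<rho> > 0" "c > 0" "L \<ge> 0" "x0 \<in> \<Omega>" "cball x0 \<rho> \<subseteq> \<Omega>"
    and "\<And>x v. x \<in> cball x0 \<rho> \<Longrightarrow> fdc x v \<Longrightarrow> c * norm v \<le> - G x0 v (\<tau> x0)"
    and "\<And>x y u w. x \<in> cball x0 \<rho> \<Longrightarrow> y \<in> cball x0 \<rho> \<Longrightarrow> \<bar>G x u w - G y u w\<bar> \<le> L * dist x y * norm u * norm w"
proof -
  have *: "\<rho> > 0" "c > 0" "L \<ge> 0" "\<eta> > 0" "cball x0 \<rho> \<subseteq> \<Omega>"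
    and bv: "\<And>x y v W. x \<in> cball x0 \<rho> \<Longrightarrow> y \<in> cball x0 \<rho> \<Longrightarrow> W \<in> cball (\<tau> x0) \<eta> \<Longrightarrow> fdc x v \<Longrightarrow> G y v W \<le> -c * norm v"
    and bL: "\<And>x y u w. x \<in> cball x0 \<rho> \<Longrightarrow> y \<in> cball x0 \<rho> \<Longrightarrow> \<bar>G x u w - G y u w\<bar> \<le> L * dist x y * norm u * norm w"
    using box unfolding is_box_def by blast+
  show "\<rho> > 0" "c > 0" "L \<ge> 0" "cball x0 \<rho> \<subseteq> \<Omega>" by fact+
  show "x0 \<in> \<Omega>" using * by auto
  show "c * norm v \<le> - G x0 v (\<tau> x0)" if "x \<in> cball x0 \<rho>" "fdc x v" for x v
    using bv[OF that(1) _ _ that(2), of x0 "\<tau> x0"] * by simp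
  show "\<bar>G x u w - G y u w\<bar> \<le> L * dist x y * norm u * norm w" if "x \<in> cball x0 \<rho>" "y \<in> cball x0 \<rho>" for x y u w
    using bL[OF that] .
qed

text \<open>The metric is frozen at the centre to make this linear. On causal vectors of the box it
  is at least \<open>c * norm v\<close>, so it increases along causal curves and controls their
  Euclidean length.\<close>

definition box_time :: "'e \<Rightarrow> real" where "box_time v = - G x0 v (\<tau> x0)"

lemma bounded_linear_metric: "y \<in> \<Omega> \<Longrightarrow> bounded_linear (\<lambda>v. G y v w)"
  using lorentzian_expand[OF lorentz, of y]
  by (intro linear_conv_bounded_linear[THEN iffD1] linearI) auto

lemma bounded_linear_box_time: "bounded_linear box_time"
  unfolding box_time_def by (intro bounded_linear_minus bounded_linear_metric box_facts)

text \<open>Every estimate on chords below is an instance: an inequality that is linear in the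
  derivative passes to the chord by a suitable choice of \<open>F\<close>.\<close>

lemma coord_curve_linear_mono:
  assumes \<zeta>: "coord_curve P \<zeta> a b" and st: "a \<le> s" "s \<le> t" "t \<le> b" and F: "bounded_linear F"
    and nonneg: "\<And>r v. r \<in> {s<..<t} \<Longrightarrow> P (\<zeta> r) v \<Longrightarrow> F v \<ge> (0::real)"
  shows "F (\<zeta> t - \<zeta> s) \<ge> 0"
proof -
  interpret F: bounded_linear F by fact
  obtain \<Lambda> N where \<Lambda>: "\<Lambda>-lipschitz_on {a..b} \<zeta>" and N: "negligible N"
    and dN: "\<And>r. r \<in> {a<..<b} - N \<Longrightarrow> \<exists>v. (\<zeta> has_vector_derivative v) (at r) \<and> P (\<zeta> r) v"
    using \<zeta> unfolding coord_curve_def by blast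
  obtain B where B: "B-lipschitz_on UNIV F" using F.lipschitz_boundE by metis
  have "F (\<zeta> s) \<le> F (\<zeta> t)"
  proof (rule lipschitz_ae_nonneg_deriv_le[OF st(2) _ N])
    have "\<Lambda>-lipschitz_on {s..t} \<zeta>" using \<Lambda> st by (rule_tac lipschitz_on_subset) auto
    from lipschitz_on_compose[OF this lipschitz_on_subset[OF B]]
    show "(B * \<Lambda>)-lipschitz_on {s..t} (\<lambda>x. F (\<zeta> x))" by (simp add: o_def mult.commute)
    fix r assume r: "r \<in> {s<..<t} - N"
    then obtain v where "(\<zeta> has_vector_derivative v) (at r)" "P (\<zeta> r) v" using dN[of r] st by auto
    then show "\<exists>v. ((\<lambda>x. F (\<zeta> x)) has_vector_derivative v) (at r) \<and> 0 \<le> v"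
      using F.has_vector_derivative nonneg r by blast
  qed
  then show ?thesis by (simp add: F.diff)
qed

text \<open>The norm is not linear, so it is tested against the direction \<open>e\<close> of the
  chord. If two points coincide, the estimate forces the curve to be constant between them, against
  the nonzero derivative at some parameter.\<close>

lemma causal_curve_box_time:
  assumes \<zeta>: "coord_curve fdc \<zeta> a b" "\<zeta> ` {a..b} \<subseteq> cball x0 \<rho>" and st: "a \<le> s" "s < t" "t \<le> b"
  shows "c * norm (\<zeta> t - \<zeta> s) \<le> box_time (\<zeta> t - \<zeta> s)" "\<zeta> t \<noteq> \<zeta> s"
proof -
  have le: "c * norm (\<zeta> t - \<zeta> s) \<le> box_time (\<zeta> t - \<zeta> s)" if st: "a \<le> s" "s < t" "t \<le> b" for s t
  proof -
    define e where "e = sgn (\<zeta> t - \<zeta> s)"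
    have "norm e \<le> 1" by (simp add: e_def norm_sgn)
    have "box_time (\<zeta> t - \<zeta> s) - c * ((\<zeta> t - \<zeta> s) \<bullet> e) \<ge> 0"
    proof (rule coord_curve_linear_mono[OF \<zeta>(1) st(1) _ st(3)])
      show "s \<le> t" using st by simp
      show "bounded_linear (\<lambda>v. box_time v - c * (v \<bullet> e))"
        by (intro bounded_linear_sub bounded_linear_box_time bounded_linear_mult_right[THEN bounded_linear_compose] bounded_linear_inner_left)
      fix r v assume r: "r \<in> {s<..<t}" "fdc (\<zeta> r) v"
      have "c * norm v \<le> box_time v" unfolding box_time_def
        using r st by (intro box_facts(6)[of "\<zeta> r"] subsetD[OF \<zeta>(2)]) auto
      moreover have "v \<bullet> e \<le> norm v"
        using norm_cauchy_schwarz[of v e] mult_left_mono[OF \<open>norm e \<le> 1\<close> norm_ge_zero[of v]] by simp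
      then have "c * (v \<bullet> e) \<le> c * norm v" using box_facts(2) by simp
      ultimately show "box_time v - c * (v \<bullet> e) \<ge> 0" by simp
    qed
    moreover have "(\<zeta> t - \<zeta> s) \<bullet> e = norm (\<zeta> t - \<zeta> s)"
      by (cases "\<zeta> t = \<zeta> s") (simp_all add: e_def sgn_div_norm dot_square_norm power2_eq_square)
    ultimately show ?thesis by simp
  qed
  show "c * norm (\<zeta> t - \<zeta> s) \<le> box_time (\<zeta> t - \<zeta> s)" by (rule le[OF st])
  show "\<zeta> t \<noteq> \<zeta> s"
  proof
    assume eq: "\<zeta> t = \<zeta> s"
    interpret bt: bounded_linear box_time by (rule bounded_linear_box_time)
    have const: "\<zeta> r = \<zeta> s" if r: "r \<in> {s<..<t}" for r
    proof -
      have "c * norm (\<zeta> r - \<zeta> s) \<le> box_time (\<zeta> r - \<zeta> s)" "c * norm (\<zeta> t - \<zeta> r) \<le> box_time (\<zeta> t - \<zeta> r)"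
        using r st by (auto intro!: le)
      moreover have "box_time (\<zeta> t - \<zeta> r) = - box_time (\<zeta> r - \<zeta> s)" by (simp add: eq bt.diff)
      moreover have "0 \<le> c * norm (\<zeta> r - \<zeta> s)" "0 \<le> c * norm (\<zeta> t - \<zeta> r)" using box_facts(2) by auto
      ultimately have "c * norm (\<zeta> r - \<zeta> s) = 0" by linarith
      then show ?thesis using box_facts(2) by simp
    qed
    obtain N where N: "negligible N"
      and dN: "\<And>r. r \<in> {a<..<b} - N \<Longrightarrow> \<exists>v. (\<zeta> has_vector_derivative v) (at r) \<and> fdc (\<zeta> r) v"
      using \<zeta> unfolding coord_curve_def by blast
    have "\<not> negligible {s<..<t}" using st by (simp add: open_not_negligible)
    then obtain r where r: "r \<in> {s<..<t}" "r \<notin> N" using N negligible_subset by blast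
    then obtain v where v: "(\<zeta> has_vector_derivative v) (at r)" "fdc (\<zeta> r) v" using dN[of r] st by auto
    have "(\<zeta> has_vector_derivative 0) (at r)"
      by (rule has_vector_derivative_transform_within_open[of "\<lambda>_. \<zeta> s" _ _ "{s<..<t}"]) (use r const in auto)
    then have "v = 0" using v(1) vector_derivative_unique_at by blast
    then show False using v(2) by (simp add: fdc_def)
  qed
qed

text \<open>In the metric at a curve point, a causal \<open>v\<close> has negative product with the
  timelike \<open>w\<close>. Passing to the metric at \<open>z\<close> costs at most
  \<open>L * r * norm v * norm w\<close>, and \<open>norm v\<close> is at most
  \<open>box_time v / c\<close>. As the radius shrinks this becomes the linear inequality that
  characterises causal derivatives at \<open>z\<close>.\<close>

lemma causal_curve_cone_estimate:
  assumes \<zeta>: "coord_curve fdc \<zeta> a b" "\<zeta> ` {a..b} \<subseteq> cball x0 \<rho>" and st: "a \<le> s" "s \<le> t" "t \<le> b"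
    and near: "\<zeta> ` {s..t} \<subseteq> cball z r" and z: "z \<in> cball x0 \<rho>"
    and w: "\<And>y. y \<in> cball z r \<Longrightarrow> y \<in> cball x0 \<rho> \<Longrightarrow> fdt y w"
  shows "G z (\<zeta> t - \<zeta> s) w \<le> L * r * norm w / c * box_time (\<zeta> t - \<zeta> s)"
proof -
  have c: "c > 0" by (rule box_facts)
  have r: "r \<ge> 0" using near st by (auto simp: image_subset_iff dest!: bspec[of _ _ s] order_trans[OF zero_le_dist])
  have z\<Omega>: "z \<in> \<Omega>" using z box_facts(5) by blast
  have "L * r * norm w / c * box_time (\<zeta> t - \<zeta> s) - G z (\<zeta> t - \<zeta> s) w \<ge> 0"
  proof (rule coord_curve_linear_mono[OF \<zeta>(1) st])
    show "bounded_linear (\<lambda>v. L * r * norm w / c * box_time v - G z v w)"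
      by (intro bounded_linear_sub bounded_linear_mult_right[THEN bounded_linear_compose]
          bounded_linear_box_time bounded_linear_metric z\<Omega>)
    fix q v assume q: "q \<in> {s<..<t}" "fdc (\<zeta> q) v"
    have y: "\<zeta> q \<in> cball x0 \<rho>" "\<zeta> q \<in> cball z r" "\<zeta> q \<in> \<Omega>"
      using q st \<zeta>(2) near box_facts(5) by (auto simp: image_subset_iff)
    have "G z v w \<le> G (\<zeta> q) v w + L * dist z (\<zeta> q) * norm v * norm w"
      using box_facts(7)[OF z y(1), of v w] by linarith
    also have "\<dots> \<le> L * dist z (\<zeta> q) * norm v * norm w"
      using fdc_fdt_neg[OF y(3) q(2) w[OF y(2,1)]] by simp
    also have "\<dots> \<le> L * r * norm v * norm w"
      using y box_facts(3) by (intro mult_right_mono mult_left_mono) auto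
    also have "\<dots> = L * r * norm w / c * (c * norm v)" using c by simp
    also have "\<dots> \<le> L * r * norm w / c * box_time v"
      unfolding box_time_def using box_facts(6)[OF y(1) q(2)] box_facts(3) r c
      by (intro mult_left_mono) auto
    finally show "0 \<le> L * r * norm w / c * box_time v - G z v w" by simp
  qed
  then show ?thesis by simp
qed

text \<open>The cone estimate does not depend on the parametrisation, so no differentiability of the change
  of parameter is needed.\<close>
lemma causal_curve_time_parametrisation:
  assumes \<zeta>: "coord_curve fdc \<zeta> a b" "\<zeta> ` {a..b} \<subseteq> cball x0 \<rho>"
  obtains \<xi> where "\<xi> 0 = \<zeta> a" "\<xi> 1 = \<zeta> b" "\<xi> ` {0..1} \<subseteq> \<zeta> ` {a..b}"
    "\<And>u u'. 0 \<le> u \<Longrightarrow> u \<le> u' \<Longrightarrow> u' \<le> 1 \<Longrightarrow> box_time (\<xi> u' - \<xi> u) = box_time (\<zeta> b - \<zeta> a) * (u' - u)"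
    "\<And>u u'. 0 \<le> u \<Longrightarrow> u \<le> u' \<Longrightarrow> u' \<le> 1 \<Longrightarrow> c * norm (\<xi> u' - \<xi> u) \<le> box_time (\<xi> u' - \<xi> u)"
    "\<And>u u' z r w. 0 \<le> u \<Longrightarrow> u \<le> u' \<Longrightarrow> u' \<le> 1 \<Longrightarrow> \<xi> ` {u..u'} \<subseteq> cball z r \<Longrightarrow> z \<in> cball x0 \<rho> \<Longrightarrow>
       (\<And>y. y \<in> cball z r \<Longrightarrow> y \<in> cball x0 \<rho> \<Longrightarrow> fdt y w) \<Longrightarrow>
       G z (\<xi> u' - \<xi> u) w \<le> L * r * norm w / c * box_time (\<xi> u' - \<xi> u)"
proof -
  interpret bt: bounded_linear box_time by (rule bounded_linear_box_time)
  have ab: "a < b" using \<zeta> by (simp add: coord_curve_def)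
  obtain \<Lambda> where \<Lambda>: "\<Lambda>-lipschitz_on {a..b} \<zeta>" using \<zeta> by (auto simp: coord_curve_def)
  define l where "l = box_time (\<zeta> b - \<zeta> a)"
  define f where "f = (\<lambda>t. box_time (\<zeta> t - \<zeta> a))"
  have f_less: "f s < f t" if "a \<le> s" "s < t" "t \<le> b" for s t
  proof -
    have "0 < c * norm (\<zeta> t - \<zeta> s)" using causal_curve_box_time(2)[OF \<zeta> that] box_facts(2) by simp
    also have "\<dots> \<le> box_time (\<zeta> t - \<zeta> s)" by (rule causal_curve_box_time(1)[OF \<zeta> that])
    also have "\<dots> = f t - f s" by (simp add: f_def bt.diff)
    finally show ?thesis by simp
  qed
  have fab: "f a = 0" "f b = l" by (simp_all add: f_def l_def bt.zero)
  have l: "l > 0" using f_less[of a b] ab fab by simp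
  have contf: "continuous_on {a..b} f"
    unfolding f_def by (intro bt.continuous_on continuous_intros lipschitz_on_continuous_on[OF \<Lambda>])
  have "\<forall>u. \<exists>t. u \<in> {0..1} \<longrightarrow> t \<in> {a..b} \<and> f t = l * u"
  proof (intro allI)
    fix u :: real
    show "\<exists>t. u \<in> {0..1} \<longrightarrow> t \<in> {a..b} \<and> f t = l * u"
    proof (cases "u \<in> {0..1}")
      case True
      then have "\<exists>t\<ge>a. t \<le> b \<and> f t = l * u"
        using contf ab l fab by (intro IVT') (auto simp: mult_left_le)
      then show ?thesis by auto
    qed auto
  qed
  from choice[OF this] obtain g where g: "\<And>u. u \<in> {0..1} \<Longrightarrow> g u \<in> {a..b}" "\<And>u. u \<in> {0..1} \<Longrightarrow> f (g u) = l * u"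
    by blast
  have inj: "s = t" if "s \<in> {a..b}" "t \<in> {a..b}" "f s = f t" for s t
    using f_less[of s t] f_less[of t s] that by (cases s t rule: linorder_cases) auto
  have f_le: "f s \<le> f t \<longleftrightarrow> s \<le> t" if "s \<in> {a..b}" "t \<in> {a..b}" for s t
    using f_less[of s t] f_less[of t s] that by (cases s t rule: linorder_cases) auto
  have g_mono: "g u \<le> g u'" if "0 \<le> u" "u \<le> u'" "u' \<le> 1" for u u'
    using f_le[of "g u" "g u'"] g[of u] g[of u'] that l by auto
  define \<xi> where "\<xi> = (\<lambda>u. \<zeta> (g u))"
  have g0: "g 0 = a" using g[of 0] fab ab by (rule_tac inj) auto
  have g1: "g 1 = b" using g[of 1] fab ab by (rule_tac inj) auto
  show thesis
  proof (rule that[of \<xi>])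
    show "\<xi> 0 = \<zeta> a" "\<xi> 1 = \<zeta> b" by (simp_all add: \<xi>_def g0 g1)
    show "\<xi> ` {0..1} \<subseteq> \<zeta> ` {a..b}" using g by (auto simp: \<xi>_def)
    fix u u' :: real assume u: "0 \<le> u" "u \<le> u'" "u' \<le> 1"
    have gu: "a \<le> g u" "g u \<le> g u'" "g u' \<le> b" using g[of u] g[of u'] u g_mono[OF u] by auto
    have "box_time (\<xi> u' - \<xi> u) = f (g u') - f (g u)" by (simp add: \<xi>_def f_def bt.diff)
    also have "\<dots> = l * (u' - u)" using g u by (simp add: algebra_simps)
    finally show "box_time (\<xi> u' - \<xi> u) = box_time (\<zeta> b - \<zeta> a) * (u' - u)" by (simp add: l_def)
    show "c * norm (\<xi> u' - \<xi> u) \<le> box_time (\<xi> u' - \<xi> u)"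
      using causal_curve_box_time(1)[OF \<zeta> gu(1) _ gu(3)] gu(2) bt.zero
      by (cases "g u = g u'") (auto simp: \<xi>_def)
    fix z r w assume near: "\<xi> ` {u..u'} \<subseteq> cball z r" and z: "z \<in> cball x0 \<rho>"
      and w: "\<And>y. y \<in> cball z r \<Longrightarrow> y \<in> cball x0 \<rho> \<Longrightarrow> fdt y w"
    have "\<zeta> ` {g u..g u'} \<subseteq> cball z r"
    proof (rule image_subsetI)
      fix q assume q: "q \<in> {g u..g u'}"
      \<comment> \<open>The hypothesis concerns only the points of \<xi> over
        \<open>{u..u'}\<close>. Every parameter \<open>q\<close> between \<open>g u\<close> and
        \<open>g u'\<close> is a value of \<open>g\<close> there, since time determines the
        parameter.\<close>
      define p where "p = f q / l"
      have qab: "q \<in> {a..b}" using q gu by auto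
      have "f (g u) \<le> f q" "f q \<le> f (g u')" using q gu f_le qab by auto
      then have p: "u \<le> p" "p \<le> u'" using g[of u] g[of u'] u l by (auto simp: p_def field_simps)
      then have p01: "p \<in> {0..1}" using u by simp
      have "f (g p) = f q" using g(2)[OF p01] l by (simp add: p_def)
      then have "g p = q" by (rule inj[OF g(1)[OF p01] qab])
      then have "\<zeta> q = \<xi> p" by (simp add: \<xi>_def)
      then show "\<zeta> q \<in> cball z r" using near p by (metis atLeastAtMost_iff image_subset_iff)
    qed
    from causal_curve_cone_estimate[OF \<zeta> gu this z w]
    show "G z (\<xi> u' - \<xi> u) w \<le> L * r * norm w / c * box_time (\<xi> u' - \<xi> u)" by (simp add: \<xi>_def)
  qed
qed

end

end

context lorentz_metric
begin

text \<open>Parametrised proportionally to box time, the curves share a Lipschitz constant, so a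
  subsequence converges uniformly. The limit is Lipschitz, hence differentiable almost everywhere,
  and the cone estimates on shrinking balls show that its derivatives are causal.\<close>

lemma causal_curve_limit:
  assumes box: "is_box x0 \<rho> c L \<eta>" and R: "R < \<rho>"
    and \<zeta>: "\<And>n. coord_curve fdc (\<zeta> n) (a n) (b n)" "\<And>n. \<zeta> n ` {a n..b n} \<subseteq> cball x0 R"
    and x: "(\<lambda>n. \<zeta> n (a n)) \<longlonglongrightarrow> x" and y: "(\<lambda>n. \<zeta> n (b n)) \<longlonglongrightarrow> y" and "x \<noteq> y"
  obtains \<xi> where "coord_curve fdc \<xi> 0 1" "\<xi> ` {0..1} \<subseteq> cball x0 R" "\<xi> 0 = x" "\<xi> 1 = y"
proof -
  note bx = box_facts[OF box]
  let ?T = "box_time x0"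
  interpret bt: bounded_linear ?T by (rule bounded_linear_box_time[OF box])
  have sub: "cball x0 R \<subseteq> cball x0 \<rho>" using R by (simp add: subset_cball)
  have \<zeta>': "\<zeta> n ` {a n..b n} \<subseteq> cball x0 \<rho>" for n using \<zeta>(2) sub by blast
  define l where "l = (\<lambda>n. ?T (\<zeta> n (b n) - \<zeta> n (a n)))"
  \<comment> \<open>Collects all properties of one reparametrised curve, with its box time already
    replaced by \<open>l n * (u' - u)\<close>, so that a single choice produces the
    sequence.\<close>
  define Q where "Q = (\<lambda>(n::nat) (\<xi>::real \<Rightarrow> 'e). \<xi> 0 = \<zeta> n (a n) \<and> \<xi> 1 = \<zeta> n (b n) \<and> \<xi> ` {0..1} \<subseteq> cball x0 R \<and>
    (\<forall>u u'. 0 \<le> u \<and> u \<le> u' \<and> u' \<le> 1 \<longrightarrow> ?T (\<xi> u' - \<xi> u) = l n * (u' - u) \<and> c * norm (\<xi> u' - \<xi> u) \<le> l n * (u' - u) \<and>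
      (\<forall>z r w. \<xi> ` {u..u'} \<subseteq> cball z r \<and> z \<in> cball x0 \<rho> \<and> (\<forall>y. y \<in> cball z r \<and> y \<in> cball x0 \<rho> \<longrightarrow> fdt y w) \<longrightarrow>
       G z (\<xi> u' - \<xi> u) w \<le> L * r * norm w / c * (l n * (u' - u)))))"
  have "\<forall>n. \<exists>\<xi>. Q n \<xi>"
  proof
    fix n
    obtain \<xi> where \<xi>: "\<xi> 0 = \<zeta> n (a n)" "\<xi> 1 = \<zeta> n (b n)" "\<xi> ` {0..1} \<subseteq> \<zeta> n ` {a n..b n}"
      and t: "\<And>u u'. 0 \<le> u \<Longrightarrow> u \<le> u' \<Longrightarrow> u' \<le> 1 \<Longrightarrow> ?T (\<xi> u' - \<xi> u) = l n * (u' - u)"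
      and s: "\<And>u u'. 0 \<le> u \<Longrightarrow> u \<le> u' \<Longrightarrow> u' \<le> 1 \<Longrightarrow> c * norm (\<xi> u' - \<xi> u) \<le> ?T (\<xi> u' - \<xi> u)"
      and g: "\<And>u u' z r w. 0 \<le> u \<Longrightarrow> u \<le> u' \<Longrightarrow> u' \<le> 1 \<Longrightarrow> \<xi> ` {u..u'} \<subseteq> cball z r \<Longrightarrow> z \<in> cball x0 \<rho> \<Longrightarrow>
       (\<And>y. y \<in> cball z r \<Longrightarrow> y \<in> cball x0 \<rho> \<Longrightarrow> fdt y w) \<Longrightarrow>
       G z (\<xi> u' - \<xi> u) w \<le> L * r * norm w / c * ?T (\<xi> u' - \<xi> u)"
      unfolding l_def by (rule causal_curve_time_parametrisation[OF box \<zeta>(1) \<zeta>', of n]) blast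
    have "Q n \<xi>"
      unfolding Q_def
    proof (intro conjI allI impI; (elim conjE)?)
      show "\<xi> 0 = \<zeta> n (a n)" "\<xi> 1 = \<zeta> n (b n)" "\<xi> ` {0..1} \<subseteq> cball x0 R" using \<xi> \<zeta>(2)[of n] by auto
      fix u u' :: real assume u: "0 \<le> u" "u \<le> u'" "u' \<le> 1"
      show "?T (\<xi> u' - \<xi> u) = l n * (u' - u)" by (rule t[OF u])
      show "c * norm (\<xi> u' - \<xi> u) \<le> l n * (u' - u)" using s[OF u] t[OF u] by simp
      fix z r w assume "\<xi> ` {u..u'} \<subseteq> cball z r" "z \<in> cball x0 \<rho>" "\<forall>y. y \<in> cball z r \<and> y \<in> cball x0 \<rho> \<longrightarrow> fdt y w"
      then have "G z (\<xi> u' - \<xi> u) w \<le> L * r * norm w / c * ?T (\<xi> u' - \<xi> u)"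
        by (intro g[OF u]) auto
      then show "G z (\<xi> u' - \<xi> u) w \<le> L * r * norm w / c * (l n * (u' - u))" by (simp only: t[OF u])
    qed
    then show "\<exists>\<xi>. Q n \<xi>" by (rule exI[of "Q n"])
  qed
  from choice[OF this] obtain X where X: "\<And>n. Q n (X n)" by blast
  have X0: "X n 0 = \<zeta> n (a n)" "X n 1 = \<zeta> n (b n)" "X n ` {0..1} \<subseteq> cball x0 R" for n
    using X[of n] unfolding Q_def by blast+
  have XT: "?T (X n u' - X n u) = l n * (u' - u)" "c * norm (X n u' - X n u) \<le> l n * (u' - u)"
    if "0 \<le> u" "u \<le> u'" "u' \<le> 1" for n u u'
    using X[of n] that unfolding Q_def by blast+
  have XG: "G z (X n u' - X n u) w \<le> L * r * norm w / c * (l n * (u' - u))"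
    if "0 \<le> u" "u \<le> u'" "u' \<le> 1" "X n ` {u..u'} \<subseteq> cball z r" "z \<in> cball x0 \<rho>"
      "\<And>y. y \<in> cball z r \<Longrightarrow> y \<in> cball x0 \<rho> \<Longrightarrow> fdt y w" for n u u' z r w
  proof -
    note XQ = X[of n, unfolded Q_def, THEN conjunct2, THEN conjunct2, THEN conjunct2, THEN spec, THEN spec,
        THEN mp, THEN conjunct2, THEN conjunct2, THEN spec, THEN spec, THEN spec, THEN mp, of u u' z r w]
    have "\<forall>y. y \<in> cball z r \<and> y \<in> cball x0 \<rho> \<longrightarrow> fdt y w" using that(6) by blast
    with that show ?thesis by (intro XQ) auto
  qed
  have llim: "l \<longlonglongrightarrow> ?T (y - x)" unfolding l_def by (intro bt.tendsto tendsto_diff x y)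
  define l' where "l' = ?T (y - x)"
  obtain B where B: "\<And>n. l n \<le> B"
    using convergent_imp_Bseq[OF convergentI[OF llim]] unfolding Bseq_def
    by (metis abs_le_D1 real_norm_def)
  define \<Lambda> where "\<Lambda> = max 0 B / c"
  have c: "c > 0" by (rule bx)
  have \<Lambda>0: "\<Lambda> \<ge> 0" using c by (simp add: \<Lambda>_def)
  have lipX: "\<Lambda>-lipschitz_on {0..1} (X n)" for n
  proof (rule lipschitz_on_leI[OF _ \<Lambda>0])
    fix u u' :: real assume "u \<in> {0..1}" "u' \<in> {0..1}" "u \<le> u'"
    then have "c * norm (X n u' - X n u) \<le> l n * (u' - u)" by (intro XT) auto
    also have "\<dots> \<le> max 0 B * (u' - u)" using B[of n] \<open>u \<le> u'\<close> by (intro mult_right_mono) auto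
    finally have "norm (X n u' - X n u) \<le> \<Lambda> * (u' - u)" using c by (simp add: \<Lambda>_def field_simps)
    then show "dist (X n u) (X n u') \<le> \<Lambda> * dist u u'"
      using \<open>u \<le> u'\<close> by (simp add: dist_norm norm_minus_commute)
  qed
  obtain \<xi> k where \<xi>: "continuous_on {0..1} \<xi>" "strict_mono (k :: nat \<Rightarrow> nat)"
    "\<And>e. 0 < e \<Longrightarrow> \<exists>N. \<forall>n x. n \<ge> N \<and> x \<in> {0..1} \<longrightarrow> norm (X (k n) x - \<xi> x) < e"
  proof (rule Arzela_Ascoli[of "{0..1::real}" X "norm x0 + R"])
    show "norm (X n t) \<le> norm x0 + R" if "t \<in> {0..1}" for n t
    proof -
      have "X n t \<in> cball x0 R" using X0(3) that by blast
      then show ?thesis using norm_triangle_sub[of "X n t" x0] by (simp add: dist_norm norm_minus_commute)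
    qed
    show "\<exists>d>0. \<forall>n y. y \<in> {0..1} \<and> norm (t - y) < d \<longrightarrow> norm (X n t - X n y) < e"
      if t: "t \<in> {0..1}" and e: "0 < e" for t e
    proof (intro exI[of _ "e / (\<Lambda> + 1)"] conjI allI impI)
      show "0 < e / (\<Lambda> + 1)" using e \<Lambda>0 by simp
      fix n y assume y: "y \<in> {0..1} \<and> norm (t - y) < e / (\<Lambda> + 1)"
      have "norm (X n t - X n y) \<le> \<Lambda> * norm (t - y)" using lipschitz_on_normD[OF lipX] t y by blast
      also have "\<dots> \<le> (\<Lambda> + 1) * norm (t - y)" by (intro mult_right_mono) auto
      also have "\<dots> < e" using y \<Lambda>0 by (simp add: field_simps)
      finally show "norm (X n t - X n y) < e" .
    qed
  qed auto
  have lim: "(\<lambda>n. X (k n) t) \<longlonglongrightarrow> \<xi> t" if "t \<in> {0..1}" for t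
    by (rule LIMSEQ_I) (use \<xi>(3) that in meson)
  have llim': "(\<lambda>n. l (k n)) \<longlonglongrightarrow> l'"
    using LIMSEQ_subseq_LIMSEQ[OF llim \<xi>(2)] by (simp add: o_def l'_def)
  have \<xi>0: "\<xi> 0 = x"
    by (rule LIMSEQ_unique[OF lim[of 0]])
      (use LIMSEQ_subseq_LIMSEQ[OF x \<xi>(2)] in \<open>simp_all add: X0 o_def\<close>)
  have \<xi>1: "\<xi> 1 = y"
    by (rule LIMSEQ_unique[OF lim[of 1]])
      (use LIMSEQ_subseq_LIMSEQ[OF y \<xi>(2)] in \<open>simp_all add: X0 o_def\<close>)
  have \<xi>R: "\<xi> ` {0..1} \<subseteq> cball x0 R"
  proof (rule image_subsetI)
    fix t :: real assume t: "t \<in> {0..1}"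
    show "\<xi> t \<in> cball x0 R"
      by (rule closed_sequentially[OF closed_cball _ lim[OF t]]) (use X0(3) t in blast)
  qed
  have lip\<xi>: "\<Lambda>-lipschitz_on {0..1} \<xi>"
  proof (rule lipschitz_onI[OF _ \<Lambda>0])
    fix s t :: real assume st: "s \<in> {0..1}" "t \<in> {0..1}"
    show "dist (\<xi> s) (\<xi> t) \<le> \<Lambda> * dist s t"
      by (rule LIMSEQ_le_const2[OF tendsto_dist[OF lim[OF st(1)] lim[OF st(2)]]])
        (use lipschitz_onD[OF lipX st] in blast)
  qed
  have T\<xi>: "?T (\<xi> u' - \<xi> u) = l' * (u' - u)" if "0 \<le> u" "u \<le> u'" "u' \<le> 1" for u u'
  proof (rule LIMSEQ_unique)
    show "(\<lambda>n. ?T (X (k n) u' - X (k n) u)) \<longlonglongrightarrow> ?T (\<xi> u' - \<xi> u)"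
      using that by (intro bt.tendsto tendsto_diff lim) auto
    show "(\<lambda>n. ?T (X (k n) u' - X (k n) u)) \<longlonglongrightarrow> l' * (u' - u)"
      unfolding XT(1)[OF that] by (intro tendsto_mult llim' tendsto_const)
  qed
  have "c * norm (y - x) \<le> l'"
  proof (rule LIMSEQ_le[OF _ llim'])
    show "(\<lambda>n. c * norm (X (k n) 1 - X (k n) 0)) \<longlonglongrightarrow> c * norm (y - x)"
      using lim[of 0] lim[of 1] by (intro tendsto_intros) (auto simp: \<xi>0 \<xi>1)
    show "\<exists>N. \<forall>n\<ge>N. c * norm (X (k n) 1 - X (k n) 0) \<le> l (k n)" using XT(2)[of 0 1] by simp
  qed
  moreover have "c * norm (y - x) > 0" using c \<open>x \<noteq> y\<close> by simp
  ultimately have l': "l' > 0" by linarith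
  obtain N where N: "negligible N" and dN: "\<And>r. r \<in> {0<..<1} - N \<Longrightarrow> \<exists>v. (\<xi> has_vector_derivative v) (at r)"
    using lipschitz_ae_vector_derivative[OF lip\<xi>] by auto
  have "fdc (\<xi> r) v" if r: "r \<in> {0<..<1}" and v: "(\<xi> has_vector_derivative v) (at r)" for r v
  proof -
    define z where "z = \<xi> r"
    have zR: "z \<in> cball x0 R" unfolding z_def using r by (intro subsetD[OF \<xi>R] imageI) auto
    then have z: "z \<in> cball x0 \<rho>" "z \<in> \<Omega>" using sub bx(5) by blast+
    have quot: "((\<lambda>h. F ((1 / h) *\<^sub>R (\<xi> (r + h) - \<xi> r))) \<longlongrightarrow> F v) (at_right 0)"
      if F: "bounded_linear F" for F :: "'e \<Rightarrow> real"
    proof -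
      have "((\<lambda>t. F (\<xi> t)) has_real_derivative F v) (at r)"
        using bounded_linear.has_vector_derivative[OF F v] by (simp add: has_real_derivative_iff_has_vector_derivative)
      then have "((\<lambda>h. (F (\<xi> (r + h)) - F (\<xi> r)) / h) \<longlongrightarrow> F v) (at 0)" by (simp add: DERIV_def)
      moreover have "(F (\<xi> (r + h)) - F (\<xi> r)) / h = F ((1 / h) *\<^sub>R (\<xi> (r + h) - \<xi> r))" for h
        using F by (simp add: bounded_linear.linear linear_diff linear_cmul diff_divide_distrib)
      ultimately show ?thesis by (simp add: filterlim_at_split)
    qed
    have h01: "\<forall>\<^sub>F h in at_right 0. 0 < h \<and> h < 1 - r"
      using r by (auto simp: eventually_at_right_field intro!: exI[of _ "1 - r"])
    \<comment> \<open>The limit keeps the proportional parametrisation, so each derivative has box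
      time \<open>l'\<close>. This is positive because the endpoints differ, and so no derivative
      vanishes.\<close>
    have Tv: "?T v = l'"
    proof (rule tendsto_unique[OF _ quot[OF bounded_linear_box_time[OF box]]])
      have "\<forall>\<^sub>F h in at_right 0. l' = ?T ((1 / h) *\<^sub>R (\<xi> (r + h) - \<xi> r))"
        using h01 by eventually_elim (use T\<xi>[of r] r in \<open>auto simp: bt.scaleR\<close>)
      then show "((\<lambda>h. ?T ((1 / h) *\<^sub>R (\<xi> (r + h) - \<xi> r))) \<longlongrightarrow> l') (at_right 0)"
        by (rule tendsto_cong[THEN iffD1]) simp
    qed simp
    then have "v \<noteq> 0" using l' by (auto simp: bt.zero)
    \<comment> \<open>For a ball of radius \<open>q\<close> on which \<open>w\<close> is timelike,
      the estimate passes first to the uniform limit, then to the derivative as \<open>h\<close>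
      tends to 0. The remaining error is proportional to \<open>q\<close>.\<close>
    have dual: "G z v w \<le> 0" if w: "fdt z w" for w
    proof -
      obtain d where d: "d > 0" "\<And>y u. dist y z < d \<Longrightarrow> dist u w < d \<Longrightarrow> y \<in> \<Omega> \<and> fdt y u"
        using fdt_neighbourhood[OF z(2) w] by metis
      have "G z v w \<le> L * q * norm w / c * l'" if q: "0 < q" "q < d" for q
      proof -
        have fw: "fdt y w" if "y \<in> cball z q" for y using d(2)[of y w] that q \<open>d > 0\<close> by (simp add: dist_commute)
        obtain e where e: "e > 0" "\<And>t. t \<in> {0..1} \<Longrightarrow> dist t r < e \<Longrightarrow> dist (\<xi> t) (\<xi> r) < q / 2"
          using \<xi>(1) r q unfolding continuous_on_iff by (metis atLeastAtMost_iff greaterThanLessThan_iff half_gt_zero less_imp_le)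
        obtain M where M: "\<And>n t. n \<ge> M \<Longrightarrow> t \<in> {0..1} \<Longrightarrow> norm (X (k n) t - \<xi> t) < q / 2"
          using \<xi>(3)[of "q / 2"] q by auto
        have est: "G z (\<xi> (r + h) - \<xi> r) w \<le> L * q * norm w / c * (l' * h)" if h: "0 < h" "h < e" "h < 1 - r" for h
        proof (rule LIMSEQ_le)
          show "(\<lambda>n. G z (X (k n) (r + h) - X (k n) r) w) \<longlonglongrightarrow> G z (\<xi> (r + h) - \<xi> r) w"
            using h r by (intro bounded_linear.tendsto[OF bounded_linear_metric[OF box z(2)]] tendsto_diff lim) auto
          show "(\<lambda>n. L * q * norm w / c * (l (k n) * h)) \<longlonglongrightarrow> L * q * norm w / c * (l' * h)"
            by (intro tendsto_intros llim')
          have "G z (X (k n) (r + h) - X (k n) r) w \<le> L * q * norm w / c * (l (k n) * ((r + h) - r))" if n: "n \<ge> M" for n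
          proof (rule XG)
            show "X (k n) ` {r..r + h} \<subseteq> cball z q"
            proof (rule image_subsetI)
              fix t assume t: "t \<in> {r..r + h}"
              then have "t \<in> {0..1}" "dist t r < e" using h r by (auto simp: dist_real_def)
              then have "norm (X (k n) t - \<xi> t) < q / 2" "dist (\<xi> t) z < q / 2" using M[OF n] e(2) by (auto simp: z_def)
              then show "X (k n) t \<in> cball z q"
                using dist_triangle[of z "X (k n) t" "\<xi> t"] by (simp add: dist_norm norm_minus_commute)
            qed
          qed (use h r z fw in auto)
          then show "\<exists>N. \<forall>n\<ge>N. G z (X (k n) (r + h) - X (k n) r) w \<le> L * q * norm w / c * (l (k n) * h)" by auto
        qed
        show ?thesis
        proof (rule tendsto_upperbound[OF quot[OF bounded_linear_metric[OF box z(2), of w]]])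
          have "\<forall>\<^sub>F h in at_right 0. 0 < h \<and> h < e"
            using e(1) by (auto simp: eventually_at_right_field intro!: exI[of _ e])
          with h01 show "\<forall>\<^sub>F h in at_right 0. G z ((1 / h) *\<^sub>R (\<xi> (r + h) - \<xi> r)) w \<le> L * q * norm w / c * l'"
          proof eventually_elim
            case (elim h)
            have "G z ((1 / h) *\<^sub>R (\<xi> (r + h) - \<xi> r)) w = (1 / h) * G z (\<xi> (r + h) - \<xi> r) w"
              by (rule lorentzian_expand(5)[OF lorentz[OF z(2)]])
            also have "\<dots> \<le> (1 / h) * (L * q * norm w / c * (l' * h))"
              using elim by (intro mult_left_mono est) auto
            also have "\<dots> = L * q * norm w / c * l'" using elim by simp
            finally show ?case .
          qed
        qed simp
      qed
      then have ev: "\<forall>\<^sub>F q in at_right 0. G z v w \<le> L * q * norm w / c * l'"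
        using \<open>d > 0\<close> by (auto simp: eventually_at_right_field)
      have "((\<lambda>q. L * q * norm w / c * l') \<longlongrightarrow> L * 0 * norm w / c * l') (at_right 0)"
        using c by (intro tendsto_intros) auto
      from tendsto_lowerbound[OF this ev] show ?thesis by simp
    qed
    have "G z v v \<le> 0" "G z v (\<tau> z) < 0"
      using causal_if_dual[OF lorentz[OF z(2)] timelike_orient[OF z(2)] _ \<open>v \<noteq> 0\<close>] dual by (auto simp: fdt_def)
    then show ?thesis using \<open>v \<noteq> 0\<close> by (simp add: fdc_def z_def)
  qed
  then have "coord_curve fdc \<xi> 0 1"
    unfolding coord_curve_def using lip\<xi> N dN by (metis DiffE zero_less_one)
  then show thesis using that \<xi>R \<xi>0 \<xi>1 by blast
qed

end

subsection \<open>Curves in a spacetime\<close>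

lemma coord_curveE:
  assumes "coord_curve P \<zeta> a b"
  obtains L N where "a < b" "L-lipschitz_on {a..b} \<zeta>" "negligible N"
    "\<forall>r\<in>{a<..<b} - N. \<exists>v. (\<zeta> has_vector_derivative v) (at r) \<and> P (\<zeta> r) v"
  using assms unfolding coord_curve_def by blast

lemma coord_curveI:
  assumes "a < b" "L-lipschitz_on {a..b} \<zeta>" "negligible N"
    "\<And>r. r \<in> {a<..<b} - N \<Longrightarrow> \<exists>v. (\<zeta> has_vector_derivative v) (at r) \<and> P (\<zeta> r) v"
  shows "coord_curve P \<zeta> a b"
  using assms unfolding coord_curve_def by blast

lemma coord_curve_cong:
  assumes "coord_curve P \<zeta> a b" and eq: "\<And>t. t \<in> {a..b} \<Longrightarrow> \<zeta> t = \<xi> t"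
  shows "coord_curve P \<xi> a b"
  using assms(1)
proof (rule coord_curveE)
  fix L N assume LN: "a < b" "L-lipschitz_on {a..b} \<zeta>" "negligible N"
    "\<forall>r\<in>{a<..<b} - N. \<exists>v. (\<zeta> has_vector_derivative v) (at r) \<and> P (\<zeta> r) v"
  show ?thesis
  proof (rule coord_curveI[OF LN(1) _ LN(3)])
    show "L-lipschitz_on {a..b} \<xi>" by (rule lipschitz_on_transform[OF LN(2)]) (use eq in auto)
    fix r assume r: "r \<in> {a<..<b} - N"
    then obtain v where v: "(\<zeta> has_vector_derivative v) (at r)" "P (\<zeta> r) v" using LN(4) by blast
    have "(\<xi> has_vector_derivative v) (at r)"
      by (rule has_vector_derivative_transform_within_open[OF v(1), of "{a<..<b}"]) (use r eq in auto)
    then show "\<exists>v. (\<xi> has_vector_derivative v) (at r) \<and> P (\<xi> r) v" using v(2) eq[of r] r by auto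
  qed
qed

lemma coord_curve_join:
  assumes "coord_curve P \<zeta> a b" "coord_curve P \<zeta> b c"
  shows "coord_curve P \<zeta> a c"
proof -
  obtain L1 N1 where 1: "a < b" "L1-lipschitz_on {a..b} \<zeta>" "negligible N1"
    "\<forall>r\<in>{a<..<b} - N1. \<exists>v. (\<zeta> has_vector_derivative v) (at r) \<and> P (\<zeta> r) v"
    using assms(1) by (rule coord_curveE)
  obtain L2 N2 where 2: "b < c" "L2-lipschitz_on {b..c} \<zeta>" "negligible N2"
    "\<forall>r\<in>{b<..<c} - N2. \<exists>v. (\<zeta> has_vector_derivative v) (at r) \<and> P (\<zeta> r) v"
    using assms(2) by (rule coord_curveE)
  show ?thesis
  proof (rule coord_curveI)
    show "a < c" using 1 2 by simp
    show "(max L1 L2)-lipschitz_on {a..c} \<zeta>" using lipschitz_on_concat_max[OF 1(2) 2(2) refl] by simp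
    show "negligible (N1 \<union> N2 \<union> {b})" using 1(3) 2(3) by (intro negligible_Un) auto
    show "\<exists>v. (\<zeta> has_vector_derivative v) (at r) \<and> P (\<zeta> r) v" if "r \<in> {a<..<c} - (N1 \<union> N2 \<union> {b})" for r
      using that 1(4) 2(4) by (cases "r < b") auto
  qed
qed

text \<open>A negative \<open>k\<close> is allowed, so that rescaling and time reversal are one
  statement; the intervals are therefore related by an image rather than by their endpoints.\<close>

lemma coord_curve_affine:
  assumes "coord_curve P \<zeta> a b" and k: "k \<noteq> 0" and ab': "a' < b'"
    and im: "(\<lambda>t. k * t + m) ` {a'..b'} = {a..b}"
    and P': "\<And>r v. r \<in> {a..b} \<Longrightarrow> P (\<zeta> r) v \<Longrightarrow> P' (\<zeta> r) (k *\<^sub>R v)"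
  shows "coord_curve P' (\<lambda>t. \<zeta> (k * t + m)) a' b'"
proof -
  obtain L N where LN: "a < b" "L-lipschitz_on {a..b} \<zeta>" "negligible N"
    "\<forall>r\<in>{a<..<b} - N. \<exists>v. (\<zeta> has_vector_derivative v) (at r) \<and> P (\<zeta> r) v"
    using assms(1) by (rule coord_curveE)
  define f where "f = (\<lambda>t. k * t + m)"
  have ends: "{a, b} = {f a', f b'}"
    using im ab' LN(1) by (auto simp: f_def image_affinity_atLeastAtMost Icc_eq_Icc split: if_splits)
  show ?thesis
  proof (rule coord_curveI[OF ab'])
    have "\<bar>k\<bar>-lipschitz_on {a'..b'} f"
      by (rule lipschitz_onI) (auto simp: f_def dist_real_def abs_mult simp flip: right_diff_distrib)
    moreover have "L-lipschitz_on (f ` {a'..b'}) \<zeta>" using LN(2) im by (simp add: f_def)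
    ultimately have "(L * \<bar>k\<bar>)-lipschitz_on {a'..b'} (\<zeta> \<circ> f)" by (rule lipschitz_on_compose)
    then show "(L * \<bar>k\<bar>)-lipschitz_on {a'..b'} (\<lambda>t. \<zeta> (k * t + m))" by (simp add: o_def f_def)
    show "negligible ((\<lambda>x. (x - m) / k) ` N)"
    proof (rule negligible_lipschitz_image[OF LN(3)])
      show "(1 / \<bar>k\<bar>)-lipschitz_on N (\<lambda>x. (x - m) / k)"
        by (rule lipschitz_onI) (auto simp: dist_real_def simp flip: diff_divide_distrib)
    qed
    fix r assume r: "r \<in> {a'<..<b'} - (\<lambda>x. (x - m) / k) ` N"
    then have "f r \<notin> N" using k by (auto simp: f_def image_iff)
    moreover have "f r \<in> {a..b}" unfolding im[symmetric] f_def using r by (intro imageI) auto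
    moreover have "f r \<notin> {f a', f b'}" using r k by (auto simp: f_def)
    ultimately have fr: "f r \<in> {a<..<b} - N" "f r \<in> {a..b}" unfolding ends[symmetric] by auto
    then obtain v where v: "(\<zeta> has_vector_derivative v) (at (f r))" "P (\<zeta> (f r)) v" using LN(4) by blast
    have "(f has_vector_derivative k) (at r)"
      unfolding f_def by (auto intro!: derivative_eq_intros simp flip: has_real_derivative_iff_has_vector_derivative)
    from vector_diff_chain_at[OF this v(1)]
    show "\<exists>v. ((\<lambda>t. \<zeta> (k * t + m)) has_vector_derivative v) (at r) \<and> P' (\<zeta> (k * r + m)) v"
      using P'[OF fr(2) v(2)] by (auto simp: o_def f_def)
  qed
qed

lemma ae_curve_iff:
  "ae_curve A P \<gamma> a b \<longleftrightarrow> a < b \<and> continuous_on {a..b} \<gamma> \<and>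
    (\<forall>c\<in>A. \<forall>s t. a \<le> s \<and> s < t \<and> t \<le> b \<and> \<gamma> ` {s..t} \<subseteq> fst c \<longrightarrow> coord_curve (P c) (snd c \<circ> \<gamma>) s t)"
  unfolding ae_curve_def coord_curve_def o_apply by (intro conj_cong[OF refl] ball_cong[OF refl] all_cong1 imp_cong[OF refl]) simp

lemma ae_curveI:
  assumes "a < b" "continuous_on {a..b} \<gamma>"
    "\<And>c s t. c \<in> A \<Longrightarrow> a \<le> s \<Longrightarrow> s < t \<Longrightarrow> t \<le> b \<Longrightarrow> \<gamma> ` {s..t} \<subseteq> fst c \<Longrightarrow> coord_curve (P c) (snd c \<circ> \<gamma>) s t"
  shows "ae_curve A P \<gamma> a b"
  unfolding ae_curve_iff using assms by blast

lemma ae_curveD: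
  assumes "ae_curve A P \<gamma> a b" "c \<in> A" "a \<le> s" "s < t" "t \<le> b" "\<gamma> ` {s..t} \<subseteq> fst c"
  shows "coord_curve (P c) (snd c \<circ> \<gamma>) s t"
  using assms unfolding ae_curve_iff by blast

lemma ae_curve_less: "ae_curve A P \<gamma> a b \<Longrightarrow> a < b"
  and ae_curve_continuous: "ae_curve A P \<gamma> a b \<Longrightarrow> continuous_on {a..b} \<gamma>"
  by (simp_all add: ae_curve_iff)

lemma ae_curve_subinterval:
  assumes "ae_curve A P \<gamma> a b" "a \<le> s" "s < t" "t \<le> b"
  shows "ae_curve A P \<gamma> s t"
proof (rule ae_curveI)
  show "continuous_on {s..t} \<gamma>"
    using continuous_on_subset[OF ae_curve_continuous[OF assms(1)], of "{s..t}"] assms by auto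
qed (use assms in \<open>auto intro: ae_curveD\<close>)

lemma ae_curve_cong:
  assumes "ae_curve A P \<gamma> a b" and eq: "\<And>t. t \<in> {a..b} \<Longrightarrow> \<gamma> t = \<delta> t"
  shows "ae_curve A P \<delta> a b"
proof (rule ae_curveI[OF ae_curve_less[OF assms(1)]])
  show "continuous_on {a..b} \<delta>" by (rule continuous_on_eq[OF ae_curve_continuous[OF assms(1)] eq])
  fix c s t assume st: "c \<in> A" "a \<le> s" "s < t" "t \<le> b" "\<delta> ` {s..t} \<subseteq> fst c"
  have im: "\<gamma> ` {s..t} = \<delta> ` {s..t}" using eq st by (intro image_cong) auto
  show "coord_curve (P c) (snd c \<circ> \<delta>) s t"
    by (rule coord_curve_cong[OF ae_curveD[OF assms(1) st(1-4)]]) (use im st eq in auto)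
qed

lemma ae_curve_join:
  assumes "ae_curve A P \<gamma> a b" "ae_curve A P \<gamma> b c"
  shows "ae_curve A P \<gamma> a c"
proof (rule ae_curveI)
  have ab: "a < b" "b < c" using assms by (auto dest: ae_curve_less)
  then show "a < c" by simp
  have "continuous_on ({a..b} \<union> {b..c}) \<gamma>"
    using assms by (intro continuous_on_closed_Un) (auto dest: ae_curve_continuous)
  moreover have "{a..b} \<union> {b..c} = {a..c}" using ab by auto
  ultimately show "continuous_on {a..c} \<gamma>" by simp
  fix d s t assume st: "d \<in> A" "a \<le> s" "s < t" "t \<le> c" "\<gamma> ` {s..t} \<subseteq> fst d"
  consider "t \<le> b" | "b \<le> s" | "s < b" "b < t" by linarith
  then show "coord_curve (P d) (snd d \<circ> \<gamma>) s t"
  proof cases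
    case 3
    have "\<gamma> ` {s..b} \<subseteq> fst d" "\<gamma> ` {b..t} \<subseteq> fst d" using st 3 by (auto simp: image_subset_iff)
    then show ?thesis
      using st 3 by (intro coord_curve_join[of _ _ s b t] ae_curveD[OF assms(1)] ae_curveD[OF assms(2)]) auto
  qed (use st ae_curveD[OF assms(1)] ae_curveD[OF assms(2)] in blast)+
qed

lemma ae_curve_affine:
  assumes \<gamma>: "ae_curve A P \<gamma> a b" and k: "k \<noteq> 0" and ab': "a' < b'"
    and im: "(\<lambda>t. k * t + m) ` {a'..b'} = {a..b}"
    and P': "\<And>c x v. c \<in> A \<Longrightarrow> x \<in> snd c ` fst c \<Longrightarrow> P c x v \<Longrightarrow> P' c x (k *\<^sub>R v)"
  shows "ae_curve A P' (\<lambda>t. \<gamma> (k * t + m)) a' b'"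
proof (rule ae_curveI[OF ab'])
  define f where "f = (\<lambda>t. k * t + m)"
  show "continuous_on {a'..b'} (\<lambda>t. \<gamma> (k * t + m))"
    using ae_curve_continuous[OF \<gamma>] im
    by (intro continuous_on_compose2[where f="\<lambda>t. k * t + m" and g=\<gamma>] continuous_intros) auto
  fix c s t assume st: "c \<in> A" "a' \<le> s" "s < t" "t \<le> b'" "(\<lambda>t. \<gamma> (k * t + m)) ` {s..t} \<subseteq> fst c"
  define s2 t2 where "s2 = min (f s) (f t)" and "t2 = max (f s) (f t)"
  have s2: "f ` {s..t} = {s2..t2}" "s2 < t2"
    using st k by (auto simp: f_def s2_def t2_def image_affinity_atLeastAtMost min_def max_def mult_le_cancel_left not_le)
  have "{s2..t2} \<subseteq> {a..b}" unfolding s2(1)[symmetric] im[symmetric] f_def using st by (intro image_mono) auto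
  then have ab2: "a \<le> s2" "t2 \<le> b" using s2(2) by auto
  have sub: "\<gamma> ` {s2..t2} \<subseteq> fst c" using st(5) unfolding s2(1)[symmetric] f_def by (auto simp: image_image)
  have "coord_curve (P' c) (\<lambda>t. (snd c \<circ> \<gamma>) (k * t + m)) s t"
  proof (rule coord_curve_affine[OF ae_curveD[OF \<gamma> st(1) ab2(1) s2(2) ab2(2) sub] k st(3)])
    show "(\<lambda>t. k * t + m) ` {s..t} = {s2..t2}" using s2(1) by (simp add: f_def)
    show "P' c ((snd c \<circ> \<gamma>) r) (k *\<^sub>R v)" if "r \<in> {s2..t2}" "P c ((snd c \<circ> \<gamma>) r) v" for r v
    proof -
      have "\<gamma> r \<in> fst c" using sub that(1) by blast
      then show ?thesis using P'[OF st(1) _ that(2)] by simp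
    qed
  qed
  then show "coord_curve (P' c) (snd c \<circ> (\<lambda>t. \<gamma> (k * t + m))) s t" by (simp add: o_def)
qed

section \<open>Charts and changes of coordinates\<close>

locale spacetime_structure =
  fixes A :: "('m::{t2_space, second_countable_topology}, 'e::euclidean_space) chart set"
    and gm :: "('m, 'e) chart \<Rightarrow> 'e \<Rightarrow> 'e \<Rightarrow> 'e \<Rightarrow> real"
    and T :: "('m, 'e) chart \<Rightarrow> 'e \<Rightarrow> 'e"
  assumes spacetime: "spacetime A gm T"
begin

abbreviation coords :: "('m, 'e) chart \<Rightarrow> 'e set" where "coords c \<equiv> snd c ` fst c"
abbreviation causal_vec where "causal_vec \<equiv> fd_causal_vec gm T"
abbreviation timelike_vec where "timelike_vec \<equiv> fd_timelike_vec gm T"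
abbreviation point_of :: "('m, 'e) chart \<Rightarrow> 'e \<Rightarrow> 'm" where "point_of c \<equiv> inv_into (fst c) (snd c)"

lemma smooth_atlas: "smooth_atlas A"
  using spacetime by (simp add: spacetime_def)

lemma chart:
  assumes "c \<in> A"
  shows "open (fst c)" "inj_on (snd c) (fst c)" "open (coords c)"
    "continuous_on (fst c) (snd c)" "continuous_on (coords c) (point_of c)"
  using smooth_atlas assms unfolding smooth_atlas_def by (auto dest!: bspec[of _ _ c] simp: case_prod_beta)

lemma chart_cover: obtains c where "c \<in> A" "p \<in> fst c"
  using smooth_atlas unfolding smooth_atlas_def by blast

lemma point_of_in: "x \<in> coords c \<Longrightarrow> point_of c x \<in> fst c"
  by (rule inv_into_into)

lemma snd_point_of: "x \<in> coords c \<Longrightarrow> snd c (point_of c x) = x"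
  by (rule f_inv_into_f)

lemma point_of_snd: "c \<in> A \<Longrightarrow> p \<in> fst c \<Longrightarrow> point_of c (snd c p) = p"
  using chart(2) by (rule inv_into_f_f)

lemma lorentz_metric_chart: "c \<in> A \<Longrightarrow> lorentz_metric (coords c) (gm c) (T c)"
  using spacetime unfolding spacetime_def lorentz_metric_def by blast

lemma transition_smooth: "c \<in> A \<Longrightarrow> d \<in> A \<Longrightarrow> smooth_on (snd c ` (fst c \<inter> fst d)) (transition c d)"
  using smooth_atlas unfolding smooth_atlas_def by blast

text \<open>What is required of a condition on tangent vectors so that checking it along a curve in
  one chart settles it in all charts.\<close>

definition chart_invariant :: "(('m, 'e) chart \<Rightarrow> 'e \<Rightarrow> 'e \<Rightarrow> bool) \<Rightarrow> bool" where
  "chart_invariant P \<longleftrightarrow> (\<forall>c\<in>A. \<forall>d\<in>A. \<forall>x\<in>snd c ` (fst c \<inter> fst d). \<forall>v. P c x v \<longrightarrow>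
     P d (transition c d x) (frechet_derivative (transition c d) (at x) v))"

lemma metric_transition:
  assumes "c \<in> A" "d \<in> A" "x \<in> snd c ` (fst c \<inter> fst d)"
  shows "gm d (transition c d x) (frechet_derivative (transition c d) (at x) u) (frechet_derivative (transition c d) (at x) w) = gm c x u w"
    "frechet_derivative (transition c d) (at x) (T c x) = T d (transition c d x)"
    "transition c d x \<in> coords d"
proof -
  show "gm d (transition c d x) (frechet_derivative (transition c d) (at x) u) (frechet_derivative (transition c d) (at x) w) = gm c x u w"
    "frechet_derivative (transition c d) (at x) (T c x) = T d (transition c d x)"
    using spacetime assms unfolding spacetime_def by metis+
  obtain p where "p \<in> fst c" "p \<in> fst d" "x = snd c p" using assms by auto
  then show "transition c d x \<in> coords d" using point_of_snd[OF assms(1)] by (simp add: transition_def)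
qed

lemma chart_invariant_causal: "chart_invariant causal_vec"
  unfolding chart_invariant_def fd_causal_vec_def
proof (intro ballI allI impI conjI; (elim conjE)?)
  fix c d x v assume *: "c \<in> A" "d \<in> A" "x \<in> snd c ` (fst c \<inter> fst d)"
    "v \<noteq> 0" "gm c x v v \<le> 0" "gm c x v (T c x) < 0"
  note m = metric_transition[OF *(1-3)]
  interpret lm: lorentz_metric "coords d" "gm d" "T d" by (rule lorentz_metric_chart[OF *(2)])
  show 1: "gm d (transition c d x) (frechet_derivative (transition c d) (at x) v) (T d (transition c d x)) < 0"
    unfolding m(2)[symmetric] m(1) by fact
  show "frechet_derivative (transition c d) (at x) v \<noteq> 0"
    using 1 lorentzian_expand(7)[OF lm.lorentz[OF m(3)]] by auto
  show "gm d (transition c d x) (frechet_derivative (transition c d) (at x) v) (frechet_derivative (transition c d) (at x) v) \<le> 0"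
    unfolding m(1) by fact
qed

lemma chart_invariant_timelike: "chart_invariant (timelike_vec)"
  unfolding chart_invariant_def fd_timelike_vec_def
proof (intro ballI allI impI conjI; (elim conjE)?)
  fix c d x v assume *: "c \<in> A" "d \<in> A" "x \<in> snd c ` (fst c \<inter> fst d)"
    "gm c x v v < 0" "gm c x v (T c x) < 0"
  note m = metric_transition[OF *(1-3)]
  show "gm d (transition c d x) (frechet_derivative (transition c d) (at x) v) (T d (transition c d x)) < 0"
    unfolding m(2)[symmetric] m(1) by fact
  show "gm d (transition c d x) (frechet_derivative (transition c d) (at x) v) (frechet_derivative (transition c d) (at x) v) < 0"
    unfolding m(1) by fact
qed

text \<open>A curve has to satisfy conditions in every chart that contains a piece of it. Transition
  maps are only locally Lipschitz, so the local Lipschitz constants are combined over the compact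
  parameter interval by bisection; the derivative is transported by the chain rule outside the same
  null set.\<close>

lemma coord_curve_imp_ae_curve:
  assumes c: "c \<in> A" and P: "chart_invariant P"
    and \<zeta>: "coord_curve (P c) \<zeta> a b" "\<zeta> ` {a..b} \<subseteq> coords c"
  shows "ae_curve A P (\<lambda>t. point_of c (\<zeta> t)) a b"
proof -
  obtain L N where ab: "a < b" and L: "L-lipschitz_on {a..b} \<zeta>" and N: "negligible N"
    and dN: "\<forall>r\<in>{a<..<b} - N. \<exists>v. (\<zeta> has_vector_derivative v) (at r) \<and> P c (\<zeta> r) v"
    using \<zeta>(1) by (rule coord_curveE)
  show ?thesis
  proof (rule ae_curveI[OF ab])
    show "continuous_on {a..b} (\<lambda>t. point_of c (\<zeta> t))"
      by (rule continuous_on_compose2[OF chart(5)[OF c] lipschitz_on_continuous_on[OF L] \<zeta>(2)])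
    fix d s t assume d: "d \<in> A" and st: "a \<le> s" "s < t" "t \<le> b" "(\<lambda>t. point_of c (\<zeta> t)) ` {s..t} \<subseteq> fst d"
    have eq: "snd d \<circ> (\<lambda>t. point_of c (\<zeta> t)) = (\<lambda>t. transition c d (\<zeta> t))"
      by (simp add: fun_eq_iff transition_def)
    have W: "\<zeta> r \<in> snd c ` (fst c \<inter> fst d)" if "r \<in> {s..t}" for r
    proof -
      have "\<zeta> r \<in> coords c" using \<zeta>(2) st that by (auto simp: image_subset_iff)
      moreover have "point_of c (\<zeta> r) \<in> fst d" using st that by (auto simp: image_subset_iff)
      ultimately show ?thesis by (metis IntI image_eqI point_of_in snd_point_of)
    qed
    have L0: "L \<ge> 0" using L by (rule lipschitz_on_nonneg)
    have loc: "\<exists>e>0. \<exists>K\<ge>0. K-lipschitz_on ({s..t} \<inter> {r - e..r + e}) (\<lambda>t. transition c d (\<zeta> t))" if r: "r \<in> {s..t}" for r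
    proof -
      obtain q K where q: "q > 0" "K-lipschitz_on (cball (\<zeta> r) q) (transition c d)"
        using smooth_on_imp_locally_lipschitz[OF transition_smooth[OF c d] W[OF r]] by metis
      define e where "e = q / (L + 1)"
      have e: "e > 0" using q L0 by (simp add: e_def)
      have "\<zeta> ` ({s..t} \<inter> {r - e..r + e}) \<subseteq> cball (\<zeta> r) q"
      proof (rule image_subsetI)
        fix u assume u: "u \<in> {s..t} \<inter> {r - e..r + e}"
        have "dist (\<zeta> r) (\<zeta> u) \<le> L * dist r u" using u r st by (intro lipschitz_onD[OF L]) auto
        also have "\<dots> \<le> L * e" using u L0 by (intro mult_left_mono) (auto simp: dist_real_def)
        also have "\<dots> \<le> q" using q L0 by (simp add: e_def field_simps)
        finally show "\<zeta> u \<in> cball (\<zeta> r) q" by simp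
      qed
      then have "(K * L)-lipschitz_on ({s..t} \<inter> {r - e..r + e}) (\<lambda>t. transition c d (\<zeta> t))"
        using st by (intro lipschitz_on_compose2[of L _ \<zeta> K "transition c d"] lipschitz_on_subset[OF L] lipschitz_on_subset[OF q(2)]) auto
      then show ?thesis using e lipschitz_on_nonneg by blast
    qed
    have "\<exists>K\<ge>0. K-lipschitz_on {s..t} (\<lambda>t. transition c d (\<zeta> t))"
    proof -
      have "s \<le> u \<and> u \<le> v \<and> v \<le> t \<longrightarrow> (\<exists>K\<ge>0. K-lipschitz_on {u..v} (\<lambda>t. transition c d (\<zeta> t)))" if "u \<le> v" for u v
        using that
      proof (induction u v rule: Bolzano)
        case (trans u v w)
        show ?case
        proof (intro impI)
          assume *: "s \<le> u \<and> u \<le> w \<and> w \<le> t"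
          then obtain K1 K2 where K: "K1 \<ge> 0" "K2 \<ge> 0" "K1-lipschitz_on {u..v} (\<lambda>t. transition c d (\<zeta> t))"
              "K2-lipschitz_on {v..w} (\<lambda>t. transition c d (\<zeta> t))"
            using trans by (meson order_trans)
          show "\<exists>K\<ge>0. K-lipschitz_on {u..w} (\<lambda>t. transition c d (\<zeta> t))"
            using lipschitz_on_concat_max[OF K(3,4) refl] K by (intro exI[of _ "max K1 K2"]) auto
        qed
      next
        case (local x)
        show ?case
        proof (cases "x \<in> {s..t}")
          case True
          obtain e K where e: "e > 0" "K \<ge> 0" "K-lipschitz_on ({s..t} \<inter> {x - e..x + e}) (\<lambda>t. transition c d (\<zeta> t))"
            using loc[OF True] by blast
          have "K-lipschitz_on {u..v} (\<lambda>t. transition c d (\<zeta> t))"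
            if "u \<le> x \<and> x \<le> v \<and> v - u < e" "s \<le> u" "v \<le> t" for u v
            by (rule lipschitz_on_subset[OF e(3)]) (use that in auto)
          then show ?thesis using e by blast
        next
          case False
          then show ?thesis by (intro exI[of _ 1]) auto
        qed
      qed
      then show ?thesis using st by (meson order_refl less_imp_le)
    qed
    then obtain K where K: "K-lipschitz_on {s..t} (\<lambda>t. transition c d (\<zeta> t))" by blast
    have "\<exists>v. ((\<lambda>t. transition c d (\<zeta> t)) has_vector_derivative v) (at r) \<and> P d (snd d (point_of c (\<zeta> r))) v"
      if r: "r \<in> {s<..<t} - N" for r
    proof -
      have rab: "r \<in> {a<..<b} - N" using r st by auto
      obtain v where v: "(\<zeta> has_vector_derivative v) (at r)" "P c (\<zeta> r) v" using bspec[OF dN rab] by blast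
      have Wr: "\<zeta> r \<in> snd c ` (fst c \<inter> fst d)" using W r by auto
      let ?D = "frechet_derivative (transition c d) (at (\<zeta> r))"
      have "dirderivs [] (transition c d) differentiable (at (\<zeta> r))"
        using transition_smooth[OF c d] Wr unfolding smooth_on_def by blast
      then have D: "(transition c d has_derivative ?D) (at (\<zeta> r))" by (simp only: dirderivs.simps frechet_derivative_works)
      have "((\<lambda>t. transition c d (\<zeta> t)) has_derivative (\<lambda>h. ?D (h *\<^sub>R v))) (at r)"
        using has_derivative_compose[OF v(1)[unfolded has_vector_derivative_def] D] .
      moreover have "?D (h *\<^sub>R v) = h *\<^sub>R ?D v" for h
        using D by (simp add: has_derivative_linear linear_cmul)
      ultimately have "((\<lambda>t. transition c d (\<zeta> t)) has_vector_derivative ?D v) (at r)"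
        by (simp add: has_vector_derivative_def)
      moreover have "P d (transition c d (\<zeta> r)) (?D v)"
        using P c d Wr v(2) unfolding chart_invariant_def by blast
      ultimately show ?thesis by (auto simp: transition_def)
    qed
    then show "coord_curve (P d) (snd d \<circ> (\<lambda>t. point_of c (\<zeta> t))) s t"
      unfolding eq by (intro coord_curveI[OF st(2) K N]) (simp add: transition_def)
  qed
qed

lemma ae_curve_imp_coord_curve:
  assumes "ae_curve A P \<gamma> a b" "c \<in> A" "\<gamma> ` {a..b} \<subseteq> fst c"
  shows "coord_curve (P c) (snd c \<circ> \<gamma>) a b"
  using ae_curveD[OF assms(1,2) order_refl ae_curve_less[OF assms(1)] order_refl assms(3)] .

end

subsection \<open>Push-up and openness of the chronological future\<close>

lemma ae_curve_mono:
  assumes "ae_curve A P \<gamma> a b" "\<And>c x v. c \<in> A \<Longrightarrow> x \<in> snd c ` fst c \<Longrightarrow> P c x v \<Longrightarrow> Q c x v"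
  shows "ae_curve A Q \<gamma> a b"
proof -
  have "ae_curve A Q (\<lambda>t. \<gamma> (1 * t + 0)) a b"
    by (rule ae_curve_affine[OF assms(1)]) (use assms in \<open>auto simp: ae_curve_def\<close>)
  then show ?thesis by simp
qed

section \<open>Concatenation, rescaling and reversal of curves\<close>

context spacetime_structure
begin

text \<open>Common form of \<open>I\<close> and of the part \<open>Cr\<close> of \<open>J\<close>
  that comes from actual curves. Chains later use \<open>Cr\<close>, because consecutive points must
  be joined by a curve.\<close>

definition curve_rel :: "(('m, 'e) chart \<Rightarrow> 'e \<Rightarrow> 'e \<Rightarrow> bool) \<Rightarrow> ('m \<times> 'm) set" where
  "curve_rel P = {(p, q). \<exists>\<gamma> a b. ae_curve A P \<gamma> a b \<and> \<gamma> a = p \<and> \<gamma> b = q}"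

definition homogeneous :: "(('m, 'e) chart \<Rightarrow> 'e \<Rightarrow> 'e \<Rightarrow> bool) \<Rightarrow> bool" where
  "homogeneous P \<longleftrightarrow> (\<forall>c\<in>A. \<forall>x\<in>coords c. \<forall>v. \<forall>k>0. P c x v \<longrightarrow> P c x (k *\<^sub>R v))"

lemma homogeneous_causal: "homogeneous causal_vec"
  and homogeneous_timelike: "homogeneous timelike_vec"
  unfolding homogeneous_def fd_causal_vec_def fd_timelike_vec_def
  using lorentzian_expand(5,6)[OF lorentz_metric.lorentz[OF lorentz_metric_chart]]
  by (auto simp: mult_pos_neg mult_nonneg_nonpos)

lemma curve_relI: "ae_curve A P \<gamma> a b \<Longrightarrow> (\<gamma> a, \<gamma> b) \<in> curve_rel P"
  unfolding curve_rel_def by blast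

lemma curve_rel_on_interval:
  assumes "homogeneous P" "(p, q) \<in> curve_rel P" "u < v"
  obtains \<delta> where "ae_curve A P \<delta> u v" "\<delta> u = p" "\<delta> v = q"
proof -
  obtain \<gamma> a b where \<gamma>: "ae_curve A P \<gamma> a b" "\<gamma> a = p" "\<gamma> b = q"
    using assms(2) unfolding curve_rel_def by blast
  have ab: "a < b" using \<gamma> by (simp add: ae_curve_def)
  define k where "k = (b - a) / (v - u)"
  have k: "k > 0" using ab assms(3) by (simp add: k_def)
  have kv: "k * u + (a - k * u) = a" "k * v + (a - k * u) = b"
  proof -
    have "k * (v - u) = b - a" using assms(3) by (simp add: k_def)
    then show "k * u + (a - k * u) = a" "k * v + (a - k * u) = b" by (simp_all add: algebra_simps)
  qed
  have "ae_curve A P (\<lambda>t. \<gamma> (k * t + (a - k * u))) u v"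
  proof (rule ae_curve_affine[OF \<gamma>(1) _ assms(3)])
    show "(\<lambda>t. k * t + (a - k * u)) ` {u..v} = {a..b}"
      using k assms(3) kv by (simp add: image_affinity_atLeastAtMost)
  qed (use k assms(1) in \<open>auto simp: homogeneous_def\<close>)
  then show thesis by (rule that) (simp_all only: kv \<gamma>)
qed

lemma curve_rel_trans:
  assumes P: "homogeneous P" and pq: "(p, q) \<in> curve_rel P" and qr: "(q, r) \<in> curve_rel P"
  shows "(p, r) \<in> curve_rel P"
proof -
  obtain \<gamma> where \<gamma>: "ae_curve A P \<gamma> 0 1" "\<gamma> 0 = p" "\<gamma> 1 = q" by (rule curve_rel_on_interval[OF P pq zero_less_one])
  have "1 < (2 :: real)" by simp
  then obtain \<delta> where \<delta>: "ae_curve A P \<delta> 1 2" "\<delta> 1 = q" "\<delta> 2 = r" by (rule curve_rel_on_interval[OF P qr])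
  define \<phi> where "\<phi> = (\<lambda>t::real. if t \<le> 1 then \<gamma> t else \<delta> t)"
  have "ae_curve A P \<phi> 0 1" by (rule ae_curve_cong[OF \<gamma>(1)]) (simp add: \<phi>_def)
  moreover have "ae_curve A P \<phi> 1 2" 
  proof (rule ae_curve_cong[OF \<delta>(1)])
    show "\<delta> t = \<phi> t" if "t \<in> {1..2}" for t using that by (cases "t = 1") (auto simp: \<phi>_def \<gamma> \<delta>)
  qed
  ultimately have "ae_curve A P \<phi> 0 2" by (rule ae_curve_join)
  from curve_relI[OF this] show ?thesis by (simp add: \<phi>_def \<gamma> \<delta>)
qed

abbreviation J where "J \<equiv> Jplus A gm T"
abbreviation I where "I \<equiv> Iplus A gm T"
abbreviation Ap where "Ap \<equiv> Aplus A gm T"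
abbreviation Cr where "Cr \<equiv> curve_rel causal_vec"

lemma Iplus_eq: "I = curve_rel timelike_vec"
  unfolding Iplus_def curve_rel_def timelike_curve_def ..

lemma Jplus_eq: "J = Id \<union> Cr"
  unfolding Jplus_def curve_rel_def causal_curve_def by auto

lemma Iplus_trans: "(p, q) \<in> I \<Longrightarrow> (q, r) \<in> I \<Longrightarrow> (p, r) \<in> I"
  unfolding Iplus_eq by (rule curve_rel_trans[OF homogeneous_timelike])

lemma Cr_trans: "(p, q) \<in> Cr \<Longrightarrow> (q, r) \<in> Cr \<Longrightarrow> (p, r) \<in> Cr"
  by (rule curve_rel_trans[OF homogeneous_causal])

lemma Jplus_trans: "(p, q) \<in> J \<Longrightarrow> (q, r) \<in> J \<Longrightarrow> (p, r) \<in> J"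
  unfolding Jplus_eq using Cr_trans by blast

lemma timelike_vec_imp_causal:
  assumes "c \<in> A" "x \<in> coords c" "timelike_vec c x v"
  shows "causal_vec c x v"
  using assms lorentzian_expand(7)[OF lorentz_metric.lorentz[OF lorentz_metric_chart[OF assms(1)] assms(2)]]
  by (auto simp: fd_timelike_vec_def fd_causal_vec_def)

lemma Iplus_subset_Cr: "I \<subseteq> Cr"
  unfolding Iplus_eq curve_rel_def
proof clarify
  fix \<gamma> a b assume "ae_curve A timelike_vec \<gamma> a b"
  then have "ae_curve A causal_vec \<gamma> a b" by (rule ae_curve_mono) (rule timelike_vec_imp_causal)
  then show "\<exists>\<gamma>' a' b'. ae_curve A causal_vec \<gamma>' a' b' \<and> \<gamma>' a' = \<gamma> a \<and> \<gamma>' b' = \<gamma> b" by blast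
qed

lemma Iplus_subset_Jplus: "I \<subseteq> J"
  using Iplus_subset_Cr by (auto simp: Jplus_eq)

lemma causal_curve_pair:
  assumes "ae_curve A causal_vec \<gamma> a b" "a \<le> s" "s \<le> t" "t \<le> b"
  shows "(\<gamma> s, \<gamma> t) \<in> J"
proof (cases "s = t")
  case False
  then have "ae_curve A causal_vec \<gamma> s t"
    using assms by (intro ae_curve_subinterval[OF assms(1)]) auto
  then show ?thesis using curve_relI by (auto simp: Jplus_eq)
qed (simp add: Jplus_eq)

text \<open>Reversing the time orientation leaves the axioms intact and exchanges future and past,
  so each statement about one end of a curve also holds at the other.\<close>

lemma dual_spacetime: "spacetime_structure A gm (\<lambda>c x. - T c x)"
proof
  have lf: "\<forall>c\<in>A. \<forall>x\<in>coords c. lorentzian_form (gm c x)"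
    using spacetime unfolding spacetime_def by (elim conjE)
  have cont: "\<forall>c\<in>A. continuous_on (coords c) (T c)"
    using spacetime unfolding spacetime_def by (elim conjE)
  have neg: "\<forall>c\<in>A. \<forall>x\<in>coords c. gm c x (T c x) (T c x) < 0"
    using spacetime unfolding spacetime_def by (elim conjE)
  have 1: "\<forall>c\<in>A. \<forall>d\<in>A. \<forall>x\<in>snd c ` (fst c \<inter> fst d).
        - T d (transition c d x) = frechet_derivative (transition c d) (at x) (- T c x)"
  proof (intro ballI)
    fix c d x assume *: "c \<in> A" "d \<in> A" "x \<in> snd c ` (fst c \<inter> fst d)"
    have "dirderivs [] (transition c d) differentiable (at x)"
      using transition_smooth[OF *(1,2)] *(3) unfolding smooth_on_def by blast
    then have "linear (frechet_derivative (transition c d) (at x))"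
      by (simp only: dirderivs.simps linear_frechet_derivative)
    then have "frechet_derivative (transition c d) (at x) (- T c x) = - frechet_derivative (transition c d) (at x) (T c x)"
      by (rule linear_neg)
    then show "- T d (transition c d x) = frechet_derivative (transition c d) (at x) (- T c x)"
      using metric_transition(2)[OF *] by simp
  qed
  have 2: "\<forall>c\<in>A. \<forall>x\<in>coords c. gm c x (- T c x) (- T c x) < 0"
    using neg lorentzian_expand(9,10)[OF lf[rule_format]] by simp
  have 3: "\<forall>c\<in>A. continuous_on (coords c) (\<lambda>x. - T c x)"
    using cont by (auto intro: continuous_on_minus)
  show "spacetime A gm (\<lambda>c x. - T c x)"
    using spacetime 1 2 3 unfolding spacetime_def by (elim conjE, intro conjI)
qed

lemma curve_rel_dual:
  assumes "(p, q) \<in> curve_rel P" "\<And>c x v. c \<in> A \<Longrightarrow> x \<in> coords c \<Longrightarrow> P c x v \<Longrightarrow> P' c x (- v)"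
  shows "(q, p) \<in> curve_rel P'"
proof -
  obtain \<gamma> a b where \<gamma>: "ae_curve A P \<gamma> a b" "\<gamma> a = p" "\<gamma> b = q"
    using assms(1) unfolding curve_rel_def by blast
  have "a < b" using \<gamma> by (simp add: ae_curve_def)
  have "ae_curve A P' (\<lambda>t. \<gamma> (- 1 * t + 0)) (- b) (- a)"
    by (rule ae_curve_affine[OF \<gamma>(1)]) (use \<open>a < b\<close> assms(2) in auto)
  from curve_relI[OF this] show ?thesis by (simp add: \<gamma>)
qed

lemma causal_vec_dual:
  "c \<in> A \<Longrightarrow> x \<in> coords c \<Longrightarrow> causal_vec c x v \<Longrightarrow> fd_causal_vec gm (\<lambda>c x. - T c x) c x (- v)"
  and timelike_vec_dual:
  "c \<in> A \<Longrightarrow> x \<in> coords c \<Longrightarrow> timelike_vec c x v \<Longrightarrow> fd_timelike_vec gm (\<lambda>c x. - T c x) c x (- v)"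
  using lorentzian_expand(9,10)[OF lorentz_metric.lorentz[OF lorentz_metric_chart]]
  by (auto simp: fd_causal_vec_def fd_timelike_vec_def)

end

context spacetime_structure
begin

interpretation dual: spacetime_structure A gm "\<lambda>c x. - T c x"
  by (rule dual_spacetime)

lemma Cr_dual: "dual.Cr = Cr\<inverse>"
proof -
  have "(q, p) \<in> dual.Cr" if "(p, q) \<in> Cr" for p q
    by (rule curve_rel_dual[OF that]) (rule causal_vec_dual)
  moreover have "(q, p) \<in> Cr" if "(p, q) \<in> dual.Cr" for p q
    by (rule curve_rel_dual[OF that]) (use dual.causal_vec_dual in simp)
  ultimately show ?thesis by auto
qed

lemma Iplus_dual: "dual.I = I\<inverse>"
proof -
  have "(q, p) \<in> dual.I" if "(p, q) \<in> I" for p q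
    unfolding dual.Iplus_eq by (rule curve_rel_dual[OF that[unfolded Iplus_eq]]) (rule timelike_vec_dual)
  moreover have "(q, p) \<in> I" if "(p, q) \<in> dual.I" for p q
    unfolding Iplus_eq by (rule curve_rel_dual[OF that[unfolded dual.Iplus_eq]]) (use dual.timelike_vec_dual in simp)
  ultimately show ?thesis by auto
qed

lemma Jplus_dual: "dual.J = J\<inverse>"
  unfolding Jplus_eq dual.Jplus_eq Cr_dual by auto

end

section \<open>From the chart to the manifold: stability and push-up\<close>

context spacetime_structure
begin

text \<open>The interior pulls back to an open set under the continuous coordinate maps, and
  coordinate curves are curves of the manifold, so that open set lies in \<open>I\<close>.\<close>

lemma local_future_interior_Iplus:
  assumes c: "c \<in> A" and xy: "(x, y) \<in> interior (lorentz_metric.local_future (coords c) (gm c) (T c))"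
  shows "(point_of c x, point_of c y) \<in> interior I"
proof -
  interpret lm: lorentz_metric "coords c" "gm c" "T c" by (rule lorentz_metric_chart[OF c])
  have fdt: "lm.fdt = timelike_vec c" by (simp add: fun_eq_iff lm.fdt_def fd_timelike_vec_def)
  have sub: "u \<in> coords c \<and> v \<in> coords c" if uv: "(u, v) \<in> lm.local_future" for u v
  proof -
    obtain \<zeta> a b where "coord_curve lm.fdt \<zeta> a b" "\<zeta> ` {a..b} \<subseteq> coords c" "\<zeta> a = u" "\<zeta> b = v"
      using uv unfolding lm.local_future_def by blast
    moreover from this have "a < b" by (simp add: coord_curve_def)
    ultimately show ?thesis by (auto simp: image_subset_iff)
  qed
  define O' where "O' = interior lm.local_future"
  have O': "open O'" "O' \<subseteq> lm.local_future" by (simp_all add: O'_def interior_subset)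
  define W where "W = (fst c \<times> fst c) \<inter> (\<lambda>z. (snd c (fst z), snd c (snd z))) -` O'"
  have "open W" unfolding W_def
  proof (rule continuous_open_preimage)
    show "continuous_on (fst c \<times> fst c) (\<lambda>z. (snd c (fst z), snd c (snd z)))"
      by (intro continuous_on_Pair continuous_on_compose2[OF chart(4)[OF c]] continuous_intros) auto
  qed (use O' chart(1)[OF c] in \<open>auto intro: open_Times\<close>)
  moreover have "W \<subseteq> I"
  proof
    fix z assume z: "z \<in> W"
    obtain p q where pq: "z = (p, q)" by (cases z)
    have p: "p \<in> fst c" "q \<in> fst c" "(snd c p, snd c q) \<in> lm.local_future"
      using z O'(2) by (auto simp: W_def pq)
    obtain \<zeta> a b where \<zeta>: "coord_curve lm.fdt \<zeta> a b" "\<zeta> ` {a..b} \<subseteq> coords c" "\<zeta> a = snd c p" "\<zeta> b = snd c q"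
      using p(3) unfolding lm.local_future_def mem_Collect_eq case_prod_conv by (elim exE conjE) (rule that)
    have "ae_curve A timelike_vec (\<lambda>t. point_of c (\<zeta> t)) a b"
      using coord_curve_imp_ae_curve[OF c chart_invariant_timelike] \<zeta>(1,2) by (simp add: fdt)
    from curve_relI[OF this] show "z \<in> I"
      by (simp add: \<zeta> pq Iplus_eq point_of_snd[OF c] p)
  qed
  moreover have "(point_of c x, point_of c y) \<in> W"
    using sub[of x y] xy interior_subset[of lm.local_future]
    by (auto simp: W_def O'_def point_of_in snd_point_of)
  ultimately show ?thesis by (meson interiorI)
qed

lemma chart_box:
  obtains c \<rho> k L \<eta> where "c \<in> A" "p \<in> fst c" "lorentz_metric.is_box (coords c) (gm c) (T c) (snd c p) \<rho> k L \<eta>"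
proof -
  obtain c where c: "c \<in> A" "p \<in> fst c" using chart_cover by blast
  then have "snd c p \<in> coords c" by simp
  then obtain \<rho> k L \<eta> where "lorentz_metric.is_box (coords c) (gm c) (T c) (snd c p) \<rho> k L \<eta>"
    by (rule lorentz_metric.ex_box[OF lorentz_metric_chart[OF c(1)]])
  with c show thesis by (rule that)
qed

lemma open_chart_preimage:
  assumes "c \<in> A" "open U"
  shows "open (fst c \<inter> snd c -` U)"
  using continuous_open_preimage[OF chart(4)[OF assms(1)] chart(1)[OF assms(1)] assms(2)] .

lemma open_chart_image:
  assumes "c \<in> A" "open U"
  shows "open (coords c \<inter> point_of c -` U)"
  using continuous_open_preimage[OF chart(5)[OF assms(1)] chart(3)[OF assms(1)] assms(2)] .

text \<open>The witness is the end of a short coordinate segment along the orienting vector.\<close>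

lemma interior_Iplus_near:
  assumes "open U" "q \<in> U"
  obtains q' where "q' \<in> U" "(q, q') \<in> interior I"
proof -
  obtain c where c: "c \<in> A" "q \<in> fst c" using chart_cover by blast
  interpret lm: lorentz_metric "coords c" "gm c" "T c" by (rule lorentz_metric_chart[OF c(1)])
  define x where "x = snd c q"
  have x: "x \<in> coords c" using c by (simp add: x_def)
  have "lm.fdt x (T c x)" using lm.timelike_orient[OF x] by (simp add: lm.fdt_def)
  then obtain d where d: "d > 0"
    "\<And>h u. 0 < h \<Longrightarrow> h < d \<Longrightarrow> dist u (T c x) < d \<Longrightarrow> (x, x + h *\<^sub>R u) \<in> interior lm.local_future"
    using lm.straight_segment_local_future[OF x] by metis
  have "open (coords c \<inter> point_of c -` U)" "x \<in> coords c \<inter> point_of c -` U"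
    using open_chart_image[OF c(1) assms(1)] x assms(2) point_of_snd[OF c] by (auto simp: x_def)
  then obtain e where e: "e > 0" "ball x e \<subseteq> coords c \<inter> point_of c -` U" by (meson openE)
  define h where "h = min (d / 2) (e / 2 / (norm (T c x) + 1))"
  have n1: "norm (T c x) + 1 > 0" by (simp add: add_nonneg_pos)
  have h: "0 < h" "h < d" using d e n1 by (auto simp: h_def min_less_iff_disj)
  have "h * norm (T c x) \<le> h * (norm (T c x) + 1)" using h by (intro mult_left_mono) auto
  also have "\<dots> \<le> e / 2" unfolding pos_le_divide_eq[OF n1, symmetric] by (simp add: h_def)
  also have "\<dots> < e" using e by simp
  finally have "x + h *\<^sub>R T c x \<in> ball x e" using h by (simp add: dist_norm)
  then have "point_of c (x + h *\<^sub>R T c x) \<in> U" using e by blast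
  moreover have "(point_of c x, point_of c (x + h *\<^sub>R T c x)) \<in> interior I"
    using d h by (intro local_future_interior_Iplus[OF c(1)] d(2)) auto
  ultimately show thesis using that by (simp add: x_def point_of_snd[OF c])
qed

text \<open>The neighbourhood \<open>V\<close> depends on the point alone and serves all causal
  curves inside it; this uniformity is what the bisection along a long curve uses.\<close>

lemma local_push_end:
  "\<exists>V. open V \<and> p \<in> V \<and>
    (\<forall>\<gamma> a b. ae_curve A causal_vec \<gamma> a b \<longrightarrow> \<gamma> ` {a..b} \<subseteq> V \<longrightarrow>
      (\<forall>U. open U \<longrightarrow> \<gamma> b \<in> U \<longrightarrow> (\<exists>q\<in>U. (\<gamma> a, q) \<in> interior I)))"
proof -
  obtain c \<rho> k L \<eta> where c: "c \<in> A" "p \<in> fst c"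
    and box: "lorentz_metric.is_box (coords c) (gm c) (T c) (snd c p) \<rho> k L \<eta>"
    by (rule chart_box)
  interpret lm: lorentz_metric "coords c" "gm c" "T c" by (rule lorentz_metric_chart[OF c(1)])
  have fdc: "lm.fdc = causal_vec c" by (simp add: fun_eq_iff lm.fdc_def fd_causal_vec_def)
  define V where "V = fst c \<inter> snd c -` ball (snd c p) \<rho>"
  show ?thesis
  proof (intro exI[of _ V] conjI allI impI)
    show "open V" unfolding V_def using c(1) by (rule open_chart_preimage) simp
    show "p \<in> V" using c lm.box_facts(1)[OF box] by (simp add: V_def)
    fix \<gamma> a b U
    assume \<gamma>: "ae_curve A causal_vec \<gamma> a b" "\<gamma> ` {a..b} \<subseteq> V" and U: "open U" "\<gamma> b \<in> U"
    have ab: "a < b" using \<gamma> by (simp add: ae_curve_def)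
    have sub: "\<gamma> ` {a..b} \<subseteq> fst c" using \<gamma>(2) by (auto simp: V_def)
    have cc: "coord_curve lm.fdc (snd c \<circ> \<gamma>) a b"
      using ae_curve_imp_coord_curve[OF \<gamma>(1) c(1) sub] by (simp add: fdc)
    have inb: "(snd c \<circ> \<gamma>) ` {a..b} \<subseteq> ball (snd c p) \<rho>" using \<gamma>(2) by (auto simp: V_def)
    have in_c: "\<gamma> a \<in> fst c" "\<gamma> b \<in> fst c" using sub ab by (auto simp: image_subset_iff)
    have "open (coords c \<inter> point_of c -` U)" "snd c (\<gamma> b) \<in> coords c \<inter> point_of c -` U"
      using open_chart_image[OF c(1) U(1)] U(2) point_of_snd[OF c(1) in_c(2)] in_c by auto
    then obtain e where e: "e > 0" "ball (snd c (\<gamma> b)) e \<subseteq> coords c \<inter> point_of c -` U" by (meson openE)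
    obtain y where y: "dist y ((snd c \<circ> \<gamma>) b) < e" "((snd c \<circ> \<gamma>) a, y) \<in> interior lm.local_future"
      using lm.causal_curve_end_push[OF box cc inb e(1)] by metis
    have "point_of c y \<in> U" using y(1) e(2) by (auto simp: dist_commute subset_iff)
    moreover have "(\<gamma> a, point_of c y) \<in> interior I"
      using local_future_interior_Iplus[OF c(1) y(2)] by (simp add: point_of_snd[OF c(1) in_c(1)])
    ultimately show "\<exists>q\<in>U. (\<gamma> a, q) \<in> interior I" by blast
  qed
qed

lemma interior_Iplus_trans:
  assumes "(p, q) \<in> interior I" "(q, r) \<in> interior I"
  shows "(p, r) \<in> interior I"
proof -
  obtain U V where UV: "open U" "open V" "p \<in> U" "q \<in> V" "U \<times> V \<subseteq> interior I"
    by (rule open_prod_elim[OF open_interior assms(1)]) auto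
  obtain V' W where VW: "open V'" "open W" "q \<in> V'" "r \<in> W" "V' \<times> W \<subseteq> interior I"
    by (rule open_prod_elim[OF open_interior assms(2)]) auto
  have "U \<times> W \<subseteq> I"
  proof clarify
    fix p' r' assume "p' \<in> U" "r' \<in> W"
    then have "(p', q) \<in> I" "(q, r') \<in> I" using UV VW interior_subset[of I] by blast+
    then show "(p', r') \<in> I" by (rule Iplus_trans)
  qed
  then show ?thesis using UV VW by (intro interiorI[of "U \<times> W"]) (auto intro: open_Times)
qed

lemma open_future_slice:
  "open {q. (p, q) \<in> interior I}" "open {p. (p, q) \<in> interior I}"
proof -
  have "open ((\<lambda>q. (p, q)) -` interior I)" "open ((\<lambda>p. (p, q)) -` interior I)"
    by (auto intro!: open_vimage continuous_intros)
  then show "open {q. (p, q) \<in> interior I}" "open {p. (p, q) \<in> interior I}" by (simp_all add: vimage_def)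
qed

text \<open>Bisection on the implication from \<open>v\<close> back to \<open>u\<close>. On a short
  piece the end can be moved to a point \<open>q\<close> in the stable future of the start; since
  the set of points stably before \<open>r\<close> is open, \<open>q\<close> may be taken in it, and
  the two relations compose.\<close>

lemma causal_curve_push_up:
  assumes \<gamma>: "ae_curve A causal_vec \<gamma> a b" and r: "(\<gamma> b, r) \<in> interior I"
  shows "(\<gamma> a, r) \<in> interior I"
proof -
  have ab: "a < b" and cont: "continuous_on {a..b} \<gamma>" using \<gamma> by (auto simp: ae_curve_def)
  have "a \<le> u \<and> u \<le> v \<and> v \<le> b \<longrightarrow> (\<gamma> v, r) \<in> interior I \<longrightarrow> (\<gamma> u, r) \<in> interior I" if "u \<le> v" for u v
    using that
  proof (induction u v rule: Bolzano)
    case (trans u v w)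
    then show ?case by (meson order_trans)
  next
    case (local x)
    show ?case
    proof (cases "x \<in> {a..b}")
      case False
      then show ?thesis by (intro exI[of _ 1]) auto
    next
      case True
      obtain V where V: "open V" "\<gamma> x \<in> V"
        "\<forall>\<delta> a b. ae_curve A causal_vec \<delta> a b \<longrightarrow> \<delta> ` {a..b} \<subseteq> V \<longrightarrow>
          (\<forall>U. open U \<longrightarrow> \<delta> b \<in> U \<longrightarrow> (\<exists>q\<in>U. (\<delta> a, q) \<in> interior I))"
        using local_push_end[of "\<gamma> x"] by blast
      obtain W where W: "open W" "x \<in> W" "\<And>y. y \<in> {a..b} \<Longrightarrow> y \<in> W \<Longrightarrow> \<gamma> y \<in> V"
        using cont True V unfolding continuous_on_topological by metis
      obtain e where e: "e > 0" "ball x e \<subseteq> W" using W by (meson openE)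
      have "(\<gamma> u, r) \<in> interior I"
        if "u \<le> x \<and> x \<le> v \<and> v - u < e" "a \<le> u \<and> u \<le> v \<and> v \<le> b" and vr: "(\<gamma> v, r) \<in> interior I" for u v
      proof (cases "u = v")
        case False
        have uv: "ae_curve A causal_vec \<gamma> u v" using that False by (intro ae_curve_subinterval[OF \<gamma>]) auto
        have sub: "\<gamma> ` {u..v} \<subseteq> V"
        proof (rule image_subsetI)
          fix y assume "y \<in> {u..v}"
          then have "y \<in> {a..b}" "y \<in> ball x e" using that by (auto simp: dist_real_def)
          then show "\<gamma> y \<in> V" using W e by blast
        qed
        obtain q where "(\<gamma> u, q) \<in> interior I" "(q, r) \<in> interior I"
          using V(3)[rule_format, OF uv sub open_future_slice(2)[of r]] vr by blast
        then show ?thesis by (rule interior_Iplus_trans)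
      qed (use vr in simp)
      then show ?thesis using e(1) by blast
    qed
  qed
  from this[of a b] show ?thesis using ab r by simp
qed

lemma Jplus_interior_Iplus:
  assumes "(p, q) \<in> J" "(q, r) \<in> interior I"
  shows "(p, r) \<in> interior I"
  using assms causal_curve_push_up unfolding Jplus_eq curve_rel_def by blast

lemma Jplus_near:
  assumes pq: "(p, q) \<in> J" and U: "open U" "q \<in> U"
  obtains q' where "q' \<in> U" "(p, q') \<in> interior I"
proof -
  obtain q' where "q' \<in> U" "(q, q') \<in> interior I" using interior_Iplus_near[OF U] by blast
  then show thesis using Jplus_interior_Iplus[OF pq] that by blast
qed

end

context spacetime_structure
begin

interpretation dual: spacetime_structure A gm "\<lambda>c x. - T c x"
  by (rule dual_spacetime)

lemma interior_Iplus_dual: "interior (dual.I) = (interior I)\<inverse>"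
proof -
  have op: "open (S\<inverse>)" if "open S" for S :: "('m \<times> 'm) set"
  proof -
    have "open ((\<lambda>z. (snd z, fst z)) -` S)" using that by (intro open_vimage continuous_intros)
    moreover have "(\<lambda>z. (snd z, fst z)) -` S = S\<inverse>" by auto
    ultimately show ?thesis by simp
  qed
  show ?thesis unfolding Iplus_dual
  proof (rule interior_unique)
    show "(interior I)\<inverse> \<subseteq> I\<inverse>" using interior_subset[of I] by auto
    show "open ((interior I)\<inverse>)" by (intro op open_interior)
    show "S \<subseteq> (interior I)\<inverse>" if "S \<subseteq> I\<inverse>" "open S" for S
      using interior_maximal[OF _ op[OF that(2)], of I] that(1) by auto
  qed
qed

lemma interior_Iplus_Jplus:
  assumes "(p, q) \<in> interior I" "(q, r) \<in> J"
  shows "(p, r) \<in> interior I"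
  using dual.Jplus_interior_Iplus[of r q p] assms by (simp add: Jplus_dual interior_Iplus_dual)

lemma open_Iplus: "open I"
proof -
  have "I \<subseteq> interior I"
  proof
    fix z assume z: "z \<in> I"
    then obtain \<gamma> a b where \<gamma>: "ae_curve A timelike_vec \<gamma> a b" "z = (\<gamma> a, \<gamma> b)"
      unfolding Iplus_eq curve_rel_def by blast
    have ab: "a < b" and cont: "continuous_on {a..b} \<gamma>" using \<gamma> by (auto simp: ae_curve_def)
    have causal: "ae_curve A causal_vec \<gamma> a b"
      by (rule ae_curve_mono[OF \<gamma>(1)]) (rule timelike_vec_imp_causal)
    obtain c where c: "c \<in> A" "\<gamma> a \<in> fst c" using chart_cover by blast
    interpret lm: lorentz_metric "coords c" "gm c" "T c" by (rule lorentz_metric_chart[OF c(1)])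
    have fdt: "lm.fdt = timelike_vec c" by (simp add: fun_eq_iff lm.fdt_def fd_timelike_vec_def)
    have "a \<in> {a..b}" using ab by simp
    then obtain W where W: "open W" "a \<in> W" "\<forall>y\<in>{a..b}. y \<in> W \<longrightarrow> \<gamma> y \<in> fst c"
      using cont[unfolded continuous_on_topological, rule_format, of a "fst c"] chart(1)[OF c(1)] c(2) by blast
    obtain e where e: "e > 0" "ball a e \<subseteq> W" using W by (meson openE)
    define s where "s = min b (a + e / 2)"
    have s: "a < s" "s \<le> b" using ab e by (auto simp: s_def)
    have sub: "\<gamma> ` {a..s} \<subseteq> fst c"
    proof (rule image_subsetI)
      fix y assume "y \<in> {a..s}"
      then have "y \<in> {a..b}" "y \<in> ball a e" using e(1) by (auto simp: dist_real_def s_def)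
      then show "\<gamma> y \<in> fst c" using W e by blast
    qed
    have "coord_curve lm.fdt (snd c \<circ> \<gamma>) a s"
      using ae_curve_imp_coord_curve[OF ae_curve_subinterval[OF \<gamma>(1) order_refl s] c(1) sub] by (simp add: fdt)
    then obtain N where N: "negligible N"
      "\<And>r. r \<in> {a<..<s} - N \<Longrightarrow> \<exists>v. (snd c \<circ> \<gamma> has_vector_derivative v) (at r) \<and> lm.fdt ((snd c \<circ> \<gamma>) r) v"
      unfolding coord_curve_def by blast
    have "\<not> negligible {a<..<s}" using s by (simp add: open_not_negligible)
    then obtain r where r: "r \<in> {a<..<s}" "r \<notin> N" using N(1) negligible_subset by blast
    then obtain v where v: "(snd c \<circ> \<gamma> has_vector_derivative v) (at r)" "lm.fdt ((snd c \<circ> \<gamma>) r) v"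
      using N(2) by blast
    have rc: "(snd c \<circ> \<gamma>) r \<in> coords c" using sub r by (auto simp: image_subset_iff)
    obtain d where d: "d > 0" "\<And>h. 0 < h \<Longrightarrow> h < d \<Longrightarrow> ((snd c \<circ> \<gamma>) r, (snd c \<circ> \<gamma>) (r + h)) \<in> interior lm.local_future"
      using lm.timelike_derivative_local_future[OF rc v(2,1)] by metis
    define h where "h = min (d / 2) ((s - r) / 2)"
    have "h \<le> (s - r) / 2" unfolding h_def by (rule min.cobounded2)
    moreover have "r < s" using r by simp
    ultimately have h3: "r + h < s" by argo
    have "0 < h" "h < d" using d(1) r by (auto simp: h_def min_less_iff_disj)
    note h = this h3
    have "\<gamma> r \<in> fst c" "\<gamma> (r + h) \<in> fst c" using sub r h by (auto simp: image_subset_iff)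
    then have "(\<gamma> r, \<gamma> (r + h)) \<in> interior I"
      using local_future_interior_Iplus[OF c(1) d(2)[OF h(1,2)]] by (simp add: point_of_snd[OF c(1)])
    moreover have "(\<gamma> a, \<gamma> r) \<in> J" "(\<gamma> (r + h), \<gamma> b) \<in> J"
      using r h s by (auto intro!: causal_curve_pair[OF causal])
    ultimately show "z \<in> interior I"
      unfolding \<gamma>(2) by (blast intro: Jplus_interior_Iplus interior_Iplus_Jplus)
  qed
  then show ?thesis by (metis interior_subset open_interior subset_antisym)
qed

lemma Jplus_Iplus: "(p, q) \<in> J \<Longrightarrow> (q, r) \<in> I \<Longrightarrow> (p, r) \<in> I"
  using Jplus_interior_Iplus interior_open[OF open_Iplus] by metis

lemma Iplus_Jplus: "(p, q) \<in> I \<Longrightarrow> (q, r) \<in> J \<Longrightarrow> (p, r) \<in> I"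
  using interior_Iplus_Jplus interior_open[OF open_Iplus] by metis

section \<open>Composing the closure of the causal relation with \<open>I\<close> and
  \<open>J\<close>\<close>

lemma Aplus_meets:
  assumes "(x, y) \<in> Ap" "open U" "open V" "x \<in> U" "y \<in> V"
  obtains x' y' where "x' \<in> U" "y' \<in> V" "(x', y') \<in> J"
proof -
  have "open (U \<times> V)" "(x, y) \<in> U \<times> V" using assms by (auto intro: open_Times)
  then have "U \<times> V \<inter> J \<noteq> {}"
    using assms(1) unfolding Aplus_def by (metis closure_iff_nhds_not_empty inf_commute order_refl)
  then show thesis using that by blast
qed

lemma AplusI:
  assumes "\<And>U V. open U \<Longrightarrow> open V \<Longrightarrow> x \<in> U \<Longrightarrow> y \<in> V \<Longrightarrow> \<exists>x'\<in>U. \<exists>y'\<in>V. (x', y') \<in> J"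
  shows "(x, y) \<in> Ap"
  unfolding Aplus_def closure_iff_nhds_not_empty
proof (intro allI impI)
  fix S W assume "W \<subseteq> S" "open W" "(x, y) \<in> W"
  obtain U V where "open U" "open V" "x \<in> U" "y \<in> V" "U \<times> V \<subseteq> W"
    by (rule open_prod_elim[OF \<open>open W\<close> \<open>(x, y) \<in> W\<close>]) auto
  with assms[of U V] \<open>W \<subseteq> S\<close> show "J \<inter> S \<noteq> {}" by blast
qed

lemma Aplus_Iplus_Aplus:
  assumes xp: "(x, p) \<in> Ap" and pq: "(p, q) \<in> I" and qz: "(q, z) \<in> Ap"
  shows "(x, z) \<in> Ap"
proof (rule AplusI)
  fix U V assume UV: "open U" "open V" "x \<in> U" "z \<in> V"
  obtain P Q where PQ: "open P" "open Q" "p \<in> P" "q \<in> Q" "P \<times> Q \<subseteq> I"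
    by (rule open_prod_elim[OF open_Iplus pq]) auto
  obtain x' p' where 1: "x' \<in> U" "p' \<in> P" "(x', p') \<in> J" using Aplus_meets[OF xp UV(1) PQ(1) UV(3) PQ(3)] .
  obtain q' z' where 2: "q' \<in> Q" "z' \<in> V" "(q', z') \<in> J" using Aplus_meets[OF qz PQ(2) UV(2) PQ(4) UV(4)] .
  have "(p', q') \<in> J" using PQ(5) 1 2 Iplus_subset_Jplus by blast
  then show "\<exists>x'\<in>U. \<exists>y'\<in>V. (x', y') \<in> J" using 1 2 Jplus_trans by blast
qed

text \<open>Moving \<open>z\<close> slightly into the future makes the relation from
  \<open>y\<close> stable, so it also holds from the points near \<open>y\<close> that are reached
  by causal curves starting near \<open>x\<close>.\<close>

lemma Aplus_Jplus:
  assumes xy: "(x, y) \<in> Ap" and yz: "(y, z) \<in> J"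
  shows "(x, z) \<in> Ap"
proof (rule AplusI)
  fix U V assume UV: "open U" "open V" "x \<in> U" "z \<in> V"
  obtain z' where z': "z' \<in> V" "(y, z') \<in> interior I" using Jplus_near[OF yz UV(2,4)] .
  obtain x' y' where "x' \<in> U" "(x', y') \<in> J" "(y', z') \<in> interior I"
    using Aplus_meets[OF xy UV(1) open_future_slice(2) UV(3)] z'(2) by blast
  then show "\<exists>x'\<in>U. \<exists>y'\<in>V. (x', y') \<in> J"
    using z'(1) interior_subset[of I] Iplus_subset_Jplus Jplus_trans by blast
qed

end

context spacetime_structure
begin

interpretation dual: spacetime_structure A gm "\<lambda>c x. - T c x"
  by (rule dual_spacetime)

lemma Aplus_dual: "dual.Ap = Ap\<inverse>"
proof -
  have "(y, x) \<in> dual.Ap" if xy: "(x, y) \<in> Ap" for x y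
  proof (rule dual.AplusI)
    fix U V assume "open U" "open V" "y \<in> U" "x \<in> V"
    then obtain x' y' where "x' \<in> V" "y' \<in> U" "(x', y') \<in> J" using Aplus_meets[OF xy] by metis
    then show "\<exists>y'\<in>U. \<exists>x'\<in>V. (y', x') \<in> dual.J" by (auto simp: Jplus_dual)
  qed
  moreover have "(y, x) \<in> Ap" if xy: "(x, y) \<in> dual.Ap" for x y
  proof (rule AplusI)
    fix U V assume "open U" "open V" "y \<in> U" "x \<in> V"
    then obtain x' y' where "x' \<in> V" "y' \<in> U" "(x', y') \<in> dual.J"
      using dual.Aplus_meets[OF xy] by metis
    then show "\<exists>y'\<in>U. \<exists>x'\<in>V. (y', x') \<in> J" by (auto simp: Jplus_dual)
  qed
  ultimately show ?thesis by auto
qed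

lemma Jplus_Aplus:
  assumes "(x, y) \<in> J" "(y, z) \<in> Ap"
  shows "(x, z) \<in> Ap"
  using dual.Aplus_Jplus[of z y x] assms by (simp add: Aplus_dual Jplus_dual)

lemma Jplus_subset_Aplus: "J \<subseteq> Ap"
  unfolding Aplus_def by (rule closure_subset)

end

subsection \<open>Limit curves and lines\<close>

text \<open>The first parameter outside \<open>W\<close> is taken; before it the curve is in
  \<open>W\<close>, and closedness of \<open>D\<close> adds that parameter. With an open and a
  closed ball of equal radius, the exit point lies on the sphere.\<close>

lemma first_exit:
  fixes \<gamma> :: "real \<Rightarrow> 'a::topological_space"
  assumes cont: "continuous_on {0..1} \<gamma>" and "\<gamma> 0 \<in> W" and W: "open W" "W \<subseteq> D" and D: "closed D"
    and exit: "t \<in> {0..1}" "\<gamma> t \<notin> D"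
  obtains s where "0 < s" "s \<le> 1" "\<gamma> ` {0..s} \<subseteq> D" "\<gamma> s \<notin> W"
proof -
  define E where "E = {0..1} \<inter> \<gamma> -` (- W)"
  have "closed E" unfolding E_def
    by (rule continuous_closed_preimage[OF cont]) (use W in auto)
  then have "compact E" unfolding E_def by (metis Int_absorb1 compact_Icc compact_Int_closed inf_le1)
  moreover have "t \<in> E" using exit W by (auto simp: E_def)
  ultimately obtain s where s: "s \<in> E" "\<forall>u\<in>E. s \<le> u" using compact_attains_inf[of E] by blast
  have s01: "0 \<le> s" "s \<le> 1" "\<gamma> s \<notin> W" using s(1) by (auto simp: E_def)
  then have "0 < s" using \<open>\<gamma> 0 \<in> W\<close> by (cases "s = 0") auto
  have "closed ({0..s} \<inter> \<gamma> -` D)"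
    by (rule continuous_closed_preimage) (use cont D s01 in \<open>auto intro: continuous_on_subset\<close>)
  moreover have "{0..<s} \<subseteq> {0..s} \<inter> \<gamma> -` D"
  proof
    fix u assume u: "u \<in> {0..<s}"
    then have "u \<notin> E" using s(2) by force
    then show "u \<in> {0..s} \<inter> \<gamma> -` D" using u s01 W by (auto simp: E_def)
  qed
  ultimately have "closure {0..<s} \<subseteq> {0..s} \<inter> \<gamma> -` D" by (intro closure_minimal)
  then have "\<gamma> ` {0..s} \<subseteq> D" using \<open>0 < s\<close> by auto
  then show thesis using that \<open>0 < s\<close> s01 by blast
qed

section \<open>One step of the limit curve construction\<close>

context spacetime_structure
begin

text \<open>The image of the closed ball is compact, hence closed in the Hausdorff manifold. This
  places both limit points inside the chart, where the coordinate version applies.\<close>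

lemma causal_curve_limit_in_chart:
  assumes c: "c \<in> A" and box: "lorentz_metric.is_box (coords c) (gm c) (T c) x0 \<rho> k L \<eta>" and R: "R < \<rho>"
    and \<gamma>: "\<And>n. ae_curve A causal_vec (\<gamma> n) (a n) (b n)" "\<And>n. \<gamma> n ` {a n..b n} \<subseteq> point_of c ` cball x0 R"
    and y: "(\<lambda>n. \<gamma> n (a n)) \<longlonglongrightarrow> y" and z: "(\<lambda>n. \<gamma> n (b n)) \<longlonglongrightarrow> z" and "y \<noteq> z"
  shows "(y, z) \<in> Cr"
proof -
  interpret lm: lorentz_metric "coords c" "gm c" "T c" by (rule lorentz_metric_chart[OF c])
  have fdc: "lm.fdc = causal_vec c" by (simp add: fun_eq_iff lm.fdc_def fd_causal_vec_def)
  have sub: "cball x0 R \<subseteq> coords c" using R lm.box_facts(5)[OF box] by (meson less_imp_le subset_cball subset_trans)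
  have "compact (point_of c ` cball x0 R)"
    using continuous_on_subset[OF chart(5)[OF c] sub] by (rule compact_continuous_image) simp
  then have cl: "closed (point_of c ` cball x0 R)" by (rule compact_imp_closed)
  have Dc: "point_of c ` cball x0 R \<subseteq> fst c" using sub point_of_in by blast
  have ab: "a n < b n" for n using \<gamma>(1)[of n] by (simp add: ae_curve_def)
  have ends: "\<gamma> n (a n) \<in> point_of c ` cball x0 R" "\<gamma> n (b n) \<in> point_of c ` cball x0 R" for n
    using \<gamma>(2)[of n] ab[of n] by (auto simp: image_subset_iff)
  have yz: "y \<in> fst c" "z \<in> fst c"
    using closed_sequentially[OF cl ends(1) y] closed_sequentially[OF cl ends(2) z] Dc by blast+
  have ne: "snd c y \<noteq> snd c z" using yz \<open>y \<noteq> z\<close> chart(2)[OF c] by (auto dest: inj_onD)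
  have l1: "(\<lambda>n. (snd c \<circ> \<gamma> n) (a n)) \<longlonglongrightarrow> snd c y" unfolding o_apply
    by (rule continuous_on_tendsto_compose[OF chart(4)[OF c] y yz(1)]) (use ends Dc in \<open>auto intro!: always_eventually\<close>)
  have l2: "(\<lambda>n. (snd c \<circ> \<gamma> n) (b n)) \<longlonglongrightarrow> snd c z" unfolding o_apply
    by (rule continuous_on_tendsto_compose[OF chart(4)[OF c] z yz(2)]) (use ends Dc in \<open>auto intro!: always_eventually\<close>)
  have cc: "coord_curve lm.fdc (snd c \<circ> \<gamma> n) (a n) (b n)" for n
    using ae_curve_imp_coord_curve[OF \<gamma>(1) c order_trans[OF \<gamma>(2) Dc]] by (simp add: fdc)
  have inb: "(snd c \<circ> \<gamma> n) ` {a n..b n} \<subseteq> cball x0 R" for n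
  proof (rule image_subsetI)
    fix t assume "t \<in> {a n..b n}"
    then have "\<gamma> n t \<in> point_of c ` cball x0 R" using \<gamma>(2)[of n] by blast
    then obtain x where "x \<in> cball x0 R" "\<gamma> n t = point_of c x" by blast
    then show "(snd c \<circ> \<gamma> n) t \<in> cball x0 R" using snd_point_of[of x c] sub by (metis o_apply subsetD)
  qed
  obtain \<xi> where \<xi>: "coord_curve lm.fdc \<xi> 0 1" "\<xi> ` {0..1} \<subseteq> cball x0 R" "\<xi> 0 = snd c y" "\<xi> 1 = snd c z"
    by (rule lm.causal_curve_limit[where \<zeta>="\<lambda>n. snd c \<circ> \<gamma> n", OF box R cc inb l1 l2 ne])
  have "ae_curve A causal_vec (\<lambda>t. point_of c (\<xi> t)) 0 1"
    using coord_curve_imp_ae_curve[OF c chart_invariant_causal] \<xi>(1) order_trans[OF \<xi>(2) sub] by (simp add: fdc)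
  from curve_relI[OF this] show ?thesis by (simp add: \<xi> point_of_snd[OF c] yz)
qed

text \<open>States one step for all starting points of \<open>B\<close> at once. \<open>S\<close> is
  a barrier to be reached from \<open>B\<close>; it is closed and misses the closure of
  \<open>B\<close>, so that infinitely many steps from the same \<open>B\<close> cannot accumulate
  at a single limit.\<close>

definition exit_pair :: "'m set \<Rightarrow> 'm set \<Rightarrow> bool" where
  "exit_pair B S \<longleftrightarrow> open B \<and> closed S \<and> closure B \<inter> S = {} \<and>
     (\<forall>y\<in>B. \<forall>z. (y, z) \<in> Ap \<longrightarrow> (y, z) \<notin> J \<longrightarrow> (\<exists>w\<in>S. (y, w) \<in> Cr \<and> (w, z) \<in> Ap))"

text \<open>As \<open>y\<close> and \<open>z\<close> are separated by open sets, the approximating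
  pairs in \<open>J\<close> eventually have distinct entries and are therefore joined by
  curves.\<close>

lemma Aplus_sequence:
  assumes yz: "(y, z) \<in> Ap" and "y \<noteq> z" and B: "open B" "y \<in> B"
  shows "\<exists>\<gamma>. (\<forall>n::nat. ae_curve A causal_vec (\<gamma> n) 0 1 \<and> \<gamma> n 0 \<in> B) \<and>
    (\<lambda>n. \<gamma> n 0) \<longlonglongrightarrow> y \<and> (\<lambda>n. \<gamma> n 1) \<longlonglongrightarrow> z"
proof -
  obtain s where s: "\<And>n. s n \<in> J" "s \<longlonglongrightarrow> (y, z)"
    using yz unfolding Aplus_def closure_sequential by blast
  have lim: "(\<lambda>n. fst (s n)) \<longlonglongrightarrow> y" "(\<lambda>n. snd (s n)) \<longlonglongrightarrow> z"
    using tendsto_fst[OF s(2)] tendsto_snd[OF s(2)] by simp_all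
  obtain U V where UV: "open U" "open V" "y \<in> U" "z \<in> V" "U \<inter> V = {}" using hausdorff[OF \<open>y \<noteq> z\<close>] by blast
  have "\<forall>\<^sub>F n in sequentially. fst (s n) \<in> B \<and> fst (s n) \<in> U \<and> snd (s n) \<in> V"
    using topological_tendstoD[OF lim(1) B] topological_tendstoD[OF lim(1) UV(1,3)] topological_tendstoD[OF lim(2) UV(2,4)]
    by eventually_elim simp
  then obtain N where N: "\<And>n. n \<ge> N \<Longrightarrow> fst (s n) \<in> B \<and> fst (s n) \<in> U \<and> snd (s n) \<in> V"
    unfolding eventually_sequentially by blast
  have "\<forall>n. \<exists>\<gamma>. ae_curve A causal_vec \<gamma> 0 1 \<and> \<gamma> 0 = fst (s (n + N)) \<and> \<gamma> 1 = snd (s (n + N))"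
  proof
    fix n
    have "fst (s (n + N)) \<noteq> snd (s (n + N))" using N[of "n + N"] UV(5) by auto
    then have "(fst (s (n + N)), snd (s (n + N))) \<in> Cr" using s(1)[of "n + N"] unfolding Jplus_eq by (cases "s (n + N)") auto
    then obtain \<gamma> where "ae_curve A causal_vec \<gamma> 0 1" "\<gamma> 0 = fst (s (n + N))" "\<gamma> 1 = snd (s (n + N))"
      by (rule curve_rel_on_interval[OF homogeneous_causal _ zero_less_one])
    then show "\<exists>\<gamma>. ae_curve A causal_vec \<gamma> 0 1 \<and> \<gamma> 0 = fst (s (n + N)) \<and> \<gamma> 1 = snd (s (n + N))" by blast
  qed
  from choice[OF this] obtain \<gamma> where \<gamma>: "\<And>n. ae_curve A causal_vec (\<gamma> n) 0 1"
    "\<And>n. \<gamma> n 0 = fst (s (n + N))" "\<And>n. \<gamma> n 1 = snd (s (n + N))" by blast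
  show ?thesis
  proof (intro exI[of _ \<gamma>] conjI allI)
    show "(\<lambda>n. \<gamma> n 0) \<longlonglongrightarrow> y" "(\<lambda>n. \<gamma> n 1) \<longlonglongrightarrow> z"
      unfolding \<gamma>(2,3) using lim by (auto intro: LIMSEQ_ignore_initial_segment)
  qed (use \<gamma> N in auto)
qed

text \<open>\<open>B\<close> is a coordinate ball of radius \<open>R / 2\<close> and
  \<open>S\<close> the sphere of radius \<open>R\<close>. Causal curves approximating
  \<open>(y, z)\<close> leave the ball, and their first exit points accumulate on the compact sphere
  at some \<open>w'\<close>. The initial pieces converge to a causal curve from \<open>y\<close> to
  \<open>w'\<close>, while the remaining pieces witness \<open>(w', z) \<in> Ap\<close>.\<close>

lemma ex_exit_pair:
  "\<exists>B S. p \<in> B \<and> exit_pair B S"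
proof -
  obtain c \<rho> k L \<eta> where c: "c \<in> A" "p \<in> fst c"
    and box: "lorentz_metric.is_box (coords c) (gm c) (T c) (snd c p) \<rho> k L \<eta>" by (rule chart_box)
  interpret lm: lorentz_metric "coords c" "gm c" "T c" by (rule lorentz_metric_chart[OF c(1)])
  define x0 where "x0 = snd c p"
  define R where "R = \<rho> / 2"
  have \<rho>: "\<rho> > 0" and cb: "cball x0 \<rho> \<subseteq> coords c" using lm.box_facts[OF box] by (auto simp: x0_def)
  have R: "R < \<rho>" "0 < R" using \<rho> by (auto simp: R_def)
  have sub: "cball x0 R \<subseteq> coords c" "ball x0 R \<subseteq> coords c" "cball x0 (R / 2) \<subseteq> coords c" "sphere x0 R \<subseteq> coords c"
    using R cb by (auto simp: subset_iff)
  define im where "im = (\<lambda>X. point_of c ` X)"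
  have im_eq: "im X = fst c \<inter> snd c -` X" if "X \<subseteq> coords c" for X
  proof -
    have "q \<in> im X" if q: "q \<in> fst c" "snd c q \<in> X" for q
      unfolding im_def using image_eqI[of q "point_of c" "snd c q" X] point_of_snd[OF c(1) q(1)] q(2) by simp
    moreover have "q \<in> fst c \<and> snd c q \<in> X" if q: "q \<in> im X" for q
    proof -
      obtain x where x: "x \<in> X" "q = point_of c x" using q by (auto simp: im_def)
      have "x \<in> coords c" using x \<open>X \<subseteq> coords c\<close> by blast
      then show ?thesis using x by (simp only: point_of_in snd_point_of simp_thms)
    qed
    ultimately show ?thesis by blast
  qed
  have cpt: "compact (im X)" if "compact X" "X \<subseteq> coords c" for X
    unfolding im_def using continuous_on_subset[OF chart(5)[OF c(1)] that(2)] that(1) by (rule compact_continuous_image)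
  define W B S D where "W = im (ball x0 R)" and "B = im (ball x0 (R / 2))" and "S = im (sphere x0 R)" and "D = im (cball x0 R)"
  have sub': "ball x0 (R / 2) \<subseteq> coords c" using sub(3) by auto
  have oW: "open W" "open B" unfolding W_def B_def im_eq[OF sub(2)] im_eq[OF sub'] using open_chart_preimage[OF c(1)] by auto
  have clS: "closed S" "closed D" unfolding S_def D_def using cpt sub by (auto intro!: compact_imp_closed)
  have BW: "B \<subseteq> W" "W \<subseteq> D" unfolding B_def W_def D_def im_def using R by (auto intro!: image_mono)
  have DWS: "q \<in> S" if "q \<in> D" "q \<notin> W" for q
    using that unfolding D_def W_def S_def im_eq[OF sub(1)] im_eq[OF sub(2)] im_eq[OF sub(4)] by auto
  have "closure B \<subseteq> im (cball x0 (R / 2))"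
    by (rule closure_minimal) (use cpt sub(3) in \<open>auto simp: B_def im_def intro!: compact_imp_closed\<close>)
  moreover have "im (cball x0 (R / 2)) \<inter> S = {}"
    unfolding S_def im_eq[OF sub(3)] im_eq[OF sub(4)] using R by auto
  ultimately have disj: "closure B \<inter> S = {}" by blast
  have step: "\<exists>w\<in>S. (y, w) \<in> Cr \<and> (w, z) \<in> Ap"
    if y: "y \<in> B" and yz: "(y, z) \<in> Ap" "(y, z) \<notin> J" for y z
  proof -
    have "y \<noteq> z" using yz(2) by (auto simp: Jplus_eq)
    obtain \<gamma> where \<gamma>: "\<And>n::nat. ae_curve A causal_vec (\<gamma> n) 0 1" "\<And>n. \<gamma> n 0 \<in> B"
      "(\<lambda>n. \<gamma> n 0) \<longlonglongrightarrow> y" "(\<lambda>n. \<gamma> n 1) \<longlonglongrightarrow> z"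
      using Aplus_sequence[OF yz(1) \<open>y \<noteq> z\<close> oW(2) y] by blast
    \<comment> \<open>If infinitely many curves stayed in \<open>D\<close>, their limit inside the
      chart would join \<open>y\<close> to \<open>z\<close> and put the pair into
      \<open>J\<close>.\<close>
    have "\<not> infinite {n. \<gamma> n ` {0..1} \<subseteq> D}"
    proof
      assume "infinite {n. \<gamma> n ` {0..1} \<subseteq> D}"
      from infinite_enumerate[OF this] obtain r :: "nat \<Rightarrow> nat" where r: "strict_mono r" "\<And>n. \<gamma> (r n) ` {0..1} \<subseteq> D"
        by auto
      have "(y, z) \<in> Cr"
      proof (rule causal_curve_limit_in_chart[OF c(1) box R(1), where \<gamma>="\<lambda>n. \<gamma> (r n)" and a="\<lambda>n. 0" and b="\<lambda>n. 1"])
        show "\<gamma> (r n) ` {0..1} \<subseteq> point_of c ` cball (snd c p) R" for n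
          using r(2)[of n] by (simp only: D_def im_def x0_def)
        show "(\<lambda>n. \<gamma> (r n) 0) \<longlonglongrightarrow> y" using LIMSEQ_subseq_LIMSEQ[OF \<gamma>(3) r(1)] by (simp add: o_def)
        show "(\<lambda>n. \<gamma> (r n) 1) \<longlonglongrightarrow> z" using LIMSEQ_subseq_LIMSEQ[OF \<gamma>(4) r(1)] by (simp add: o_def)
      qed fact+
      then show False using yz(2) by (simp add: Jplus_eq)
    qed
    then have "infinite (- {n. \<gamma> n ` {0..1} \<subseteq> D})"
      using infinite_UNIV_nat finite_compl by blast
    from infinite_enumerate[OF this] obtain r :: "nat \<Rightarrow> nat" where r: "strict_mono r" "\<And>n. \<not> \<gamma> (r n) ` {0..1} \<subseteq> D"
      by auto
    have "\<forall>n. \<exists>s. 0 < s \<and> s \<le> 1 \<and> \<gamma> (r n) ` {0..s} \<subseteq> D \<and> \<gamma> (r n) s \<in> S"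
    proof
      fix n
      obtain t where t: "t \<in> {0..1}" "\<gamma> (r n) t \<notin> D" using r(2)[of n] by blast
      have "continuous_on {0..1} (\<gamma> (r n))" using \<gamma>(1)[of "r n"] by (simp add: ae_curve_def)
      moreover have "\<gamma> (r n) 0 \<in> W" using \<gamma>(2) BW by blast
      ultimately obtain s where s: "0 < s" "s \<le> 1" "\<gamma> (r n) ` {0..s} \<subseteq> D" "\<gamma> (r n) s \<notin> W"
        by (rule first_exit[where \<gamma>="\<gamma> (r n)", OF _ _ oW(1) BW(2) clS(2) t])
      moreover have "\<gamma> (r n) s \<in> D" using s by auto
      ultimately show "\<exists>s. 0 < s \<and> s \<le> 1 \<and> \<gamma> (r n) ` {0..s} \<subseteq> D \<and> \<gamma> (r n) s \<in> S" using DWS by blast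
    qed
    from choice[OF this] obtain s where s: "\<And>n. 0 < s n" "\<And>n. s n \<le> 1" "\<And>n. \<gamma> (r n) ` {0..s n} \<subseteq> D" "\<And>n. \<gamma> (r n) (s n) \<in> S"
      by blast
    define w where "w = (\<lambda>n. \<gamma> (r n) (s n))"
    have wS: "w n \<in> fst c" "snd c (w n) \<in> sphere x0 R" for n
      using s(4)[of n] unfolding S_def im_eq[OF sub(4)] w_def by auto
    have "seq_compact (sphere x0 R)" by (rule compact_imp_seq_compact[OF compact_sphere])
    then obtain l r2 where l: "l \<in> sphere x0 R" "strict_mono r2" "((\<lambda>n. snd c (w n)) \<circ> r2) \<longlonglongrightarrow> l"
      using wS(2) by (rule_tac seq_compactE[of "sphere x0 R" "\<lambda>n. snd c (w n)"]) auto
    define w' where "w' = point_of c l"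
    have lc: "l \<in> coords c" using l sub by blast
    have "(\<lambda>n. point_of c (snd c (w (r2 n)))) \<longlonglongrightarrow> point_of c l"
      by (rule continuous_on_tendsto_compose[OF chart(5)[OF c(1)] _ lc])
        (use l(3) wS(1) in \<open>auto simp: o_def intro!: always_eventually\<close>)
    then have w': "(\<lambda>n. w (r2 n)) \<longlonglongrightarrow> w'" by (simp add: w'_def point_of_snd[OF c(1) wS(1)])
    have w'S: "w' \<in> S" unfolding w'_def S_def im_def using l(1) by blast
    have "y \<in> closure B" using y closure_subset by blast
    then have "y \<noteq> w'" using disj w'S by blast
    have rr: "strict_mono (\<lambda>n. r (r2 n))" using r(1) l(2) by (auto simp: strict_mono_def)
    have "(y, w') \<in> Cr"
    proof (rule causal_curve_limit_in_chart[OF c(1) box R(1), where \<gamma>="\<lambda>n. \<gamma> (r (r2 n))" and a="\<lambda>n. 0" and b="\<lambda>n. s (r2 n)"])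
      show "ae_curve A causal_vec (\<gamma> (r (r2 n))) 0 (s (r2 n))" for n
        using s by (intro ae_curve_subinterval[OF \<gamma>(1)]) auto
      show "\<gamma> (r (r2 n)) ` {0..s (r2 n)} \<subseteq> point_of c ` cball (snd c p) R" for n
        using s(3)[of "r2 n"] by (simp add: D_def im_def x0_def)
      show "(\<lambda>n. \<gamma> (r (r2 n)) 0) \<longlonglongrightarrow> y" using LIMSEQ_subseq_LIMSEQ[OF \<gamma>(3) rr] by (simp add: o_def)
      show "(\<lambda>n. \<gamma> (r (r2 n)) (s (r2 n))) \<longlonglongrightarrow> w'" using w' by (simp add: w_def)
    qed fact
    moreover have "(w', z) \<in> Ap"
      unfolding Aplus_def closure_sequential
    proof (intro exI conjI allI)
      show "(w (r2 n), \<gamma> (r (r2 n)) 1) \<in> J" for n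
        unfolding w_def using s(1,2)[of "r2 n"] by (intro causal_curve_pair[OF \<gamma>(1)]) auto
      show "(\<lambda>n. (w (r2 n), \<gamma> (r (r2 n)) 1)) \<longlonglongrightarrow> (w', z)"
        using w' LIMSEQ_subseq_LIMSEQ[OF \<gamma>(4) rr] by (intro tendsto_Pair) (auto simp: o_def)
    qed
    ultimately show ?thesis using w'S by blast
  qed
  have "p \<in> B" unfolding B_def im_eq[OF sub'] using c R by (simp add: x0_def)
  moreover have "exit_pair B S" unfolding exit_pair_def using oW clS disj step by blast
  ultimately show ?thesis by blast
qed

text \<open>Second countability makes the cover a sequence, so that every point has a cover element
  of least index.\<close>

lemma countable_exit_pairs:
  obtains B S where "\<And>k::nat. exit_pair (B k) (S k)" "\<And>p. \<exists>k. p \<in> B k"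
proof -
  obtain F where F: "F \<subseteq> {B. \<exists>S. exit_pair B S}" "countable F" "\<Union>F = \<Union>{B. \<exists>S. exit_pair B S}"
    by (rule Lindelof[of "{B. \<exists>S. exit_pair B S}"]) (auto simp: exit_pair_def)
  have cov: "\<Union>F = UNIV"
  proof -
    have "p \<in> \<Union>{B. \<exists>S. exit_pair B S}" for p using ex_exit_pair[of p] by auto
    then show ?thesis unfolding F(3) by blast
  qed
  then have "F \<noteq> {}" by auto
  then have rng: "range (from_nat_into F) = F" using F(2) by (rule range_from_nat_into)
  have "\<forall>k. \<exists>S. exit_pair (from_nat_into F k) S" using F(1) rng by blast
  from choice[OF this] obtain S where "\<forall>k. exit_pair (from_nat_into F k) (S k)" ..
  moreover have "\<exists>k. p \<in> from_nat_into F k" for p 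
  proof -
    have "p \<in> \<Union>F" by (simp add: cov)
    then obtain X where "X \<in> F" "p \<in> X" by (rule UnionE)
    then have "X \<in> range (from_nat_into F)" by (simp only: rng)
    then obtain k where "from_nat_into F k = X" by (rule rangeE) simp
    then show ?thesis using \<open>p \<in> X\<close> by blast
  qed
  ultimately show thesis by (intro that) blast+
qed

text \<open>Each step leaves the cover element of least index containing the current point. If the chain
  converged, some index \<open>k\<close> would occur infinitely often, and the limit would lie in \<open>closure (B k)\<close>
  as well as in \<open>S k\<close>.\<close>
lemma causal_chain_of_Aplus:
  assumes yz: "(y, z) \<in> Ap" "(y, z) \<notin> J"
  shows "\<exists>Y. Y 0 = y \<and> (\<forall>i. (Y i, Y (Suc i)) \<in> Cr) \<and> \<not> convergent Y \<and> (\<forall>i. (Y i, z) \<in> Ap)"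
proof -
  obtain B S where BS: "\<And>k::nat. exit_pair (B k) (S k)" "\<And>p. \<exists>k. p \<in> B k"
    by (rule countable_exit_pairs) blast
  define k where "k = (\<lambda>p. LEAST k. p \<in> B k)"
  have k: "p \<in> B (k p)" for p unfolding k_def using BS(2) by (rule LeastI_ex)
  have k_le: "k p \<le> m" if "p \<in> B m" for p m unfolding k_def using that by (rule Least_le)
  \<comment> \<open>The invariant of the chain. Its second half keeps the construction going: a
    later point with \<open>(q, z) \<in> J\<close> would give \<open>(p, z) \<in> J\<close> for its
    predecessor.\<close>
  define P where "P = (\<lambda>p. (p, z) \<in> Ap \<and> (p, z) \<notin> J)"
  have "\<exists>Y. Y 0 = y \<and> (\<forall>i. P (Y i) \<and> (Y i, Y (Suc i)) \<in> Cr \<and> Y (Suc i) \<in> S (k (Y i)))"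
  proof -
    have "\<exists>Y. \<forall>i. (P (Y i) \<and> (i = 0 \<longrightarrow> Y i = y)) \<and> ((Y i, Y (Suc i)) \<in> Cr \<and> Y (Suc i) \<in> S (k (Y i)))"
    proof (rule dependent_nat_choice)
      show "\<exists>p. P p \<and> ((0::nat) = 0 \<longrightarrow> p = y)" using yz by (auto simp: P_def)
      fix p and i :: nat assume "P p \<and> (i = 0 \<longrightarrow> p = y)"
      then have p: "(p, z) \<in> Ap" "(p, z) \<notin> J" by (auto simp: P_def)
      obtain q where q: "q \<in> S (k p)" "(p, q) \<in> Cr" "(q, z) \<in> Ap"
        using BS(1)[of "k p"] k[of p] p unfolding exit_pair_def by blast
      have "(q, z) \<notin> J" using p(2) q(2) Jplus_trans[of p q z] by (auto simp: Jplus_eq)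
      then show "\<exists>q. (P q \<and> (Suc i = 0 \<longrightarrow> q = y)) \<and> (p, q) \<in> Cr \<and> q \<in> S (k p)" using q by (auto simp: P_def)
    qed
    then show ?thesis by blast
  qed
  then obtain Y where Y: "Y 0 = y" "\<And>i. P (Y i)" "\<And>i. (Y i, Y (Suc i)) \<in> Cr" "\<And>i. Y (Suc i) \<in> S (k (Y i))" by blast
  have "\<not> convergent Y"
  proof
    assume "convergent Y"
    then obtain p where p: "Y \<longlonglongrightarrow> p" by (auto simp: convergent_def)
    obtain m where m: "p \<in> B m" using BS(2) by blast
    have "\<forall>\<^sub>F i in sequentially. Y i \<in> B m"
      using p BS(1)[of m] m by (intro topological_tendstoD) (auto simp: exit_pair_def)
    then obtain N where N: "\<And>i. i \<ge> N \<Longrightarrow> Y i \<in> B m" unfolding eventually_sequentially by blast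
    \<comment> \<open>Near the limit all points lie in \<open>B m\<close>, so their least indices
      are at most \<open>m\<close>, and one value recurs.\<close>
    have "finite ((\<lambda>i. k (Y i)) ` {N..})" by (rule finite_subset[of _ "{..m}"]) (use N k_le in auto)
    then obtain i0 where "infinite {i \<in> {N..}. k (Y i) = k (Y i0)}"
      using pigeonhole_infinite[of "{N..}" "\<lambda>i. k (Y i)"] infinite_Ici by blast
    then obtain r :: "nat \<Rightarrow> nat" where r: "strict_mono r" "\<And>n. k (Y (r n)) = k (Y i0)"
      using infinite_enumerate[of "{i \<in> {N..}. k (Y i) = k (Y i0)}"] by auto
    define K where "K = k (Y i0)"
    have "(\<lambda>n. Y (r n)) \<longlonglongrightarrow> p" using LIMSEQ_subseq_LIMSEQ[OF p r(1)] by (simp add: o_def)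
    moreover have "Y (r n) \<in> B K" for n using k[of "Y (r n)"] by (simp add: r(2) K_def)
    ultimately have "p \<in> closure (B K)" unfolding closure_sequential by (intro exI[of _ "\<lambda>n. Y (r n)"]) auto
    moreover have "p \<in> S K"
    proof (rule closed_sequentially)
      show "closed (S K)" using BS(1)[of K] by (simp add: exit_pair_def)
      show "Y (Suc (r n)) \<in> S K" for n using Y(4)[of "r n"] by (simp add: r(2) K_def)
      show "(\<lambda>n. Y (Suc (r n))) \<longlonglongrightarrow> p"
        using LIMSEQ_subseq_LIMSEQ[OF LIMSEQ_Suc[OF p] r(1)] by (simp add: o_def)
    qed
    ultimately show False using BS(1)[of K] by (auto simp: exit_pair_def)
  qed
  then show ?thesis using Y by (auto simp: P_def)
qed

text \<open>Curves between consecutive points are glued over the integers. A limit of the curve at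
  either end would be a limit of the corresponding chain, so the curve is inextendible and hence not
  achronal. The related points \<open>\<Gamma> s\<close> and \<open>\<Gamma> t\<close> may come in
  any order: it suffices that some \<open>Z i\<close> precedes the first and some \<open>Y j\<close>
  follows the second.\<close>

lemma no_line_chains:
  assumes noline: "\<not> (\<exists>\<gamma> I. lightlike_line A gm T \<gamma> I)"
    and Y: "\<And>i. (Y i, Y (Suc i)) \<in> Cr" "\<not> convergent Y"
    and Z: "\<And>i. (Z (Suc i), Z i) \<in> Cr" "\<not> convergent Z" and "Z 0 = Y 0"
  obtains i j where "(Z i, Y j) \<in> I"
proof -
  define X where "X = (\<lambda>k::int. if k \<ge> 0 then Y (nat k) else Z (nat (- k)))"
  have XY: "X (int i) = Y i" and XZ: "X (- int i) = Z i" for i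
    using \<open>Z 0 = Y 0\<close> by (auto simp: X_def)
  have Xstep: "(X k, X (k + 1)) \<in> Cr" for k
  proof (cases "k \<ge> 0")
    case True
    then have "X k = Y (nat k)" "X (k + 1) = Y (Suc (nat k))" by (auto simp: X_def nat_add_distrib)
    then show ?thesis using Y(1) by simp
  next
    case False
    define i where "i = nat (- k - 1)"
    have "k = - int (Suc i)" "k + 1 = - int i" using False by (auto simp: i_def)
    then have "X k = Z (Suc i)" "X (k + 1) = Z i" using XZ by metis+
    then show ?thesis using Z(1) by simp
  qed
  have "\<forall>k. \<exists>\<gamma>. ae_curve A causal_vec \<gamma> (of_int k) (of_int k + 1) \<and> \<gamma> (of_int k) = X k \<and> \<gamma> (of_int k + 1) = X (k + 1)"
  proof
    fix k :: int
    have "of_int k < (of_int k + 1 :: real)" by simp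
    then obtain \<gamma> where "ae_curve A causal_vec \<gamma> (of_int k) (of_int k + 1)" "\<gamma> (of_int k) = X k" "\<gamma> (of_int k + 1) = X (k + 1)"
      by (rule curve_rel_on_interval[OF homogeneous_causal Xstep])
    then show "\<exists>\<gamma>. ae_curve A causal_vec \<gamma> (of_int k) (of_int k + 1) \<and> \<gamma> (of_int k) = X k \<and> \<gamma> (of_int k + 1) = X (k + 1)"
      by blast
  qed
  from choice[OF this] obtain g where g: "\<And>k. ae_curve A causal_vec (g k) (of_int k) (of_int k + 1)"
    "\<And>k. g k (of_int k) = X k" "\<And>k. g k (of_int k + 1) = X (k + 1)" by blast
  define \<Gamma> where "\<Gamma> = (\<lambda>t::real. g \<lfloor>t\<rfloor> t)"
  have \<Gamma>X: "\<Gamma> (of_int k) = X k" for k by (simp add: \<Gamma>_def g)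
  have unit: "ae_curve A causal_vec \<Gamma> (of_int k) (of_int k + 1)" for k
  proof (rule ae_curve_cong[OF g(1)])
    fix t :: real assume t: "t \<in> {of_int k..of_int k + 1}"
    show "g k t = \<Gamma> t"
    \<comment> \<open>At its right endpoint the piece \<open>g k\<close> meets the value that the
      floor assigns to the next piece; both are \<open>X (k + 1)\<close>.\<close>
    proof (cases "t = of_int k + 1")
      case True
      then have "\<Gamma> t = X (k + 1)" using \<Gamma>X[of "k + 1"] by simp
      then show ?thesis using True g(3) by simp
    next
      case False
      then have "\<lfloor>t\<rfloor> = k" using t by (intro floor_unique) auto
      then show ?thesis by (simp add: \<Gamma>_def)
    qed
  qed
  have long: "ae_curve A causal_vec \<Gamma> (of_int k) (of_int k + 1 + real n)" for k n
  proof (induction n)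
    case 0
    then show ?case using unit[of k] by simp
  next
    case (Suc n)
    have "ae_curve A causal_vec \<Gamma> (of_int k + 1 + real n) (of_int k + 1 + real (Suc n))"
      using unit[of "k + 1 + int n"] by (simp add: algebra_simps)
    with Suc show ?case by (rule ae_curve_join)
  qed
  have causal: "ae_curve A causal_vec \<Gamma> a b" if "a < b" for a b
  proof -
    define n where "n = nat \<lceil>b - of_int \<lfloor>a\<rfloor>\<rceil>"
    have "b \<le> of_int \<lfloor>a\<rfloor> + 1 + real n" unfolding n_def by linarith
    moreover have "of_int \<lfloor>a\<rfloor> \<le> a" by simp
    ultimately show ?thesis using that by (intro ae_curve_subinterval[OF long[of "\<lfloor>a\<rfloor>" n]])
  qed
  have top: "\<not> (\<exists>p. (\<Gamma> \<longlongrightarrow> p) at_top)"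
  proof
    assume "\<exists>p. (\<Gamma> \<longlongrightarrow> p) at_top"
    then obtain p where "(\<Gamma> \<longlongrightarrow> p) at_top" by blast
    then have "(\<lambda>n. \<Gamma> (real n)) \<longlonglongrightarrow> p" by (rule filterlim_compose[OF _ filterlim_real_sequentially])
    moreover have "\<Gamma> (real n) = Y n" for n using \<Gamma>X[of "int n"] XY by simp
    ultimately show False using Y(2) by (auto simp: convergent_def)
  qed
  have bot: "\<not> (\<exists>p. (\<Gamma> \<longlongrightarrow> p) at_bot)"
  proof
    assume "\<exists>p. (\<Gamma> \<longlongrightarrow> p) at_bot"
    then obtain p where "(\<Gamma> \<longlongrightarrow> p) at_bot" by blast
    moreover have "filterlim (\<lambda>n. - real n) at_bot sequentially"
      by (simp add: filterlim_uminus_at_bot filterlim_real_sequentially)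
    ultimately have "(\<lambda>n. \<Gamma> (- real n)) \<longlonglongrightarrow> p" by (rule filterlim_compose)
    moreover have "\<Gamma> (- real n) = Z n" for n using \<Gamma>X[of "- int n"] XZ by simp
    ultimately show False using Z(2) by (auto simp: convergent_def)
  qed
  have nb: "\<not> bdd_above (UNIV :: real set)" "\<not> bdd_below (UNIV :: real set)"
    by (auto simp: bdd_above_def bdd_below_def not_le intro: lt_ex gt_ex)
  have "inextendible_causal_curve A gm T \<Gamma> UNIV"
    unfolding inextendible_causal_curve_def
  proof (intro conjI allI impI)
    show "is_interval (UNIV :: real set)" by simp
    show "\<exists>a b. a < b \<and> {a..b} \<subseteq> (UNIV :: real set)" by (intro exI[of _ "0::real"] exI[of _ "1::real"]) simp
  qed (use top bot nb causal in \<open>simp_all add: causal_curve_def\<close>)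
  then have "\<not> achronal A gm T (\<Gamma> ` UNIV)" using noline by (auto simp: lightlike_line_def)
  then obtain s t where st: "(\<Gamma> s, \<Gamma> t) \<in> I" unfolding achronal_def by blast
  obtain i where i: "- s \<le> real i" using real_arch_simple by blast
  obtain j where j: "t \<le> real j" using real_arch_simple by blast
  have pair: "(\<Gamma> a, \<Gamma> b) \<in> J" if "a \<le> b" for a b
    using causal[of a b] that curve_relI[of _ \<Gamma> a b] by (cases "a = b") (auto simp: Jplus_eq)
  have "(Z i, \<Gamma> s) \<in> J" using pair[of "- real i" s] i \<Gamma>X[of "- int i"] XZ[of i] by simp
  moreover have "(\<Gamma> t, Y j) \<in> J" using pair[of t "real j"] j \<Gamma>X[of "int j"] XY[of j] by simp
  ultimately have "(Z i, Y j) \<in> I" using st Jplus_Iplus Iplus_Jplus by blast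
  then show thesis by (rule that)
qed

text \<open>If \<open>(x, y) \<notin> J\<close>, a chain from \<open>x\<close> towards
  \<open>y\<close> stays in the class by transitivity. If only \<open>(y, x) \<notin> J\<close>, the
  chain goes to \<open>y\<close> first and continues towards \<open>x\<close>. If both pairs come
  from causal curves, alternating between the two distinct points does not converge.\<close>

lemma causal_chain_in_class:
  assumes tr: "trans Ap" and xy: "(x, y) \<in> Ap" "(y, x) \<in> Ap" "x \<noteq> y"
  shows "\<exists>Y. Y 0 = x \<and> (\<forall>i. (Y i, Y (Suc i)) \<in> Cr) \<and> \<not> convergent Y \<and> (\<forall>i. (Y i, x) \<in> Ap)"
proof -
  consider "(x, y) \<notin> J" | "(x, y) \<in> Cr" "(y, x) \<notin> J" | "(x, y) \<in> Cr" "(y, x) \<in> Cr"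
    using \<open>x \<noteq> y\<close> by (auto simp: Jplus_eq)
  then show ?thesis
  proof cases
    case 1
    obtain Y where "Y 0 = x" "\<And>i. (Y i, Y (Suc i)) \<in> Cr" "\<not> convergent Y" "\<And>i. (Y i, y) \<in> Ap"
      using causal_chain_of_Aplus[OF xy(1) 1] by blast
    then show ?thesis using transD[OF tr _ xy(2)] by blast
  next
    case 2
    obtain Y where Y: "Y 0 = y" "\<And>i. (Y i, Y (Suc i)) \<in> Cr" "\<not> convergent Y" "\<And>i. (Y i, x) \<in> Ap"
      using causal_chain_of_Aplus[OF xy(2) 2(2)] by blast
    show ?thesis
    proof (intro exI[of _ "case_nat x Y"] conjI allI)
      show "\<not> convergent (case_nat x Y)" using Y(3) convergent_Suc_iff[of "case_nat x Y"] by simp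
      show "(case_nat x Y i, case_nat x Y (Suc i)) \<in> Cr" for i using Y 2(1) by (cases i) auto
      show "(case_nat x Y i, x) \<in> Ap" for i
        using Y(4) Jplus_subset_Aplus by (cases i) (auto simp: Jplus_eq)
    qed simp
  next
    case 3
    show ?thesis
    proof (intro exI[of _ "\<lambda>i. if even i then x else y"] conjI allI)
      show "\<not> convergent (\<lambda>i::nat. if even i then x else y)"
      proof
        assume "convergent (\<lambda>i::nat. if even i then x else y)"
        then obtain l where l: "(\<lambda>i::nat. if even i then x else y) \<longlonglongrightarrow> l" by (auto simp: convergent_def)
        have sm: "strict_mono (\<lambda>i::nat. 2 * i)" "strict_mono (\<lambda>i::nat. 2 * i + 1)" by (auto simp: strict_mono_def)
        have "(\<lambda>i::nat. x) \<longlonglongrightarrow> l" "(\<lambda>i::nat. y) \<longlonglongrightarrow> l"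
          using LIMSEQ_subseq_LIMSEQ[OF l sm(1)] LIMSEQ_subseq_LIMSEQ[OF l sm(2)] by (simp_all add: o_def)
        then show False using \<open>x \<noteq> y\<close> by (metis LIMSEQ_unique tendsto_const)
      qed
    qed (use 3 xy Jplus_subset_Aplus in \<open>auto simp: Jplus_eq\<close>)
  qed
qed

end

section \<open>Transitivity and antisymmetry of the closure\<close>

context spacetime_structure
begin

interpretation dual: spacetime_structure A gm "\<lambda>c x. - T c x"
  by (rule dual_spacetime)

text \<open>Chains exist only for pairs outside \<open>J\<close>. When one of the two pairs lies in
  \<open>J\<close>, push-up already gives the conclusion.\<close>

lemma trans_Aplus:
  assumes noline: "\<not> (\<exists>\<gamma> I. lightlike_line A gm T \<gamma> I)"
  shows "trans Ap"
proof (rule transI)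
  fix x y z assume xy: "(x, y) \<in> Ap" and yz: "(y, z) \<in> Ap"
  consider "(x, y) \<in> J" | "(y, z) \<in> J" | "(x, y) \<notin> J" "(y, z) \<notin> J" by blast
  then show "(x, z) \<in> Ap"
  proof cases
    case 3
    obtain Y where Y: "Y 0 = y" "\<And>i. (Y i, Y (Suc i)) \<in> Cr" "\<not> convergent Y" "\<And>i. (Y i, z) \<in> Ap"
      using causal_chain_of_Aplus[OF yz 3(2)] by blast
    have "(y, x) \<in> dual.Ap" "(y, x) \<notin> dual.J"
      using xy 3(1) by (auto simp: Aplus_dual Jplus_dual)
    then obtain Z where Z: "Z 0 = y" "\<And>i. (Z i, Z (Suc i)) \<in> dual.Cr" "\<not> convergent Z" "\<And>i. (Z i, x) \<in> dual.Ap"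
      using dual.causal_chain_of_Aplus[of y x] by blast
    have Z': "(Z (Suc i), Z i) \<in> Cr" "(x, Z i) \<in> Ap" for i
      using Z(2,4)[of i] by (auto simp: Cr_dual Aplus_dual)
    obtain i j where "(Z i, Y j) \<in> I"
      by (rule no_line_chains[OF noline Y(2,3) Z'(1) Z(3)]) (simp add: Y(1) Z(1))
    then show ?thesis using Aplus_Iplus_Aplus[OF Z'(2) _ Y(4)] by blast
  qed (use xy yz Aplus_Jplus Jplus_Aplus in blast)+
qed

lemma antisym_Aplus:
  assumes noline: "\<not> (\<exists>\<gamma> I. lightlike_line A gm T \<gamma> I)" and chron: "chronological A gm T"
  shows "antisym Ap"
proof (rule antisymI, rule ccontr)
  fix x y assume xy: "(x, y) \<in> Ap" "(y, x) \<in> Ap" "x \<noteq> y"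
  have tr: "trans Ap" using noline by (rule trans_Aplus)
  obtain Y where Y: "Y 0 = x" "\<And>i. (Y i, Y (Suc i)) \<in> Cr" "\<not> convergent Y" "\<And>i. (Y i, x) \<in> Ap"
    using causal_chain_in_class[OF tr xy] by blast
  have "trans (dual.Ap)" using tr by (simp add: Aplus_dual)
  moreover have "(x, y) \<in> dual.Ap" "(y, x) \<in> dual.Ap"
    using xy by (simp_all add: Aplus_dual)
  ultimately obtain Z where Z: "Z 0 = x" "\<And>i. (Z i, Z (Suc i)) \<in> dual.Cr" "\<not> convergent Z" "\<And>i. (Z i, x) \<in> dual.Ap"
    using dual.causal_chain_in_class[of x y] xy(3) by blast
  have Z': "(Z (Suc i), Z i) \<in> Cr" "(x, Z i) \<in> Ap" for i
    using Z(2,4)[of i] by (auto simp: Cr_dual Aplus_dual)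
  obtain i j where ij: "(Z i, Y j) \<in> I"
    by (rule no_line_chains[OF noline Y(2,3) Z'(1) Z(3)]) (simp add: Y(1) Z(1))
  \<comment> \<open>Obtained through \<open>x\<close>. Membership in the closure produces causally
    related points only near \<open>Y j\<close> and \<open>Z i\<close>, so the closed timelike curve
    is based at a nearby \<open>q\<close>; openness of \<open>I\<close> keeps \<open>(p, q)\<close>
    related.\<close>
  have "(Y j, Z i) \<in> Ap" using Y(4) Z'(2) by (rule transD[OF tr])
  moreover obtain P Q where PQ: "open P" "open Q" "Z i \<in> P" "Y j \<in> Q" "P \<times> Q \<subseteq> I"
    by (rule open_prod_elim[OF open_Iplus ij]) auto
  ultimately obtain q p where "q \<in> Q" "p \<in> P" "(q, p) \<in> J" using Aplus_meets[of "Y j" "Z i" Q P] by metis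
  then have "(q, q) \<in> I" using PQ(5) Jplus_Iplus by blast
  then obtain \<gamma> a b where "timelike_curve A gm T \<gamma> a b" "\<gamma> a = q" "\<gamma> b = q" by (auto simp: Iplus_def)
  then show False using chron unfolding chronological_def by metis
qed

text \<open>Transitivity is all that \<open>Ap\<close> lacks to be one of the relations intersected,
  and every closed relation containing \<open>J\<close> contains its closure.\<close>

lemma Kplus_eq_Aplus:
  assumes "trans Ap"
  shows "Kplus A gm T = Ap"
proof
  show "Kplus A gm T \<subseteq> Ap"
    unfolding Kplus_def using assms Jplus_subset_Aplus by (auto simp: Aplus_def)
  show "Ap \<subseteq> Kplus A gm T"
    unfolding Kplus_def Aplus_def by (intro Inter_greatest) (auto intro: closure_minimal[THEN subsetD])
qed

end

theorem theorem5:
  fixes A :: "('m::{t2_space, second_countable_topology}, 'e::euclidean_space) chart set"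
    and gm :: "('m, 'e) chart \<Rightarrow> 'e \<Rightarrow> 'e \<Rightarrow> 'e \<Rightarrow> real"
    and T :: "('m, 'e) chart \<Rightarrow> 'e \<Rightarrow> 'e"
  assumes "spacetime A gm T"
    and "\<not> (\<exists>\<gamma> I. lightlike_line A gm T \<gamma> I)"
  shows "trans (Aplus A gm T) \<and> Kplus A gm T = Aplus A gm T
         \<and> (chronological A gm T \<longrightarrow> K_causal A gm T)"
proof -
  interpret spacetime_structure A gm T by unfold_locales fact
  show ?thesis
    using trans_Aplus[OF assms(2)] Kplus_eq_Aplus antisym_Aplus[OF assms(2)]
    by (simp add: K_causal_def)
qed

end
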